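(* $$b_{34,7}=\left(3\sqrt{2}-\sqrt{17}\right)^2\left(\sqrt{17}-4\right)^2.$$
   Context: For $|q|<1$ put $\varphi(q)=\sum_{k=-\infty}^{\infty}q^{k^2}$ and $\psi(q)=\sum_{k=0}^{\infty}q^{k(k+1)/2}$. For a positive rational number $m$ and a positive integer $n$ define $$b_{m,n}=\frac{n\,e^{-\frac{\pi}{4}(n-1)\sqrt{m/n}}\;\psi^2\!\left(-e^{-\pi\sqrt{mn}}\right)\varphi^2\!\left(-e^{-2\pi\sqrt{mn}}\right)}{\psi^2\!\left(-e^{-\pi\sqrt{m/n}}\right)\varphi^2\!\left(-e^{-2\pi\sqrt{m/n}}\right)}.$$ *)

theory Defs
  imports "HOL-Analysis.Analysis"
begin

text \<open>
  Ramanujan's theta functions. Both sums converge absolutely for \<open>norm q < 1\<close>, the only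
  range in which the definitions are meant to be used. The exponents \<open>k\<^sup>2\<close> (\<open>k\<close> an integer)
  and \<open>k (k + 1) / 2\<close> are natural numbers, so neither \<open>nat\<close> nor \<open>div\<close> loses information.
\<close>

definition ramanujan_phi :: "'a::real_normed_field \<Rightarrow> 'a" where
  "ramanujan_phi q = (\<Sum>\<^sub>\<infinity>k::int. q ^ nat (k\<^sup>2))"

definition ramanujan_psi :: "'a::real_normed_field \<Rightarrow> 'a" where
  "ramanujan_psi q = (\<Sum>k::nat. q ^ (k * (k + 1) div 2))"

text \<open>Meant for \<open>m > 0\<close> and \<open>n > 0\<close>.\<close>

definition b :: "rat \<Rightarrow> nat \<Rightarrow> real" where
  "b m n =
     (let m' = real_of_rat m; n' = real n in
        (n' * exp (- (pi / 4) * (n' - 1) * sqrt (m' / n'))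
           * (ramanujan_psi (- exp (- pi * sqrt (m' * n'))))\<^sup>2
           * (ramanujan_phi (- exp (- 2 * pi * sqrt (m' * n'))))\<^sup>2)
        / ((ramanujan_psi (- exp (- pi * sqrt (m' / n'))))\<^sup>2
           * (ramanujan_phi (- exp (- 2 * pi * sqrt (m' / n'))))\<^sup>2))"

end

theory Submission
  imports Defs "HOL-Number_Theory.Number_Theory"
begin

text \<open>
  The proof is Kronecker's limit formula for genus characters, made elementary.
  By the triple product, \<open>\<psi>(-q) \<phi>(-q\<^sup>2)\<close> is the product of all \<open>(1 - q\<^sup>n) (1 - q\<^bsup>2n\<^esup>)\<close>, so
  \<open>ln b\<close> is, up to elementary terms, the limit at \<open>s = 1\<close> of the Epstein zeta functions of the
  forms \<open>x\<^sup>2 + 238 y\<^sup>2\<close> and \<open>2 x\<^sup>2 + 119 y\<^sup>2\<close> minus those of \<open>7 x\<^sup>2 + 34 y\<^sup>2\<close> and \<open>14 x\<^sup>2 + 17 y\<^sup>2\<close>: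
  summing over \<open>x\<close> first turns each of them into a series of hyperbolic cotangents.

  These four forms are the 2-torsion of the class group \<open>\<int>/4 \<times> \<int>/2\<close> of discriminant \<open>-952\<close>, and
  the chosen signs are half the sum of the two genus characters that are \<open>-1\<close> on the prime above
  \<open>7\<close>. Hence the combination equals
  \<open>L(s, \<chi>\<^sub>1\<^sub>7) L(s, \<chi>\<^sub>-\<^sub>5\<^sub>6) + L(s, \<chi>\<^sub>1\<^sub>3\<^sub>6) L(s, \<chi>\<^sub>-\<^sub>7)\<close>. The values at \<open>s = 1\<close> of the two real characters are
  logarithms of the units \<open>4 + \<surd>17\<close> and \<open>(3 \<surd>2 + \<surd>17)\<^sup>2\<close>; those of the two imaginary ones are
  rational multiples of \<open>\<pi>/\<surd>14\<close> and \<open>\<pi>/\<surd>7\<close>.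
\<close>

subsection \<open>The Jacobi triple product\<close>

text \<open>In the signed combination the coefficients of the poles at s = 1 cancel, but their
  derivative does not: it is a multiple of ln 49 and produces the factor 7 in \<open>b\<close>. The
  rows y = 0 contribute multiples of zeta(2), which become the exponential prefactor.
  Representations are counted through square roots of -238 modulo n: a primitive representation
  determines a root, and every root comes from one reduced form. For n prime to 238, chi8 decides
  whether that form is diagonal, and chi17 decides which pair of diagonal forms it belongs to. So
  the signed count is (1 + chi8) chi17 times the number of roots, and expanding 1 + chi8 gives the
  two products of L-series. All double series are rearranged only for real s > 1, where they
  converge absolutely; s then tends to 1 from the right. The L-series converge only conditionally at
  1, so their values come from Abel summation of logarithmic series whose coefficients are Gauss sum
  expansions of the characters.\<close>

definition euler_fn :: "real \<Rightarrow> real" where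
  "euler_fn q = exp (\<Sum>n. ln (1 - q ^ Suc n))"

lemma abs_ln_one_minus_le:
  fixes x q :: real
  assumes "0 \<le> x" "x \<le> q" "q < 1"
  shows "\<bar>ln (1 - x)\<bar> \<le> x / (1 - q)"
proof -
  have "- ln (1 - x) = ln (1 / (1 - x))" using assms by (simp add: ln_div)
  also have "\<dots> \<le> 1 / (1 - x) - 1" using assms by (intro ln_le_minus_one) auto
  also have "\<dots> = x / (1 - x)" using assms by (simp add: field_simps)
  also have "\<dots> \<le> x / (1 - q)" using assms by (intro divide_left_mono mult_pos_pos) auto
  finally show ?thesis using assms by (simp add: abs_if)
qed

lemma summable_ln_euler:
  fixes q :: real
  assumes "0 \<le> q" "q < 1"
  shows "summable (\<lambda>n. ln (1 - q ^ Suc n))"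
proof (rule summable_comparison_test')
  show "summable (\<lambda>n. q ^ Suc n / (1 - q))"
    using assms by (intro summable_divide summable_ignore_initial_segment[of _ 1, simplified] summable_geometric) auto
  show "norm (ln (1 - q ^ Suc n)) \<le> q ^ Suc n / (1 - q)" if "n \<ge> 0" for n
    unfolding real_norm_def using assms by (intro abs_ln_one_minus_le) (auto simp: mult_le_cancel_left1 power_le_one intro: mult_left_le)
qed

lemma euler_fn_pos: "euler_fn q > 0"
  by (simp add: euler_fn_def)

text \<open>Encoding the infinite product through its logarithm makes positivity and
  \<open>ln\<close> immediate; this lemma recovers the product itself.\<close>

lemma euler_fn_LIMSEQ:
  assumes "0 \<le> q" "q < 1"
  shows "(\<lambda>N. \<Prod>k<N. 1 - q ^ Suc k) \<longlonglongrightarrow> euler_fn q"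
proof -
  have "(\<lambda>N. exp (\<Sum>k<N. ln (1 - q ^ Suc k))) \<longlonglongrightarrow> euler_fn q"
    unfolding euler_fn_def by (intro tendsto_exp summable_LIMSEQ summable_ln_euler assms)
  moreover have "exp (\<Sum>k<N. ln (1 - q ^ Suc k)) = (\<Prod>k<N. 1 - q ^ Suc k)" for N
    using assms by (simp add: exp_sum del: power_Suc) (intro prod.cong refl exp_ln, simp add: power_less_one_iff del: power_Suc)
  ultimately show ?thesis by simp
qed

text \<open>The q-Pochhammer symbol (t; t)_m.\<close>

definition qfact :: "real \<Rightarrow> nat \<Rightarrow> real" where "qfact t m = (\<Prod>i<m. 1 - t ^ Suc i)"

text \<open>The lower bound by the infinite product is uniform in m and dominates the Gaussian
  binomials when n tends to infinity in the triple product.\<close>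

lemma qfact_bounds:
  assumes "0 \<le> t" "t < 1"
  shows "0 < qfact t m" "qfact t m \<le> 1" "euler_fn t \<le> qfact t m"
proof -
  have f: "0 < 1 - t ^ Suc i" "1 - t ^ Suc i \<le> 1" for i
    using assms by (auto simp: power_less_one_iff simp del: power_Suc)
  show pos: "0 < qfact t m" for m unfolding qfact_def by (intro prod_pos) (use f in auto)
  show "qfact t m \<le> 1" unfolding qfact_def by (intro prod_le_1) (use f in \<open>auto intro: less_imp_le\<close>)
  have "decseq (qfact t)"
  proof (rule decseq_SucI)
    fix n show "qfact t (Suc n) \<le> qfact t n"
      using mult_left_mono[OF f(2)[of n], of "qfact t n"] pos[of n] by (simp add: qfact_def)
  qed
  moreover have "qfact t \<longlonglongrightarrow> euler_fn t" using euler_fn_LIMSEQ[OF assms] by (simp add: qfact_def[abs_def])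
  ultimately show "euler_fn t \<le> qfact t m" by (rule decseq_ge)
qed

text \<open>Gaussian binomial coefficients by the q-Pascal rule, which involves no division.\<close>

fun qbin :: "real \<Rightarrow> nat \<Rightarrow> nat \<Rightarrow> real" where
  "qbin t 0 0 = 1"
| "qbin t 0 (Suc k) = 0"
| "qbin t (Suc n) 0 = 1"
| "qbin t (Suc n) (Suc k) = qbin t n (Suc k) + t ^ (n - k) * qbin t n k"

lemma qbin_0 [simp]: "qbin t n 0 = 1" by (cases n) auto

lemma qbin_zero: "k > n \<Longrightarrow> qbin t n k = 0"
  by (induction t n k rule: qbin.induct) auto

text \<open>Stated as a product so that the induction needs no condition on t; the quotient form
  follows once t lies in [0, 1).\<close>

lemma qbin_qfact: "k \<le> n \<Longrightarrow> qbin t n k * (qfact t k * qfact t (n - k)) = qfact t n"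
proof (induction t n k rule: qbin.induct)
  case (4 t n k)
  then have kn: "k \<le> n" by simp
  have IH2: "qbin t n k * (qfact t k * qfact t (n - k)) = qfact t n" using 4 kn by simp
  have s: "qfact t (Suc m) = qfact t m * (1 - t ^ Suc m)" for m by (simp add: qfact_def)
  show ?case
  proof (cases "Suc k \<le> n")
    case True
    then have nk: "n - k = Suc (n - Suc k)" by simp
    have IH1: "qbin t n (Suc k) * (qfact t (Suc k) * qfact t (n - Suc k)) = qfact t n" using 4 True by simp
    have "qbin t (Suc n) (Suc k) * (qfact t (Suc k) * qfact t (Suc n - Suc k))
      = (qbin t n (Suc k) * (qfact t (Suc k) * qfact t (n - Suc k))) * (1 - t ^ (n - k))
        + t ^ (n - k) * (1 - t ^ Suc k) * (qbin t n k * (qfact t k * qfact t (n - k)))"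
    proof -
      have s1: "qfact t (n - k) = qfact t (n - Suc k) * (1 - t ^ (n - k))" using s[of "n - Suc k"] nk by simp
      show ?thesis unfolding qbin.simps diff_Suc_Suc s1 s[of k] by (simp add: algebra_simps)
    qed
    also have "\<dots> = qfact t n * (1 - t ^ (n - k) * t ^ Suc k)"
      unfolding IH1 IH2 by (simp add: algebra_simps)
    also have "t ^ (n - k) * t ^ Suc k = t ^ Suc n" using kn by (simp add: power_add[symmetric] del: power_Suc)
    finally show ?thesis using s[of n] by simp
  next
    case False
    then have "k = n" using kn by simp
    have q0: "qfact t 0 = 1" by (simp add: qfact_def)
    have h: "qbin t n n * qfact t n = qfact t n" using IH2 \<open>k = n\<close> q0 by simp
    have "qbin t (Suc n) (Suc k) * (qfact t (Suc k) * qfact t (Suc n - Suc k)) = (qbin t n n * qfact t n) * (1 - t ^ Suc n)"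
      unfolding \<open>k = n\<close> s[of n] by (simp add: qbin_zero q0)
    then show ?thesis unfolding h s[of n] .
  qed
qed (auto simp: qfact_def)

lemma qbin_eq:
  assumes "0 \<le> t" "t < 1" "k \<le> n"
  shows "qbin t n k = qfact t n / (qfact t k * qfact t (n - k))"
  using qbin_qfact[OF assms(3), of t] qfact_bounds(1)[OF assms(1,2), of k] qfact_bounds(1)[OF assms(1,2), of "n - k"]
  by (simp add: field_simps)

text \<open>Rothe's finite q-binomial theorem. The base is a square so that the triangular exponent
  becomes j (j - 1) in Q, without halves.\<close>

lemma qbinomial_theorem:
  fixes Q x :: real
  shows "(\<Prod>k<N. 1 + x * Q ^ (2 * k)) = (\<Sum>j\<le>N. Q ^ (j * (j - 1)) * qbin (Q\<^sup>2) N j * x ^ j)"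
proof (induction N)
  case (Suc N)
  let ?b = "qbin (Q\<^sup>2)"
  have "(\<Sum>j\<le>Suc N. Q ^ (j * (j - 1)) * ?b (Suc N) j * x ^ j)
     = 1 + (\<Sum>j\<le>N. Q ^ (Suc j * j) * ?b (Suc N) (Suc j) * x ^ Suc j)"
    by (subst sum.atMost_Suc_shift) simp
  also have "\<dots> = (1 + (\<Sum>j\<le>N. Q ^ (Suc j * j) * ?b N (Suc j) * x ^ Suc j))
     + (\<Sum>j\<le>N. Q ^ (Suc j * j) * (Q\<^sup>2) ^ (N - j) * ?b N j * x ^ Suc j)"
    by (simp add: sum.distrib[symmetric] algebra_simps)
  also have "1 + (\<Sum>j\<le>N. Q ^ (Suc j * j) * ?b N (Suc j) * x ^ Suc j) = (\<Sum>j\<le>Suc N. Q ^ (j * (j - 1)) * ?b N j * x ^ j)"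
    by (subst sum.atMost_Suc_shift) simp
  also have "\<dots> = (\<Sum>j\<le>N. Q ^ (j * (j - 1)) * ?b N j * x ^ j)"
    by (simp add: qbin_zero)
  also have "(\<Sum>j\<le>N. Q ^ (Suc j * j) * (Q\<^sup>2) ^ (N - j) * ?b N j * x ^ Suc j)
     = (\<Sum>j\<le>N. x * Q ^ (2 * N) * (Q ^ (j * (j - 1)) * ?b N j * x ^ j))"
  proof (rule sum.cong[OF refl])
    fix j assume "j \<in> {..N}"
    then have "Suc j * j + 2 * (N - j) = 2 * N + j * (j - 1)"
      by (cases j) (auto simp: algebra_simps)
    then have "Q ^ (Suc j * j) * (Q\<^sup>2) ^ (N - j) = Q ^ (2 * N) * Q ^ (j * (j - 1))"
      by (metis power_add power_mult)
    then show "Q ^ (Suc j * j) * (Q\<^sup>2) ^ (N - j) * ?b N j * x ^ Suc j = x * Q ^ (2 * N) * (Q ^ (j * (j - 1)) * ?b N j * x ^ j)"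
      by simp
  qed
  also have "\<dots> = x * Q ^ (2 * N) * (\<Sum>j\<le>N. Q ^ (j * (j - 1)) * ?b N j * x ^ j)"
    by (simp add: sum_distrib_left)
  finally show ?case using Suc by (simp add: algebra_simps)
qed simp

lemma finite_jacobi_triple_product:
  fixes Q z :: real
  assumes Q: "0 < Q" "Q < 1" and z: "z \<noteq> 0"
  shows "(\<Prod>k<n. (1 + z * Q ^ (2 * k + 1)) * (1 + Q ^ (2 * k + 1) / z))
    = qbin (Q\<^sup>2) (2 * n) n + (\<Sum>j<n. qbin (Q\<^sup>2) (2 * n) (n + Suc j) * Q ^ ((Suc j)\<^sup>2) * (z ^ Suc j + (1 / z) ^ Suc j))"
proof -
  \<comment> \<open>With z Q^(1 - 2n) the 2n factors split in the middle: those with k >= n are the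
    1 + z Q^(2k+1), those with k < n become, after reversal, multiples of 1 + Q^(2k+1) / z.\<close>
  define x where "x = z * Q / Q ^ (2 * n)"
  define b where "b = qbin (Q\<^sup>2) (2 * n)"
  \<comment> \<open>The prefactor removes the product of the z / Q^(2k+1) split off from the lower
    half; after it the exponent of Q is the square of the distance from j to n.\<close>
  define T where "T j = Q ^ n\<^sup>2 / z ^ n * (Q ^ (j * (j - 1)) * b j * x ^ j)" for j
  have pw: "Q ^ (j * (j - 1)) * Q ^ j = Q ^ (j * j)" for j
  proof -
    have "j * (j - 1) + j = j * j" by (cases j) auto
    then show ?thesis by (metis power_add)
  qed
  have xj: "Q ^ (j * (j - 1)) * x ^ j = z ^ j * Q ^ (j * j) / Q ^ (2 * n * j)" for j
    unfolding pw[symmetric] by (simp add: x_def power_divide power_mult_distrib power_mult)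
  have Tp: "T (n + m) = b (n + m) * Q ^ m\<^sup>2 * z ^ m" for m
  proof -
    have e: "n\<^sup>2 + (n + m) * (n + m) = m\<^sup>2 + 2 * n * (n + m)" by (simp add: power2_eq_square algebra_simps)
    have "Q ^ n\<^sup>2 * Q ^ ((n + m) * (n + m)) = Q ^ m\<^sup>2 * Q ^ (2 * n * (n + m))"
      unfolding power_add[symmetric] e ..
    then have "Q ^ n\<^sup>2 * Q ^ ((n + m) * (n + m)) / Q ^ (2 * n * (n + m)) = Q ^ m\<^sup>2" using Q by simp
    moreover have "T (n + m) = b (n + m) * (z ^ (n + m) / z ^ n) * (Q ^ n\<^sup>2 * Q ^ ((n + m) * (n + m)) / Q ^ (2 * n * (n + m)))"
      using xj[of "n + m"] unfolding T_def by (simp add: mult_ac)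
    ultimately show ?thesis using z by (simp add: power_add)
  qed
  have Tm: "T (n - m) = b (n - m) * Q ^ m\<^sup>2 * (1 / z) ^ m" if "m \<le> n" for m
  proof -
    define k where "k = n - m"
    have k: "n = k + m" using that by (simp add: k_def)
    have e: "n\<^sup>2 + k * k = m\<^sup>2 + 2 * n * k" by (simp add: k power2_eq_square algebra_simps)
    have "Q ^ n\<^sup>2 * Q ^ (k * k) = Q ^ m\<^sup>2 * Q ^ (2 * n * k)"
      unfolding power_add[symmetric] e ..
    then have B: "Q ^ n\<^sup>2 * Q ^ (k * k) / Q ^ (2 * n * k) = Q ^ m\<^sup>2" using Q by simp
    have A: "T k = b k * (z ^ k / z ^ n) * (Q ^ n\<^sup>2 * Q ^ (k * k) / Q ^ (2 * n * k))"
      using xj[of k] unfolding T_def by (simp add: mult_ac)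
    have C: "z ^ k / z ^ n = (1 / z) ^ m" using z by (simp add: k power_add power_one_over)
    show ?thesis unfolding k_def[symmetric] A B C by (simp only: mult_ac)
  qed
  \<comment> \<open>Symmetry of the binomials about the middle index lets z^m and z^(-m) share a
    coefficient.\<close>
  have bsym: "b (n - m) = b (n + m)" if "m \<le> n" for m
  proof -
    have t: "0 \<le> Q\<^sup>2" "Q\<^sup>2 < 1" using Q by (auto simp: power_less_one_iff)
    have "2 * n - (n - m) = n + m" "2 * n - (n + m) = n - m" using that by auto
    then show ?thesis using qbin_eq[OF t, of "n - m" "2 * n"] qbin_eq[OF t, of "n + m" "2 * n"] that
      by (simp add: b_def mult.commute)
  qed
  have "(\<Prod>k<2 * n. 1 + x * Q ^ (2 * k)) = (\<Prod>k<n. 1 + x * Q ^ (2 * k)) * (\<Prod>k<n. 1 + x * Q ^ (2 * (n + k)))"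
  proof -
    have "{..<2 * n} = {..<n} \<union> {n..<n + n}" by auto
    moreover have "(\<Prod>k\<in>{n..<n + n}. 1 + x * Q ^ (2 * k)) = (\<Prod>k<n. 1 + x * Q ^ (2 * (n + k)))"
      using prod.shift_bounds_nat_ivl[of "\<lambda>k. 1 + x * Q ^ (2 * k)" 0 n n] by (simp add: lessThan_atLeast0 add.commute)
    ultimately show ?thesis by (simp add: prod.union_disjoint ivl_disj_int)
  qed
  also have "(\<Prod>k<n. 1 + x * Q ^ (2 * (n + k))) = (\<Prod>k<n. 1 + z * Q ^ (2 * k + 1))"
    using Q by (intro prod.cong refl) (simp add: x_def power_add distrib_left)
  also have "(\<Prod>k<n. 1 + x * Q ^ (2 * k)) = (\<Prod>k<n. 1 + x * Q ^ (2 * (n - Suc k)))"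
    by (rule prod.nat_diff_reindex[symmetric])
  also have "\<dots> = (\<Prod>k<n. (z / Q ^ (2 * k + 1)) * (1 + Q ^ (2 * k + 1) / z))"
  proof (rule prod.cong[OF refl])
    fix k assume "k \<in> {..<n}"
    then have "2 * n = 2 * (n - Suc k) + (2 * k + 2)" by auto
    then have "Q ^ (2 * n) = Q ^ (2 * (n - Suc k)) * Q ^ (2 * k + 2)" by (metis power_add)
    then have "x * Q ^ (2 * (n - Suc k)) = z * Q / Q ^ (2 * k + 2)" using Q by (simp add: x_def)
    also have "\<dots> = z / Q ^ (2 * k + 1)" using Q by simp
    finally show "1 + x * Q ^ (2 * (n - Suc k)) = (z / Q ^ (2 * k + 1)) * (1 + Q ^ (2 * k + 1) / z)"
      using Q z by (simp add: field_simps)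
  qed
  also have "\<dots> = (\<Prod>k<n. z / Q ^ (2 * k + 1)) * (\<Prod>k<n. 1 + Q ^ (2 * k + 1) / z)"
    by (rule prod.distrib)
  also have "(\<Prod>k<n. z / Q ^ (2 * k + 1)) = z ^ n / Q ^ n\<^sup>2"
  proof (induction n)
    case (Suc n)
    have "(Suc n)\<^sup>2 = n\<^sup>2 + (2 * n + 1)" by (simp add: power2_eq_square)
    then have "Q ^ (Suc n)\<^sup>2 = Q ^ n\<^sup>2 * Q ^ (2 * n + 1)" by (metis power_add)
    then show ?case using Suc by simp
  qed simp
  finally have "(\<Prod>k<2 * n. 1 + x * Q ^ (2 * k)) * (Q ^ n\<^sup>2 / z ^ n)
      = (\<Prod>k<n. 1 + Q ^ (2 * k + 1) / z) * (\<Prod>k<n. 1 + z * Q ^ (2 * k + 1))"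
    using Q z by simp
  then have "(\<Prod>k<n. (1 + z * Q ^ (2 * k + 1)) * (1 + Q ^ (2 * k + 1) / z))
     = (\<Prod>k<2 * n. 1 + x * Q ^ (2 * k)) * (Q ^ n\<^sup>2 / z ^ n)"
    by (simp add: prod.distrib mult.commute)
  also have "\<dots> = (\<Sum>j\<le>2 * n. T j)"
    unfolding qbinomial_theorem T_def b_def by (simp add: sum_distrib_left sum_distrib_right mult_ac)
  also have "{..2 * n} = ({..<n} \<union> {n}) \<union> {Suc n..<Suc n + n}" by auto
  also have "sum T \<dots> = (\<Sum>j<n. T j) + T n + (\<Sum>j\<in>{Suc n..<Suc n + n}. T j)"
    by (subst sum.union_disjoint; auto)+
  also have "(\<Sum>j<n. T j) = (\<Sum>j<n. T (n - Suc j))" by (rule sum.nat_diff_reindex[symmetric])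
  also have "(\<Sum>j\<in>{Suc n..<Suc n + n}. T j) = (\<Sum>j<n. T (n + Suc j))"
    using sum.shift_bounds_nat_ivl[of T 0 "Suc n" n] by (simp add: lessThan_atLeast0 add.commute)
  also have "(\<Sum>j<n. T (n - Suc j)) = (\<Sum>j<n. b (n + Suc j) * Q ^ (Suc j)\<^sup>2 * (1 / z) ^ Suc j)"
    using Tm bsym by (intro sum.cong refl) (simp del: power_Suc)
  also have "(\<Sum>j<n. T (n + Suc j)) = (\<Sum>j<n. b (n + Suc j) * Q ^ (Suc j)\<^sup>2 * z ^ Suc j)"
    using Tp by (intro sum.cong refl) (simp del: power_Suc add_Suc_right)
  also have "T n = b n" using Tp[of 0] by simp
  finally show ?thesis
    by (simp add: b_def[symmetric] distrib_left sum.distrib del: power_Suc add_Suc_right)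
qed

text \<open>Dominated convergence in the finite identity. The summability hypothesis is on the
  combined term, which is what the applications check directly.\<close>

lemma jacobi_triple_product:
  fixes Q z :: real
  assumes Q: "0 < Q" "Q < 1" and z: "z \<noteq> 0"
    and sm: "summable (\<lambda>j. Q ^ (Suc j)\<^sup>2 * \<bar>z ^ Suc j + (1 / z) ^ Suc j\<bar>)"
  shows "(\<lambda>n. (\<Prod>k<n. 1 - Q ^ (2 * k + 2)) * (\<Prod>k<n. (1 + z * Q ^ (2 * k + 1)) * (1 + Q ^ (2 * k + 1) / z)))
    \<longlonglongrightarrow> 1 + (\<Sum>j. Q ^ (Suc j)\<^sup>2 * (z ^ Suc j + (1 / z) ^ Suc j))"
proof -
  let ?t = "Q\<^sup>2"
  define E where "E = euler_fn ?t"
  have t: "0 \<le> ?t" "?t < 1" using Q by (auto simp: power_less_one_iff)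
  have E0: "E > 0" by (simp add: E_def euler_fn_pos)
  have qlim: "qfact ?t \<longlonglongrightarrow> E" using euler_fn_LIMSEQ[OF t] by (simp add: qfact_def[abs_def] E_def)
  have blim: "(\<lambda>n. qbin ?t (2 * n) (n + m)) \<longlonglongrightarrow> 1 / E" for m
  proof (rule Lim_transform_eventually)
    have "filterlim (\<lambda>n. 2 * n) at_top (at_top :: nat filter)" "filterlim (\<lambda>n. n - m) at_top (at_top :: nat filter)"
      "filterlim (\<lambda>n. n + m) at_top (at_top :: nat filter)"
      by (auto intro: filterlim_subseq filterlim_minus_const_nat_at_top filterlim_add_const_nat_at_top simp: strict_mono_def)
    then show "(\<lambda>n. qfact ?t (2 * n) / (qfact ?t (n + m) * qfact ?t (n - m))) \<longlonglongrightarrow> 1 / E"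
      using E0 by (auto intro!: tendsto_eq_intros filterlim_compose[OF qlim])
    show "\<forall>\<^sub>F n in sequentially. qfact ?t (2 * n) / (qfact ?t (n + m) * qfact ?t (n - m)) = qbin ?t (2 * n) (n + m)"
      using eventually_ge_at_top[of m]
    proof eventually_elim
      case (elim n)
      then have "2 * n - (n + m) = n - m" by simp
      then show ?case using qbin_eq[OF t, of "n + m" "2 * n"] elim by simp
    qed
  qed
  have bbd: "\<bar>qbin ?t (2 * n) (n + m)\<bar> \<le> 1 / (E * E)" for n m
  proof (cases "m \<le> n")
    case True
    note b = qfact_bounds[OF t]
    have "2 * n - (n + m) = n - m" by simp
    then have "qbin ?t (2 * n) (n + m) = qfact ?t (2 * n) / (qfact ?t (n + m) * qfact ?t (n - m))"
      using qbin_eq[OF t, of "n + m" "2 * n"] True by simp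
    also have "\<dots> \<le> 1 / (E * E)"
      using b E0 by (intro frac_le mult_mono) (auto simp: E_def less_imp_le)
    finally show ?thesis
      using qbin_eq[OF t, of "n + m" "2 * n"] True b(1) by (simp add: less_imp_le)
  next
    case False
    then show ?thesis using E0 by (simp add: qbin_zero)
  qed
  \<comment> \<open>Extending the finite sum by zero turns it into a series over all j, the shape
    required for dominated convergence.\<close>
  define a where "a j n = (if j < n then qbin ?t (2 * n) (n + Suc j) * Q ^ (Suc j)\<^sup>2 * (z ^ Suc j + (1 / z) ^ Suc j) else 0)" for j n
  define c where "c j = Q ^ (Suc j)\<^sup>2 * (z ^ Suc j + (1 / z) ^ Suc j)" for j
  have lim: "(\<lambda>n. \<Sum>j. a j n) \<longlonglongrightarrow> (\<Sum>j. (1 / E) * c j)"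
  proof (rule conjunct2[OF conjunct2[OF tannerys_theorem]])
    show "(\<lambda>n. a j n) \<longlonglongrightarrow> (1 / E) * c j" for j
    proof (rule Lim_transform_eventually)
      show "(\<lambda>n. qbin ?t (2 * n) (n + Suc j) * c j) \<longlonglongrightarrow> (1 / E) * c j"
        by (intro tendsto_mult blim tendsto_const)
      show "\<forall>\<^sub>F n in sequentially. qbin ?t (2 * n) (n + Suc j) * c j = a j n"
        using eventually_gt_at_top[of j] by eventually_elim (simp add: a_def c_def)
    qed
    have "norm (a j n) \<le> 1 / (E * E) * \<bar>c j\<bar>" for j n
    proof (cases "j < n")
      case True
      then have "norm (a j n) = \<bar>qbin ?t (2 * n) (n + Suc j)\<bar> * \<bar>c j\<bar>"
        by (simp add: a_def c_def abs_mult)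
      also have "\<dots> \<le> 1 / (E * E) * \<bar>c j\<bar>" by (rule mult_right_mono[OF bbd]) simp
      finally show ?thesis .
    qed (use E0 in \<open>simp add: a_def\<close>)
    then show "\<forall>\<^sub>F (j, n) in sequentially \<times>\<^sub>F sequentially. norm (a j n) \<le> 1 / (E * E) * \<bar>c j\<bar>"
      by (intro always_eventually) auto
    show "summable (\<lambda>j. 1 / (E * E) * \<bar>c j\<bar>)"
      using sm Q by (intro summable_mult) (simp add: c_def abs_mult)
  qed simp
  have "(\<lambda>n. qfact ?t n * (qbin ?t (2 * n) (n + 0) + (\<Sum>j. a j n))) \<longlonglongrightarrow> E * (1 / E + (\<Sum>j. (1 / E) * c j))"
    by (intro tendsto_mult tendsto_add qlim blim lim)
  also have "E * (1 / E + (\<Sum>j. (1 / E) * c j)) = 1 + (\<Sum>j. c j)"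
  proof -
    have "summable (\<lambda>j. \<bar>c j\<bar>)" using sm Q by (simp add: c_def abs_mult)
    then have "summable c" by (rule summable_rabs_cancel)
    then have "(\<Sum>j. (1 / E) * c j) = (1 / E) * (\<Sum>j. c j)" by (rule suminf_mult)
    then show ?thesis using E0 by (simp add: field_simps)
  qed
  finally have *: "(\<lambda>n. qfact ?t n * (qbin ?t (2 * n) (n + 0) + (\<Sum>j. a j n))) \<longlonglongrightarrow> 1 + (\<Sum>j. c j)" .
  have "(\<Sum>j. a j n) = (\<Sum>j<n. a j n)" for n
    by (rule suminf_finite) (auto simp: a_def)
  then have "qbin ?t (2 * n) (n + 0) + (\<Sum>j. a j n) = (\<Prod>k<n. (1 + z * Q ^ (2 * k + 1)) * (1 + Q ^ (2 * k + 1) / z))" for n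
    unfolding finite_jacobi_triple_product[OF Q z] by (simp add: a_def)
  moreover have "qfact ?t n = (\<Prod>k<n. 1 - Q ^ (2 * k + 2))" for n
    unfolding qfact_def power_mult[symmetric] by simp
  ultimately show ?thesis using * by (simp add: c_def)
qed

section \<open>Theta functions as quotients of Euler products\<close>

lemma prod_pairs:
  fixes f :: "nat \<Rightarrow> real"
  shows "(\<Prod>k<2 * n. f k) = (\<Prod>k<n. f (2 * k) * f (2 * k + 1))"
  by (induction n) (auto simp: mult_ac)

lemma filterlim_double: "filterlim (\<lambda>n::nat. 2 * n) at_top at_top"
  by (rule filterlim_subseq) (simp add: strict_mono_def)

lemma odd_product_LIMSEQ:
  fixes q :: real
  assumes q: "0 < q" "q < 1"
  shows "(\<lambda>n. \<Prod>k<n. 1 - q ^ (2 * k + 1)) \<longlonglongrightarrow> euler_fn q / euler_fn (q\<^sup>2)"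
proof (rule Lim_transform_eventually)
  have q2: "0 \<le> q\<^sup>2" "q\<^sup>2 < 1" using q by (auto simp: power_less_one_iff)
  show "(\<lambda>n. (\<Prod>k<2 * n. 1 - q ^ Suc k) / (\<Prod>k<n. 1 - (q\<^sup>2) ^ Suc k)) \<longlonglongrightarrow> euler_fn q / euler_fn (q\<^sup>2)"
    using q euler_fn_pos[of "q\<^sup>2"]
    by (intro tendsto_divide filterlim_compose[OF euler_fn_LIMSEQ filterlim_double] euler_fn_LIMSEQ q2) auto
  have "(\<Prod>k<n. 1 - (q\<^sup>2) ^ Suc k) \<noteq> 0" for n
    by (metis qfact_def qfact_bounds(1)[OF q2] less_irrefl)
  moreover have "(\<Prod>k<2 * n. 1 - q ^ Suc k) = (\<Prod>k<n. 1 - q ^ (2 * k + 1)) * (\<Prod>k<n. 1 - (q\<^sup>2) ^ Suc k)" for n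
    unfolding prod_pairs prod.distrib power_mult[symmetric] by simp
  ultimately show "\<forall>\<^sub>F n in sequentially. (\<Prod>k<2 * n. 1 - q ^ Suc k) / (\<Prod>k<n. 1 - (q\<^sup>2) ^ Suc k) = (\<Prod>k<n. 1 - q ^ (2 * k + 1))"
    by (intro always_eventually allI) (metis nonzero_mult_div_cancel_right)
qed

lemma summable_power_square:
  fixes Q :: real
  assumes "0 < Q" "Q < 1"
  shows "summable (\<lambda>j. Q ^ (Suc j)\<^sup>2)"
proof (rule summable_comparison_test')
  show "summable (\<lambda>j. Q ^ j)" using assms by (intro summable_geometric) auto
  show "norm (Q ^ (Suc j)\<^sup>2) \<le> Q ^ j" if "j \<ge> 0" for j
  proof -
    have "j \<le> (Suc j)\<^sup>2" by (simp add: power2_eq_square)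
    then show ?thesis using assms by (simp add: power_decreasing del: power_Suc)
  qed
qed

text \<open>Links unordered sums over the integers, as in \<open>ramanujan_phi\<close> and in the
  lattice sums below, with ordinary series.\<close>

lemma has_sum_int_even:
  fixes f :: "int \<Rightarrow> real"
  assumes "\<And>k. f (- k) = f k" "summable (\<lambda>n. \<bar>f (int (Suc n))\<bar>)"
  shows "(f has_sum f 0 + 2 * (\<Sum>n. f (int (Suc n)))) UNIV"
proof -
  have hs: "((\<lambda>n. f (int (Suc n))) has_sum (\<Sum>n. f (int (Suc n)))) UNIV"
    using assms(2) by (intro norm_summable_imp_has_sum) (auto intro: summable_sums summable_rabs_cancel)
  have p: "(f has_sum (\<Sum>n. f (int (Suc n)))) {0<..}"
  proof -
    have "((\<lambda>n. f (int (Suc n))) has_sum (\<Sum>n. f (int (Suc n)))) UNIV = (f has_sum (\<Sum>n. f (int (Suc n)))) {0<..}"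
      by (rule has_sum_reindex_bij_witness[of _ "\<lambda>k. nat k - 1" "\<lambda>n. int (Suc n)"]) auto
    then show ?thesis using hs by simp
  qed
  have n: "(f has_sum (\<Sum>n. f (int (Suc n)))) {..<0}"
  proof -
    have "(f has_sum (\<Sum>n. f (int (Suc n)))) {0<..} = (f has_sum (\<Sum>n. f (int (Suc n)))) {..<0}"
      by (rule has_sum_reindex_bij_witness[of _ uminus uminus]) (auto simp: assms(1))
    then show ?thesis using p by simp
  qed
  have z: "(f has_sum f 0) {0}" using has_sum_finite[of "{0::int}" f] by simp
  have "(f has_sum (f 0 + (\<Sum>n. f (int (Suc n))) + (\<Sum>n. f (int (Suc n))))) (({0} \<union> {0<..}) \<union> {..<0})"
    by (intro has_sum_Un_disjoint z p n) auto
  moreover have "({0} \<union> {0<..}) \<union> {..<0} = (UNIV :: int set)" by auto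
  ultimately show ?thesis by (simp add: add.commute)
qed

text \<open>The triple product at z = -1, where the two odd products coincide.\<close>

lemma ramanujan_phi_product:
  fixes q :: real
  assumes q: "0 < q" "q < 1"
  shows "ramanujan_phi (- q) = (euler_fn q)\<^sup>2 / euler_fn (q\<^sup>2)"
proof -
  have e: "(-1) ^ Suc j + (1 / -1) ^ Suc j = 2 * (-1::real) ^ Suc j" for j by simp
  have sq: "(-1::real) ^ (Suc j)\<^sup>2 = (-1) ^ Suc j" for j
    by (simp add: power2_eq_square power_mult minus_one_power_iff)
  have sm: "summable (\<lambda>j. q ^ (Suc j)\<^sup>2 * \<bar>(-1) ^ Suc j + (1 / -1) ^ Suc j\<bar>)"
    unfolding e using summable_mult2[OF summable_power_square[OF q], of 2] by (simp add: abs_mult power_abs)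
  have J0: "(\<lambda>n. (\<Prod>k<n. 1 - q ^ (2 * k + 2)) * (\<Prod>k<n. (1 + (-1) * q ^ (2 * k + 1)) * (1 + q ^ (2 * k + 1) / (-1))))
    \<longlonglongrightarrow> 1 + (\<Sum>j. q ^ (Suc j)\<^sup>2 * ((-1) ^ Suc j + (1 / -1) ^ Suc j))"
    by (rule jacobi_triple_product[OF q _ sm]) simp
  have fac: "(\<Prod>k<n. 1 - q ^ (2 * k + 2)) * (\<Prod>k<n. (1 + (-1) * q ^ (2 * k + 1)) * (1 + q ^ (2 * k + 1) / (-1)))
     = (\<Prod>k<n. 1 - (q\<^sup>2) ^ Suc k) * ((\<Prod>k<n. 1 - q ^ (2 * k + 1)) * (\<Prod>k<n. 1 - q ^ (2 * k + 1)))" for n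
    unfolding power_mult[symmetric] prod.distrib[symmetric] by simp
  have lim: "(\<lambda>n. (\<Prod>k<n. 1 - (q\<^sup>2) ^ Suc k) * ((\<Prod>k<n. 1 - q ^ (2 * k + 1)) * (\<Prod>k<n. 1 - q ^ (2 * k + 1))))
     \<longlonglongrightarrow> euler_fn (q\<^sup>2) * (euler_fn q / euler_fn (q\<^sup>2) * (euler_fn q / euler_fn (q\<^sup>2)))"
    using q by (intro tendsto_mult euler_fn_LIMSEQ odd_product_LIMSEQ) (auto simp: power_less_one_iff)
  have "1 + (\<Sum>j. q ^ (Suc j)\<^sup>2 * ((-1) ^ Suc j + (1 / -1) ^ Suc j))
    = euler_fn (q\<^sup>2) * (euler_fn q / euler_fn (q\<^sup>2) * (euler_fn q / euler_fn (q\<^sup>2)))"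
    by (rule LIMSEQ_unique[OF J0[unfolded fac] lim])
  also have "\<dots> = (euler_fn q)\<^sup>2 / euler_fn (q\<^sup>2)"
    using euler_fn_pos[of "q\<^sup>2"] by (simp add: power2_eq_square)
  finally have J: "1 + (\<Sum>j. q ^ (Suc j)\<^sup>2 * ((-1) ^ Suc j + (1 / -1) ^ Suc j)) = (euler_fn q)\<^sup>2 / euler_fn (q\<^sup>2)" .
  have trm: "(- q) ^ nat ((int (Suc n))\<^sup>2) = (-1) ^ Suc n * q ^ (Suc n)\<^sup>2" for n
  proof -
    have "nat ((int (Suc n))\<^sup>2) = (Suc n)\<^sup>2" by (metis nat_int of_nat_power)
    then show ?thesis using power_minus[of q "(Suc n)\<^sup>2"] sq[of n] by simp
  qed
  have ab: "\<bar>(-1) ^ Suc n * q ^ (Suc n)\<^sup>2\<bar> = q ^ (Suc n)\<^sup>2" for n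
    using q by (simp only: abs_mult power_abs abs_minus_cancel abs_one power_one abs_of_pos zero_less_power mult_1)
  have s2: "summable (\<lambda>n. (-1) ^ Suc n * q ^ (Suc n)\<^sup>2)"
    by (rule summable_rabs_cancel) (simp only: ab summable_power_square[OF q])
  have "ramanujan_phi (- q) = (- q) ^ nat (0\<^sup>2) + 2 * (\<Sum>n. (- q) ^ nat ((int (Suc n))\<^sup>2))"
    unfolding ramanujan_phi_def
  proof (rule infsumI[OF has_sum_int_even])
    show "summable (\<lambda>n. \<bar>(- q) ^ nat ((int (Suc n))\<^sup>2)\<bar>)"
      unfolding trm ab by (rule summable_power_square[OF q])
  qed simp
  also have "\<dots> = 1 + (\<Sum>n. 2 * ((-1) ^ Suc n * q ^ (Suc n)\<^sup>2))"
    unfolding trm using suminf_mult[OF s2, of 2] by simp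
  also have "\<dots> = 1 + (\<Sum>j. q ^ (Suc j)\<^sup>2 * ((-1) ^ Suc j + (1 / -1) ^ Suc j))"
    unfolding e by (simp add: mult_ac)
  finally show ?thesis using J by simp
qed

text \<open>The triple product with base q^2 and z = -q; consecutive terms of the triangular series
  are the terms for z^m and z^(-m).\<close>

lemma ramanujan_psi_product:
  fixes q :: real
  assumes q: "0 < q" "q < 1"
  shows "ramanujan_psi (- q) = euler_fn q * euler_fn (q ^ 4) / euler_fn (q\<^sup>2)"
proof -
  define f where "f k = (- q) ^ (k * (k + 1) div 2)" for k :: nat
  have Q: "0 < q\<^sup>2" "q\<^sup>2 < 1" using q by (auto simp: power_less_one_iff)
  have fsm: "summable (\<lambda>k. \<bar>f k\<bar>)"
  proof (rule summable_comparison_test')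
    show "summable (\<lambda>j. q ^ j)" using q by (intro summable_geometric) auto
    show "norm \<bar>f j\<bar> \<le> q ^ j" if "j \<ge> 0" for j
    proof -
      have "j \<le> j * (j + 1) div 2" by (cases j) auto
      then show ?thesis using q by (simp add: f_def power_abs power_decreasing)
    qed
  qed
  have fsum: "summable f" using fsm by (rule summable_rabs_cancel)
  \<comment> \<open>With m = j + 1 the triangular numbers of index 2j + 1 and 2j + 2 are 2 m^2 - m
    and 2 m^2 + m.\<close>
  have pair: "f (Suc (2 * j)) + f (Suc (2 * j + 1)) = (q\<^sup>2) ^ (Suc j)\<^sup>2 * ((- q) ^ Suc j + (1 / - q) ^ Suc j)" for j
  proof -
    let ?m = "Suc j"
    have e1: "Suc (2 * j) * (Suc (2 * j) + 1) div 2 = (2 * j + 1) * ?m"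
      by (simp add: algebra_simps)
    have e2: "Suc (2 * j + 1) * (Suc (2 * j + 1) + 1) div 2 = 2 * ?m\<^sup>2 + ?m"
    proof -
      have "Suc (2 * j + 1) * (Suc (2 * j + 1) + 1) = 2 * (2 * ?m\<^sup>2 + ?m)"
        by (simp add: power2_eq_square algebra_simps)
      then show ?thesis by simp
    qed
    have p: "(- q) ^ (2 * ?m\<^sup>2) = (q\<^sup>2) ^ ?m\<^sup>2" by (simp add: power_mult)
    have "(2 * j + 1) * ?m + ?m = 2 * ?m\<^sup>2" by (simp add: power2_eq_square algebra_simps)
    then have *: "(- q) ^ ((2 * j + 1) * ?m) * (- q) ^ ?m = (q\<^sup>2) ^ ?m\<^sup>2"
      unfolding p[symmetric] by (metis power_add)
    have "(1 / - q) ^ ?m = 1 / (- q) ^ ?m" by (rule power_one_over)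
    moreover have "(- q) ^ ?m \<noteq> 0" using q by simp
    ultimately have f1: "f (Suc (2 * j)) = (q\<^sup>2) ^ ?m\<^sup>2 * (1 / - q) ^ ?m"
      using * unfolding f_def e1 by (metis nonzero_eq_divide_eq times_divide_eq_right mult_1_right)
    have f2: "f (Suc (2 * j + 1)) = (q\<^sup>2) ^ ?m\<^sup>2 * (- q) ^ ?m"
      unfolding f_def e2 power_add p ..
    show ?thesis unfolding f1 f2 by (simp only: distrib_left add.commute)
  qed
  have g: "(\<lambda>j. f (Suc (2 * j)) + f (Suc (2 * j + 1))) sums (\<Sum>k. f (Suc k))"
  proof -
    have "(\<lambda>k. f (Suc k)) sums (\<Sum>k. f (Suc k))" using fsum by (simp add: summable_sums summable_Suc_iff)
    from sums_group[OF this, of 2] show ?thesis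
      by (simp add: mult.commute numeral_2_eq_2)
  qed
  have gabs: "summable (\<lambda>j. \<bar>f (Suc (2 * j)) + f (Suc (2 * j + 1))\<bar>)"
  proof (rule summable_comparison_test')
    have "(\<lambda>k. \<bar>f (Suc k)\<bar>) sums (\<Sum>k. \<bar>f (Suc k)\<bar>)"
      using fsm summable_Suc_iff[of "\<lambda>k. \<bar>f k\<bar>"] by (simp add: summable_sums)
    from sums_group[OF this, of 2] show "summable (\<lambda>j. \<bar>f (Suc (2 * j))\<bar> + \<bar>f (Suc (2 * j + 1))\<bar>)"
      by (simp add: mult.commute numeral_2_eq_2 sums_iff)
  qed simp
  have sm: "summable (\<lambda>j. (q\<^sup>2) ^ (Suc j)\<^sup>2 * \<bar>(- q) ^ Suc j + (1 / - q) ^ Suc j\<bar>)"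
    using gabs unfolding pair by (simp only: abs_mult power_abs power2_abs)
  have J: "(\<lambda>n. (\<Prod>k<n. 1 - (q\<^sup>2) ^ (2 * k + 2)) * (\<Prod>k<n. (1 + (- q) * (q\<^sup>2) ^ (2 * k + 1)) * (1 + (q\<^sup>2) ^ (2 * k + 1) / (- q))))
    \<longlonglongrightarrow> 1 + (\<Sum>j. (q\<^sup>2) ^ (Suc j)\<^sup>2 * ((- q) ^ Suc j + (1 / - q) ^ Suc j))"
    by (rule jacobi_triple_product[OF Q _ sm]) (use q in simp)
  have fac: "(\<Prod>k<n. 1 - (q\<^sup>2) ^ (2 * k + 2)) * (\<Prod>k<n. (1 + (- q) * (q\<^sup>2) ^ (2 * k + 1)) * (1 + (q\<^sup>2) ^ (2 * k + 1) / (- q)))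
     = (\<Prod>k<n. 1 - (q ^ 4) ^ Suc k) * (\<Prod>k<2 * n. 1 - q ^ (2 * k + 1))" for n
  proof -
    have p1: "(q\<^sup>2) ^ (2 * k + 2) = (q ^ 4) ^ Suc k" for k
    proof -
      have "2 * (2 * k + 2) = 4 * Suc k" by simp
      then show ?thesis by (metis power_mult)
    qed
    \<comment> \<open>The two kinds of factors carry the exponents 4k + 1 and 4k + 3; together they
      run through all odd exponents, which is why the product has 2n factors.\<close>
    have p2: "(1 + (- q) * (q\<^sup>2) ^ (2 * k + 1)) * (1 + (q\<^sup>2) ^ (2 * k + 1) / (- q))
       = (1 - q ^ (2 * (2 * k) + 1)) * (1 - q ^ (2 * (2 * k + 1) + 1))" for k
    proof -
      have "q * (q\<^sup>2) ^ (2 * k + 1) = q ^ (2 * (2 * k + 1) + 1)"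
        unfolding power_mult[symmetric] by simp
      moreover have "(q\<^sup>2) ^ (2 * k + 1) = q ^ (2 * (2 * k) + 1) * q"
        unfolding power_mult[symmetric] by simp
      then have "(q\<^sup>2) ^ (2 * k + 1) / (- q) = - (q ^ (2 * (2 * k) + 1))" using q by simp
      ultimately show ?thesis by simp
    qed
    show ?thesis unfolding prod_pairs p1 p2 ..
  qed
  have "(\<lambda>n. (\<Prod>k<n. 1 - (q ^ 4) ^ Suc k) * (\<Prod>k<2 * n. 1 - q ^ (2 * k + 1)))
     \<longlonglongrightarrow> euler_fn (q ^ 4) * (euler_fn q / euler_fn (q\<^sup>2))"
    using q by (intro tendsto_mult euler_fn_LIMSEQ filterlim_compose[OF odd_product_LIMSEQ filterlim_double])
       (auto simp: power_less_one_iff)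
  with J have "1 + (\<Sum>j. (q\<^sup>2) ^ (Suc j)\<^sup>2 * ((- q) ^ Suc j + (1 / - q) ^ Suc j)) = euler_fn (q ^ 4) * (euler_fn q / euler_fn (q\<^sup>2))"
    unfolding fac using LIMSEQ_unique by blast
  moreover have "ramanujan_psi (- q) = 1 + (\<Sum>j. (q\<^sup>2) ^ (Suc j)\<^sup>2 * ((- q) ^ Suc j + (1 / - q) ^ Suc j))"
  proof -
    have "ramanujan_psi (- q) = (\<Sum>k. f k)" by (simp only: ramanujan_psi_def f_def)
    also have "\<dots> = (\<Sum>k. f (Suc k)) + f 0" using suminf_split_head[OF fsum] by linarith
    also have "(\<Sum>k. f (Suc k)) = (\<Sum>j. (q\<^sup>2) ^ (Suc j)\<^sup>2 * ((- q) ^ Suc j + (1 / - q) ^ Suc j))"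
      using sums_unique[OF g] unfolding pair .
    also have "f 0 = 1" by (simp add: f_def)
    finally show ?thesis by (simp only: add.commute)
  qed
  ultimately show ?thesis by simp
qed

text \<open>The factors at q^4 cancel, so the quotient in \<open>b\<close> becomes one of Euler
  products at four points.\<close>

lemma psi_phi_product:
  fixes q :: real
  assumes q: "0 < q" "q < 1"
  shows "ramanujan_psi (- q) * ramanujan_phi (- q\<^sup>2) = euler_fn q * euler_fn (q\<^sup>2)"
proof -
  have "0 < q\<^sup>2" "q\<^sup>2 < 1" using q by (auto simp: power_less_one_iff)
  from ramanujan_phi_product[OF this] ramanujan_psi_product[OF q] show ?thesis
    using euler_fn_pos[of "q\<^sup>2"] euler_fn_pos[of "q ^ 4"] by (simp add: power2_eq_square power4_eq_xxxx mult.assoc)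
qed

subsection \<open>Quadratic characters\<close>

text \<open>The Legendre symbol modulo 7, which is the Kronecker character of discriminant
  -7.\<close>

definition chi7 :: "nat \<Rightarrow> int" where
  "chi7 n = (if n mod 7 = 0 then 0 else if n mod 7 \<in> {1,2,4} then 1 else -1)"

text \<open>The Kronecker character of discriminant 8, n -> (2/n).\<close>

definition chi8 :: "nat \<Rightarrow> int" where
  "chi8 n = (if even n then 0 else if n mod 8 \<in> {1,7} then 1 else -1)"

definition chi17 :: "nat \<Rightarrow> int" where
  "chi17 n = (if n mod 17 = 0 then 0 else if n mod 17 \<in> {1,2,4,8,9,13,15,16} then 1 else -1)"

lemma chi7_mod: "chi7 (n mod 7) = chi7 n" by (simp add: chi7_def)
lemma chi8_mod: "chi8 (n mod 8) = chi8 n"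
proof -
  have "even (n mod 8) = even n" by presburger
  then show ?thesis by (simp add: chi8_def)
qed
lemma chi17_mod: "chi17 (n mod 17) = chi17 n" by (simp add: chi17_def)

lemma chi7_mult: "chi7 (m * n) = chi7 m * chi7 n"
proof -
  have "\<forall>i\<in>set [0..<7]. \<forall>j\<in>set [0..<7]. chi7 (i * j) = chi7 i * chi7 j"
    by code_simp
  then have "chi7 ((m mod 7) * (n mod 7)) = chi7 (m mod 7) * chi7 (n mod 7)" by simp
  then show ?thesis by (metis chi7_mod mod_mult_eq)
qed

lemma chi8_mult: "chi8 (m * n) = chi8 m * chi8 n"
proof -
  have "\<forall>i\<in>set [0..<8]. \<forall>j\<in>set [0..<8]. chi8 (i * j) = chi8 i * chi8 j"
    by code_simp
  then have "chi8 ((m mod 8) * (n mod 8)) = chi8 (m mod 8) * chi8 (n mod 8)" by simp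
  then show ?thesis by (metis chi8_mod mod_mult_eq)
qed

lemma chi17_mult: "chi17 (m * n) = chi17 m * chi17 n"
proof -
  have "\<forall>i\<in>set [0..<17]. \<forall>j\<in>set [0..<17]. chi17 (i * j) = chi17 i * chi17 j"
    by code_simp
  then have "chi17 ((m mod 17) * (n mod 17)) = chi17 (m mod 17) * chi17 (n mod 17)" by simp
  then show ?thesis by (metis chi17_mod mod_mult_eq)
qed

section \<open>Legendre symbols and reciprocity\<close>

lemma Legendre_cases: "Legendre a p \<in> {-1, 0, 1}"
  by (simp add: Legendre_def)

lemma cong_sign_imp_eq:
  fixes u v :: int
  assumes "u \<in> {-1,0,1}" "v \<in> {-1,0,1}" "[u = v] (mod p)" "p > 2"
  shows "u = v"
proof -
  have "p dvd u - v" using assms(3) by (simp add: cong_iff_dvd_diff)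
  then have "u - v = 0 \<or> p \<le> \<bar>u - v\<bar>" by (metis abs_of_pos assms(4) dvd_imp_le_int dual_order.strict_trans zero_less_numeral)
  then show ?thesis using assms by auto
qed

lemma Legendre_eqI:
  assumes "prime p" "2 < p" "v \<in> {-1,0,1}" "[v = a ^ ((p - 1) div 2)] (mod int p)"
  shows "Legendre a (int p) = v"
  using cong_sign_imp_eq[OF Legendre_cases assms(3), of a "int p" "int p"]
    euler_criterion[OF assms(1,2), of a] assms(2,4) by (metis cong_sym cong_trans int_ops(3) of_nat_less_iff)

lemma Legendre_mult:
  fixes a b :: int
  assumes "prime p" "2 < p"
  shows "Legendre (a * b) (int p) = Legendre a (int p) * Legendre b (int p)"
proof (rule Legendre_eqI[OF assms])
  show "Legendre a (int p) * Legendre b (int p) \<in> {-1,0,1}"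
    using Legendre_cases[of a p] Legendre_cases[of b p] by auto
  show "[Legendre a (int p) * Legendre b (int p) = (a * b) ^ ((p - 1) div 2)] (mod int p)"
    using cong_mult[OF euler_criterion[OF assms, of a] euler_criterion[OF assms, of b]]
    by (simp add: power_mult_distrib)
qed

lemma Legendre_minus_one:
  assumes "prime p" "2 < p"
  shows "Legendre (-1) (int p) = (-1) ^ ((p - 1) div 2)"
  by (rule Legendre_eqI[OF assms]) (auto simp: minus_one_power_iff)

text \<open>Gauss's lemma: with h = (p - 1) / 2, the doubles of 1, ..., h that exceed h are those of
  the upper half, h - h div 2 in number.\<close>

lemma Legendre_two:
  assumes "prime p" "2 < p"
  shows "Legendre 2 (int p) = chi8 p"
proof -
  have odd: "odd p" using assms prime_odd_nat by blast
  interpret GAUSS p 2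
  proof
    have "\<not> p dvd 2" using assms by (auto dest: dvd_imp_le)
    then show "[2 \<noteq> 0] (mod int p)"
      by (metis cong_0_iff int_dvd_int_iff of_nat_numeral)
  qed (use assms in auto)
  define h where "h = (p - 1) div 2"
  have ph: "p = 2 * h + 1" using odd h_def by (metis add_diff_cancel_right' dvd_def nonzero_mult_div_cancel_left odd_two_times_div_two_succ zero_neq_numeral)
  have hh: "(int p - 1) div 2 = int h" using ph by simp
  have E: "E = (\<lambda>x. 2 * x) ` {int (h div 2) <.. int h}"
  proof -
    have "C = (\<lambda>x. 2 * x) ` {0 <.. int h}"
      unfolding C_def B_def A_def hh image_image
      by (rule image_cong) (auto simp: ph)
    moreover have "(int h < 2 * x) = (int (h div 2) < x)" for x by (simp add: zdiv_int) presburger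
    ultimately show ?thesis unfolding E_def hh by auto
  qed
  have "card E = nat (int h - int (h div 2))"
    unfolding E by (subst card_image) (auto simp: inj_on_def)
  also have "\<dots> = h - h div 2" by simp
  finally have "Legendre 2 (int p) = (-1) ^ (h - h div 2)" using gauss_lemma by simp
  \<comment> \<open>The parity depends only on h modulo 4, that is, on p modulo 8.\<close>
  moreover have "even (h - h div 2) \<longleftrightarrow> p mod 8 \<in> {1, 7}"
  proof -
    define k r where "k = h div 4" and "r = h mod 4"
    have h: "h = 4 * k + r" and "r < 4" by (simp_all add: k_def r_def)
    then have "r \<in> {0,1,2,3}" by auto
    moreover have "(4 * k + 3) div 2 = 2 * k + 1" by simp
    ultimately show ?thesis by (auto simp: ph h)
  qed
  ultimately show ?thesis using odd by (auto simp: chi8_def minus_one_power_iff)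
qed

lemma Legendre_7: "Legendre (int n) 7 = chi7 n"
proof -
  have "[chi7 n = int n ^ 3] (mod 7)"
  proof -
    have "\<forall>i\<in>set [0..<7]. (chi7 i) mod 7 = (int i ^ 3) mod 7"
      by code_simp
    then have "[chi7 n = int (n mod 7) ^ 3] (mod 7)"
      using chi7_mod[of n] by (auto simp: cong_def dest!: bspec[of _ _ "n mod 7"])
    also have "[int (n mod 7) ^ 3 = int n ^ 3] (mod 7)"
      by (simp add: cong_def zmod_int power_mod)
    finally show ?thesis .
  qed
  then show ?thesis using Legendre_eqI[of 7 "chi7 n" "int n"] by (simp add: chi7_def)
qed

lemma Legendre_17: "Legendre (int n) 17 = chi17 n"
proof -
  have "[chi17 n = int n ^ 8] (mod 17)"
  proof -
    have "\<forall>i\<in>set [0..<17]. (chi17 i) mod 17 = (int i ^ 8) mod 17"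
      by code_simp
    then have "[chi17 n = int (n mod 17) ^ 8] (mod 17)"
      using chi17_mod[of n] by (auto simp: cong_def dest!: bspec[of _ _ "n mod 17"])
    also have "[int (n mod 17) ^ 8 = int n ^ 8] (mod 17)"
      by (simp add: cong_def zmod_int power_mod)
    finally show ?thesis .
  qed
  then show ?thesis using Legendre_eqI[of 17 "chi17 n" "int n"] by (simp add: chi17_def)
qed

text \<open>In -238 = (-1) * 2 * 7 * 17 the sign from reciprocity at 7 cancels the symbol of -1, and
  17, being 1 modulo 4, produces no sign.\<close>

lemma Legendre_minus_238:
  assumes "prime p" "p \<notin> {2, 7, 17}"
  shows "Legendre (-238) (int p) = chi8 p * chi7 p * chi17 p"
proof -
  have p2: "2 < p" using assms prime_ge_2_nat[OF assms(1)] by auto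
  note m = Legendre_mult[OF assms(1) p2]
  define h where "h = (p - 1) div 2"
  have "Legendre (int p) (int 7) * Legendre (int 7) (int p) = (-1) ^ (h * 3)"
    using Quadratic_Reciprocity[of p 7] assms p2 by (simp add: h_def)
  then have "chi7 p * Legendre 7 (int p) = (-1) ^ (h * 3)"
    using Legendre_7[of p] by simp
  moreover have "((-1)::int) ^ (h * 3) = (-1) ^ h" by (simp add: minus_one_power_iff)
  ultimately have e7: "chi7 p * Legendre 7 (int p) = (-1) ^ h" by simp
  have "Legendre (int p) (int 17) * Legendre (int 17) (int p) = (-1) ^ (h * 8)"
    using Quadratic_Reciprocity[of p 17] assms p2 by (simp add: h_def)
  then have e17: "chi17 p * Legendre 17 (int p) = 1"
    using Legendre_17[of p] by simp
  have sq: "((-1)::int) ^ h * (-1) ^ h = 1" by (simp add: minus_one_power_iff)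
  have "chi7 p * chi7 p = 1"
  proof -
    have "chi7 p \<noteq> 0" using e7 by auto
    then show ?thesis by (simp add: chi7_def split: if_splits)
  qed
  then have "Legendre 7 (int p) = chi7 p * (-1) ^ h"
    using e7 by (metis mult.assoc mult_1)
  moreover have "Legendre 17 (int p) = chi17 p"
    using e17 by (metis mult.assoc mult.commute mult_1 zmult_eq_1_iff)
  moreover have "Legendre (-238) (int p) =
      Legendre (-1) (int p) * Legendre 2 (int p) * Legendre 7 (int p) * Legendre 17 (int p)"
    using m[of "-1" 238] m[of 2 119] m[of 7 17] by simp
  ultimately have "Legendre (-238) (int p) = ((-1) ^ h * (-1) ^ h) * (chi8 p * chi7 p * chi17 p)"
    unfolding Legendre_two[OF assms(1) p2] Legendre_minus_one[OF assms(1) p2] h_def[symmetric]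
    by (simp only: mult_ac)
  then show ?thesis unfolding sq by simp
qed

section \<open>Square roots modulo n\<close>

definition roots :: "int \<Rightarrow> nat \<Rightarrow> int set" where
  "roots D n = {x \<in> {0..<int n}. [x\<^sup>2 = D] (mod int n)}"

lemma finite_roots [simp]: "finite (roots D n)"
  by (rule finite_subset[of _ "{0..<int n}"]) (auto simp: roots_def)

lemma roots_one [simp]: "roots D (Suc 0) = {0}"
  by (auto simp: roots_def)

lemma card_roots_mult:
  assumes "coprime m n" "m > 0" "n > 0"
  shows "card (roots D (m * n)) = card (roots D m) * card (roots D n)"
proof -
  have cop: "coprime (int m) (int n)" using assms(1) by simp
  have "bij_betw (\<lambda>x. (x mod int m, x mod int n)) (roots D (m * n)) (roots D m \<times> roots D n)"
  proof (intro bij_betw_imageI inj_onI equalityI subsetI)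
    fix x y assume xy: "x \<in> roots D (m * n)" "y \<in> roots D (m * n)"
      "(x mod int m, x mod int n) = (y mod int m, y mod int n)"
    then have "[x = y] (mod int m * int n)"
      using cop by (intro coprime_cong_mult) (auto simp: cong_def)
    then show "x = y" using xy by (auto simp: roots_def cong_def)
  next
    fix z assume "z \<in> (\<lambda>x. (x mod int m, x mod int n)) ` roots D (m * n)"
    then obtain x where x: "[x\<^sup>2 = D] (mod int m * int n)" "z = (x mod int m, x mod int n)"
      by (auto simp: roots_def)
    have "[x\<^sup>2 = D] (mod int m)" "[x\<^sup>2 = D] (mod int n)"
      using x(1) by (auto simp: cong_iff_dvd_diff intro: dvd_mult_left dvd_mult_right)
    then show "z \<in> roots D m \<times> roots D n"
      using x(2) assms by (auto simp: roots_def cong_def power_mod)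
  next
    fix z assume "z \<in> roots D m \<times> roots D n"
    then obtain u v where z: "z = (u, v)" "u \<in> roots D m" "v \<in> roots D n" by auto
    obtain w where w: "[w = u] (mod int m)" "[w = v] (mod int n)"
      using binary_chinese_remainder_int[OF cop] by blast
    define x where "x = w mod (int m * int n)"
    have xu: "[x = u] (mod int m)" and xv: "[x = v] (mod int n)"
      using w by (auto simp: x_def cong_def mod_mod_cancel)
    have "[x\<^sup>2 = D] (mod int m)" "[x\<^sup>2 = D] (mod int n)"
      using z cong_pow[OF xu, of 2] cong_pow[OF xv, of 2] by (auto simp: roots_def intro: cong_trans)
    then have "[x\<^sup>2 = D] (mod int m * int n)" using cop by (intro coprime_cong_mult)
    then have "x \<in> roots D (m * n)" using assms by (simp add: roots_def x_def)
    moreover have "x mod int m = u" "x mod int n = v"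
      using xu xv z by (auto simp: roots_def cong_def)
    ultimately show "z \<in> (\<lambda>x. (x mod int m, x mod int n)) ` roots D (m * n)"
      using z(1) by force
  qed
  from bij_betw_same_card[OF this] show ?thesis by (simp add: card_cartesian_product)
qed

lemma hensel_sqrt:
  assumes "prime p" "2 < p" "\<not> int p dvd D" "QuadRes (int p) D"
  shows "\<exists>x. [x\<^sup>2 = D] (mod int p ^ Suc k)"
proof (induction k)
  case 0
  then show ?case using assms(4) by (auto simp: QuadRes_def)
next
  case (Suc k)
  then obtain x where "int p ^ Suc k dvd x\<^sup>2 - D" by (auto simp: cong_iff_dvd_diff)
  then obtain t where t: "x\<^sup>2 - D = int p ^ Suc k * t" by auto
  have pp: "prime (int p)" using assms(1) by simp
  have "\<not> int p dvd x"
  proof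
    assume "int p dvd x"
    then have "int p dvd x\<^sup>2" by (simp add: power2_eq_square)
    moreover have "int p dvd x\<^sup>2 - D" using t by simp
    ultimately have "int p dvd x\<^sup>2 - (x\<^sup>2 - D)" by (rule dvd_diff)
    then have "int p dvd D" by simp
    then show False using assms(3) by simp
  qed
  moreover have "\<not> int p dvd 2" using assms(2) by (auto dest: zdvd_imp_le)
  ultimately have "\<not> int p dvd 2 * x" using pp by (simp add: prime_dvd_mult_iff)
  then have "coprime (2 * x) (int p)" using pp by (metis coprime_commute prime_imp_coprime)
  then obtain u where u: "[2 * x * u = 1] (mod int p)" using cong_solve_coprime_int by blast
  \<comment> \<open>Newton's step: the error x^2 - D is \<open>p ^ Suc k * t\<close>, and u inverts
    the derivative 2 x modulo p.\<close>
  define y where "y = x - int p ^ Suc k * (t * u)"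
  have "int p dvd 1 - 2 * x * u" using u by (metis cong_iff_dvd_diff cong_sym)
  then obtain v where v: "1 - 2 * x * u = int p * v" by auto
  have "y\<^sup>2 - D = (x\<^sup>2 - D) - int p ^ Suc k * t * (2 * x * u) + (int p ^ Suc k * (t * u))\<^sup>2"
    by (simp add: y_def power2_eq_square algebra_simps)
  also have "\<dots> = int p ^ Suc k * t * (1 - 2 * x * u) + (int p ^ Suc k * (t * u))\<^sup>2"
    by (simp add: t algebra_simps)
  also have "\<dots> = int p ^ Suc (Suc k) * (t * v + int p ^ k * (t * u)\<^sup>2)"
    unfolding v by (simp add: power2_eq_square algebra_simps)
  finally have "int p ^ Suc (Suc k) dvd y\<^sup>2 - D" by simp
  then show ?case by (auto simp: cong_iff_dvd_diff)
qed

lemma card_roots_prime_power: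
  assumes "prime p" "2 < p" "\<not> int p dvd D" "k > 0"
  shows "int (card (roots D (p ^ k))) = 1 + Legendre D (int p)"
proof -
  obtain j where j: "k = Suc j" using assms(4) by (cases k) auto
  have pp: "prime (int p)" using assms(1) by simp
  have n0: "\<not> [D = 0] (mod int p)" using assms(3) by (simp add: cong_0_iff)
  have pdvd: "int p dvd int (p ^ k)" using assms(4) by (simp add: dvd_power)
  show ?thesis
  proof (cases "QuadRes (int p) D")
    case False
    have "roots D (p ^ k) = {}"
    proof (rule ccontr)
      assume "roots D (p ^ k) \<noteq> {}"
      then obtain x where "[x\<^sup>2 = D] (mod int (p ^ k))" by (auto simp: roots_def)
      then have "[x\<^sup>2 = D] (mod int p)" using pdvd cong_dvd_modulus by blast
      then show False using False by (auto simp: QuadRes_def)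
    qed
    then show ?thesis using False n0 by (simp add: Legendre_def)
  next
    case True
    obtain x where x: "[x\<^sup>2 = D] (mod int p ^ k)" using hensel_sqrt[OF assms(1-3) True] j by blast
    have "\<not> int p dvd x"
    proof
      assume "int p dvd x"
      then have "int p dvd x\<^sup>2" by (simp add: power2_eq_square)
      moreover have "int p dvd x\<^sup>2 - D"
        using x pdvd by (auto simp: cong_iff_dvd_diff intro: dvd_trans)
      ultimately have "int p dvd x\<^sup>2 - (x\<^sup>2 - D)" by (rule dvd_diff)
    then have "int p dvd D" by simp
      then show False using assms(3) by simp
    qed
    moreover have "\<not> int p dvd 2" using assms(2) by (auto dest: zdvd_imp_le)
    ultimately have p2x: "\<not> int p dvd 2 * x" using pp by (simp add: prime_dvd_mult_iff)
    have key: "[y = x] (mod int p ^ k) \<or> [y = - x] (mod int p ^ k)" if "[y\<^sup>2 = D] (mod int p ^ k)" for y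
    proof -
      have "[y\<^sup>2 = x\<^sup>2] (mod int p ^ k)" using that x by (meson cong_sym cong_trans)
      then have d: "int p ^ k dvd (y - x) * (y + x)"
        by (simp add: cong_iff_dvd_diff power2_eq_square algebra_simps)
      \<comment> \<open>Since 2 x is a unit modulo p, only one of the two factors can meet p, so the
        other takes the whole power.\<close>
      have "\<not> (int p dvd y - x \<and> int p dvd y + x)"
      proof
        assume "int p dvd y - x \<and> int p dvd y + x"
        then have "int p dvd (y + x) - (y - x)" using dvd_diff by blast
        then show False using p2x by simp
      qed
      then have "coprime (int p ^ k) (y - x) \<or> coprime (int p ^ k) (y + x)"
        using pp by (auto intro: prime_imp_coprime)
      then have "int p ^ k dvd y + x \<or> int p ^ k dvd y - x"
        using d coprime_dvd_mult_right_iff coprime_dvd_mult_left_iff by blast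
      then show ?thesis by (auto simp: cong_iff_dvd_diff)
    qed
    have pk: "int p ^ k > 0" using assms by simp
    have "roots D (p ^ k) = {x mod int p ^ k, (- x) mod int p ^ k}"
    proof (intro equalityI subsetI)
      fix y assume "y \<in> roots D (p ^ k)"
      then have "0 \<le> y" "y < int p ^ k" "[y\<^sup>2 = D] (mod int p ^ k)" by (auto simp: roots_def)
      then show "y \<in> {x mod int p ^ k, (- x) mod int p ^ k}"
        using key[of y] by (auto simp: cong_def)
    next
      fix y assume "y \<in> {x mod int p ^ k, (- x) mod int p ^ k}"
      then have "[y = x] (mod int p ^ k) \<or> [y = - x] (mod int p ^ k)" "0 \<le> y" "y < int p ^ k"
        using pk by auto
      then show "y \<in> roots D (p ^ k)"
        using x cong_pow[of y x "int p ^ k" 2] cong_pow[of y "- x" "int p ^ k" 2]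
        by (auto simp: roots_def intro: cong_trans)
    qed
    moreover have "x mod int p ^ k \<noteq> (- x) mod int p ^ k"
    proof
      assume "x mod int p ^ k = (- x) mod int p ^ k"
      then have "int p ^ k dvd x - (- x)" by (simp add: mod_eq_dvd_iff)
      then show False using p2x pdvd by (auto intro: dvd_trans)
    qed
    ultimately show ?thesis using True n0 by (simp add: Legendre_def)
  qed
qed

text \<open>The prime power hypothesis is asked only for primes dividing n, so the criterion applies
  to n prime to 238 although the two functions disagree at 2, 7 or 17.\<close>

lemma multiplicative_eqI:
  fixes f g :: "nat \<Rightarrow> int"
  assumes "\<And>m n. coprime m n \<Longrightarrow> m > 0 \<Longrightarrow> n > 0 \<Longrightarrow> f (m * n) = f m * f n"
    and "\<And>m n. coprime m n \<Longrightarrow> m > 0 \<Longrightarrow> n > 0 \<Longrightarrow> g (m * n) = g m * g n"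
    and "f 1 = g 1"
    and "n > 0"
    and "\<And>p k. prime p \<Longrightarrow> p dvd n \<Longrightarrow> f (p ^ k) = g (p ^ k)"
  shows "f n = g n"
  using assms(4,5)
proof (induction n rule: less_induct)
  case (less n)
  show ?case
  proof (cases "n = 1")
    case True
    then show ?thesis using assms(3) by simp
  next
    case False
    then obtain p where p: "prime p" "p dvd n" using prime_factor_nat by blast
    then obtain k m where km: "\<not> p dvd m" "n = m * p ^ k"
      using prime_power_canonical less.prems(1) by blast
    have "k > 0" using p km by (cases k) auto
    then have "p ^ k > 1" using p(1) by (metis one_less_power prime_gt_1_nat)
    then have m: "0 < m" "m < n" using less.prems(1) km(2) by auto
    have "f m = g m"
    proof (rule less.IH[OF m(2) m(1)])
      fix p' j assume "prime p'" "p' dvd m"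
      then show "f (p' ^ j) = g (p' ^ j)" using less.prems(2)[of p' j] km(2) by simp
    qed
    moreover have "f (p ^ k) = g (p ^ k)" using less.prems(2) p by blast
    moreover have "coprime m (p ^ k)"
      using km(1) p(1) by (metis coprime_commute coprime_power_right_iff prime_imp_coprime)
    ultimately show ?thesis
      using assms(1,2)[of m "p ^ k"] m p(1) by (simp add: km(2) prime_gt_0_nat)
  qed
qed

section \<open>Sums over divisors and over square divisors\<close>

lemma finite_square_divisors: "n > 0 \<Longrightarrow> finite {g::nat. g\<^sup>2 dvd n}"
  by (rule finite_subset[of _ "{..n}"]) (auto dest!: dvd_imp_le intro: le_trans[OF power2_nat_le_imp_le])

lemma coprime_decomp:
  fixes a b a' b' m n :: nat
  assumes "coprime m n" "a dvd m" "a' dvd m" "b dvd n" "b' dvd n" "a * b = a' * b'"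
  shows "a = a' \<and> b = b'"
proof -
  have "coprime a b'" "coprime a' b"
    using assms by (meson coprime_divisors dvd_refl)+
  then have "a dvd a'" "a' dvd a" "b dvd b'" "b' dvd b"
    using assms(6) by (metis coprime_dvd_mult_left_iff dvd_triv_left,
      metis coprime_dvd_mult_left_iff dvd_triv_left,
      metis coprime_commute coprime_dvd_mult_right_iff dvd_triv_right,
      metis coprime_commute coprime_dvd_mult_right_iff dvd_triv_right)
  then show ?thesis by (simp add: dvd_antisym)
qed

lemma sum_divisors_multiplicative:
  fixes f :: "nat \<Rightarrow> int"
  assumes f: "\<And>m n. f (m * n) = f m * f n" and "coprime m n" "m > 0" "n > 0"
  shows "(\<Sum>d | d dvd m * n. f d) = (\<Sum>d | d dvd m. f d) * (\<Sum>d | d dvd n. f d)"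
proof -
  have "(\<Sum>d | d dvd m. f d) * (\<Sum>d | d dvd n. f d)
      = (\<Sum>p\<in>{d. d dvd m} \<times> {d. d dvd n}. f (fst p * snd p))"
    by (simp add: sum_product sum.cartesian_product f case_prod_unfold)
  also have "\<dots> = (\<Sum>d | d dvd m * n. f d)"
  proof (rule sum.reindex_bij_betw)
    show "bij_betw (\<lambda>p. fst p * snd p) ({d. d dvd m} \<times> {d. d dvd n}) {d. d dvd m * n}"
    proof (intro bij_betw_imageI inj_onI equalityI subsetI)
      fix p q assume "p \<in> {d. d dvd m} \<times> {d. d dvd n}" "q \<in> {d. d dvd m} \<times> {d. d dvd n}"
        "fst p * snd p = fst q * snd q"
      then show "p = q" using coprime_decomp[OF assms(2), of "fst p" "fst q" "snd p" "snd q"]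
        by (auto simp: prod_eq_iff)
    next
      fix d assume "d \<in> {d. d dvd m * n}"
      then obtain a b where "d = a * b" "a dvd m" "b dvd n" by (auto dest: division_decomp)
      then show "d \<in> (\<lambda>p. fst p * snd p) ` ({d. d dvd m} \<times> {d. d dvd n})" by force
    qed (auto simp: mult_dvd_mono)
  qed
  finally show ?thesis ..
qed

text \<open>Convolution with the indicator of squares is the passage from primitive representations
  to all of them. Here f is only multiplicative on coprime arguments, as root counts are.\<close>

lemma sum_square_divisors_multiplicative:
  fixes f :: "nat \<Rightarrow> int"
  assumes f: "\<And>m n. coprime m n \<Longrightarrow> m > 0 \<Longrightarrow> n > 0 \<Longrightarrow> f (m * n) = f m * f n"
    and cop: "coprime m n" and "m > 0" "n > 0"
  shows "(\<Sum>g | g\<^sup>2 dvd m * n. f (m * n div g\<^sup>2))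
    = (\<Sum>g | g\<^sup>2 dvd m. f (m div g\<^sup>2)) * (\<Sum>g | g\<^sup>2 dvd n. f (n div g\<^sup>2))"
proof -
  have "(\<Sum>g | g\<^sup>2 dvd m. f (m div g\<^sup>2)) * (\<Sum>g | g\<^sup>2 dvd n. f (n div g\<^sup>2))
      = (\<Sum>p\<in>{g. g\<^sup>2 dvd m} \<times> {g. g\<^sup>2 dvd n}. f (m div (fst p)\<^sup>2) * f (n div (snd p)\<^sup>2))"
    by (simp add: sum_product sum.cartesian_product case_prod_unfold)
  also have "\<dots> = (\<Sum>p\<in>{g. g\<^sup>2 dvd m} \<times> {g. g\<^sup>2 dvd n}. f (m * n div (fst p * snd p)\<^sup>2))"
  proof (rule sum.cong[OF refl])
    fix p assume "p \<in> {g. g\<^sup>2 dvd m} \<times> {g. g\<^sup>2 dvd n}"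
    then have d: "(fst p)\<^sup>2 dvd m" "(snd p)\<^sup>2 dvd n" by auto
    then have "coprime (m div (fst p)\<^sup>2) (n div (snd p)\<^sup>2)"
      using d by (intro coprime_divisors[OF _ _ cop]) (metis dvd_div_mult_self dvd_triv_left)+
    moreover have "m div (fst p)\<^sup>2 > 0" "n div (snd p)\<^sup>2 > 0"
      using d assms(3,4) by (auto simp: dvd_imp_le div_greater_zero_iff dest: dvd_pos_nat)
    moreover have "m * n div (fst p * snd p)\<^sup>2 = (m div (fst p)\<^sup>2) * (n div (snd p)\<^sup>2)"
      using d by (simp add: div_mult_div_if_dvd power_mult_distrib)
    ultimately show "f (m div (fst p)\<^sup>2) * f (n div (snd p)\<^sup>2) = f (m * n div (fst p * snd p)\<^sup>2)"
      using f by simp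
  qed
  also have "\<dots> = (\<Sum>g | g\<^sup>2 dvd m * n. f (m * n div g\<^sup>2))"
  proof (rule sum.reindex_bij_betw)
    show "bij_betw (\<lambda>p. fst p * snd p) ({g. g\<^sup>2 dvd m} \<times> {g. g\<^sup>2 dvd n}) {g. g\<^sup>2 dvd m * n}"
    proof (intro bij_betw_imageI inj_onI equalityI subsetI)
      fix p q assume pq: "p \<in> {g. g\<^sup>2 dvd m} \<times> {g. g\<^sup>2 dvd n}" "q \<in> {g. g\<^sup>2 dvd m} \<times> {g. g\<^sup>2 dvd n}"
        "fst p * snd p = fst q * snd q"
      then have "(fst p)\<^sup>2 * (snd p)\<^sup>2 = (fst q)\<^sup>2 * (snd q)\<^sup>2"
        by (metis power_mult_distrib)
      then show "p = q"
        using coprime_decomp[OF cop, of "(fst p)\<^sup>2" "(fst q)\<^sup>2" "(snd p)\<^sup>2" "(snd q)\<^sup>2"] pq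
        by (auto simp: prod_eq_iff)
    next
      fix g assume "g \<in> {g. g\<^sup>2 dvd m * n}"
      then have g: "g\<^sup>2 dvd m * n" by simp
      then have "g dvd m * n" by (meson dvd_trans dvd_triv_left power2_eq_square dvd_power zero_less_numeral)
      then obtain a b where ab: "g = a * b" "a dvd m" "b dvd n" by (auto dest: division_decomp)
      have "coprime (a\<^sup>2) n" "coprime (b\<^sup>2) m"
        using cop ab by (simp_all, metis coprime_divisors dvd_refl, metis coprime_commute coprime_divisors dvd_refl)
      moreover have "a\<^sup>2 dvd m * n" "b\<^sup>2 dvd m * n"
        using g ab(1) by (auto simp: power_mult_distrib intro: dvd_mult_left dvd_mult_right)
      ultimately have "a\<^sup>2 dvd m" "b\<^sup>2 dvd n"
        by (auto simp: coprime_dvd_mult_left_iff coprime_dvd_mult_right_iff)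
      then show "g \<in> (\<lambda>p. fst p * snd p) ` ({g. g\<^sup>2 dvd m} \<times> {g. g\<^sup>2 dvd n})"
        using ab(1) by force
    qed (auto simp: power_mult_distrib mult_dvd_mono)
  qed
  finally show ?thesis ..
qed

text \<open>The Kronecker character of discriminant -952 = 8 * (-7) * 17.\<close>

definition chiD :: "nat \<Rightarrow> int" where "chiD n = chi8 n * chi7 n * chi17 n"

lemma chiD_mult: "chiD (m * n) = chiD m * chiD n"
  by (simp add: chiD_def chi7_mult chi8_mult chi17_mult)

lemma sum_divisors_prime_power:
  fixes f :: "nat \<Rightarrow> int"
  assumes "prime p"
  shows "(\<Sum>d | d dvd p ^ k. f d) = (\<Sum>i\<le>k. f (p ^ i))"
proof -
  have "{d. d dvd p ^ k} = (\<lambda>i. p ^ i) ` {..k}"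
    using divides_primepow_nat[OF assms] by auto
  moreover have "inj_on (\<lambda>i. p ^ i) {..k}"
    using prime_gt_1_nat[OF assms] by (auto simp: inj_on_def)
  ultimately show ?thesis by (simp add: sum.reindex)
qed

lemma sum_square_divisors_prime_power:
  fixes f :: "nat \<Rightarrow> int"
  assumes "prime p"
  shows "(\<Sum>g | g\<^sup>2 dvd p ^ k. f (p ^ k div g\<^sup>2)) = (\<Sum>i | 2 * i \<le> k. f (p ^ (k - 2 * i)))"
proof -
  have p: "p > 1" using prime_gt_1_nat[OF assms] .
  have "{g. g\<^sup>2 dvd p ^ k} = (\<lambda>i. p ^ i) ` {i. 2 * i \<le> k}"
  proof (intro equalityI subsetI)
    fix g assume "g \<in> {g. g\<^sup>2 dvd p ^ k}"
    then have g: "g\<^sup>2 dvd p ^ k" by simp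
    then have "g dvd p ^ k" by (meson dvd_trans dvd_power zero_less_numeral)
    then obtain i where i: "g = p ^ i" using divides_primepow_nat[OF assms] by auto
    then have "p ^ (2 * i) dvd p ^ k" using g by (simp add: power_mult[symmetric] mult.commute)
    then have "2 * i \<le> k" using p by (auto dest: power_dvd_imp_le)
    then show "g \<in> (\<lambda>i. p ^ i) ` {i. 2 * i \<le> k}" using i by simp
  next
    fix g assume "g \<in> (\<lambda>i. p ^ i) ` {i. 2 * i \<le> k}"
    then obtain i where "g = p ^ i" "2 * i \<le> k" by auto
    then show "g \<in> {g. g\<^sup>2 dvd p ^ k}"
      by (auto simp: power_mult[symmetric] mult.commute le_imp_power_dvd)
  qed
  moreover have "inj_on (\<lambda>i. p ^ i) {i. 2 * i \<le> k}"
    using p by (auto simp: inj_on_def)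
  ultimately have "(\<Sum>g | g\<^sup>2 dvd p ^ k. f (p ^ k div g\<^sup>2)) = (\<Sum>i | 2 * i \<le> k. f (p ^ k div (p ^ i)\<^sup>2))"
    by (simp add: sum.reindex)
  also have "\<dots> = (\<Sum>i | 2 * i \<le> k. f (p ^ (k - 2 * i)))"
    using p by (intro sum.cong) (auto simp: power_diff power_mult[symmetric] mult.commute)
  finally show ?thesis .
qed

text \<open>Raising k by 2 adds 1 + chiD p to either side: one more root count on the left, two
  consecutive powers of a sign on the right.\<close>

lemma sum_roots_prime_power:
  assumes "prime p" "p \<notin> {2, 7, 17}"
  shows "(\<Sum>i | 2 * i \<le> k. int (card (roots (-238) (p ^ (k - 2 * i))))) = (\<Sum>i\<le>k. chiD (p ^ i))"
proof -
  have p2: "2 < p" using assms prime_ge_2_nat[OF assms(1)] by auto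
  have "\<not> p dvd 238"
  proof
    assume "p dvd 238"
    then have "p dvd 2 * (7 * 17)" by simp
    then have "p dvd 2 \<or> p dvd 7 \<or> p dvd 17" using assms(1) by (metis prime_dvd_mult_iff)
    then show False using assms by (auto simp: primes_dvd_imp_eq)
  qed
  then have nd: "\<not> int p dvd - 238" by (metis dvd_minus_iff int_dvd_int_iff of_nat_numeral)
  have L: "Legendre (-238) (int p) = chiD p"
    using Legendre_minus_238[OF assms] by (simp add: chiD_def)
  have r: "int (card (roots (-238) (p ^ j))) = 1 + chiD p" if "j > 0" for j
    using card_roots_prime_power[OF assms(1) p2 nd that] L by simp
  have "chiD p \<noteq> 0"
    using nd L by (auto simp: Legendre_def cong_0_iff split: if_splits)
  then have c: "chiD p = 1 \<or> chiD p = -1"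
    using L Legendre_cases[of "-238" "int p"] by auto
  have c1: "chiD 1 = 1" by (simp add: chiD_def chi7_def chi8_def chi17_def)
  have pw: "chiD (p ^ i) = chiD p ^ i" for i
    by (induction i) (use c1 in \<open>auto simp: chiD_mult\<close>)
  show ?thesis
  proof (induction k rule: less_induct)
    case (less k)
    consider "k = 0" | "k = 1" | j where "k = j + 2"
      by (metis One_nat_def add_2_eq_Suc' not0_implies_Suc)
    then show ?case
    proof cases
      case 1
      then show ?thesis using c1 by simp
    next
      case 2
      then have "{i. 2 * i \<le> k} = {0}" by auto
      then show ?thesis using 2 c1 r[of 1] by simp
    next
      case 3
      have "{i. 2 * i \<le> k} = insert 0 (Suc ` {i. 2 * i \<le> j})"
        unfolding set_eq_iff
      proof
        fix i show "i \<in> {i. 2 * i \<le> k} \<longleftrightarrow> i \<in> insert 0 (Suc ` {i. 2 * i \<le> j})"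
          using 3 by (cases i) auto
      qed
      moreover have "finite {i. 2 * i \<le> j}" by (rule finite_subset[of _ "{..j}"]) auto
      ultimately have "(\<Sum>i | 2 * i \<le> k. int (card (roots (-238) (p ^ (k - 2 * i)))))
        = (1 + chiD p) + (\<Sum>i | 2 * i \<le> j. int (card (roots (-238) (p ^ (j - 2 * i)))))"
        using r[of k] 3 by (simp add: sum.reindex)
      also have "\<dots> = (1 + chiD p) + (\<Sum>i\<le>j. chiD (p ^ i))" using less[of j] 3 by simp
      \<comment> \<open>For a sign c, any two consecutive powers add up to 1 + c.\<close>
      also have "1 + chiD p = chiD (p ^ Suc j) + chiD (p ^ Suc (Suc j))"
        unfolding pw using c by (auto simp: minus_one_power_iff)
      finally show ?thesis using 3 by (simp add: algebra_simps)
    qed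
  qed
qed

text \<open>The coefficient form of zeta(2s) * sum r(n) n^(-s) = zeta(s) L(s, chiD), with r the
  number of roots, away from the primes 2, 7, 17.\<close>

lemma sum_card_roots:
  assumes "n > 0" "coprime n 238"
  shows "(\<Sum>g | g\<^sup>2 dvd n. int (card (roots (-238) (n div g\<^sup>2)))) = (\<Sum>d | d dvd n. chiD d)"
proof (rule multiplicative_eqI[where n = n])
  fix p k :: nat assume p: "prime p" "p dvd n"
  then have "\<not> p dvd 238" using assms by (metis coprime_common_divisor not_prime_unit)
  then have "p \<notin> {2, 7, 17}" by auto
  then show "(\<Sum>g | g\<^sup>2 dvd p ^ k. int (card (roots (-238) (p ^ k div g\<^sup>2)))) = (\<Sum>d | d dvd p ^ k. chiD d)"
    using sum_square_divisors_prime_power[OF p(1), of "\<lambda>n. int (card (roots (-238) n))"]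
      sum_divisors_prime_power[OF p(1), of chiD] sum_roots_prime_power[OF p(1)] by simp
next
  have "{g::nat. g\<^sup>2 dvd 1} = {1}" by auto
  then show "(\<Sum>g | g\<^sup>2 dvd 1. int (card (roots (-238) (1 div g\<^sup>2)))) = (\<Sum>d | d dvd 1. chiD d)"
    by (simp add: chiD_def chi7_def chi8_def chi17_def)
qed (use assms card_roots_mult chiD_mult in
    \<open>auto intro!: sum_divisors_multiplicative sum_square_divisors_multiplicative[of "\<lambda>n. int (card (roots (-238) n))"]\<close>)

subsection \<open>Representations by the forms of discriminant $-952$\<close>

definition form_count :: "int \<Rightarrow> int \<Rightarrow> nat \<Rightarrow> nat" where
  "form_count a c n = card {(x, y). a * x\<^sup>2 + c * y\<^sup>2 = int n}"

definition prim_reps :: "int \<Rightarrow> int \<Rightarrow> nat \<Rightarrow> (int \<times> int) set" where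
  "prim_reps a c n = {(x, y). coprime x y \<and> a * x\<^sup>2 + c * y\<^sup>2 = int n}"

lemma finite_form_reps:
  fixes a c :: int
  assumes "a > 0" "c > 0"
  shows "finite {(x, y). a * x\<^sup>2 + c * y\<^sup>2 = int n}"
proof (rule finite_subset)
  show "{(x, y). a * x\<^sup>2 + c * y\<^sup>2 = int n} \<subseteq> {- int n..int n} \<times> {- int n..int n}"
  proof (clarsimp)
    fix x y :: int assume e: "a * x\<^sup>2 + c * y\<^sup>2 = int n"
    have b: "\<bar>z\<bar> \<le> z\<^sup>2" for z :: int
      using mult_mono[of 1 "\<bar>z\<bar>" "\<bar>z\<bar>" "\<bar>z\<bar>"] by (cases "z = 0") (auto simp: power2_eq_square)
    have "x\<^sup>2 \<le> a * x\<^sup>2" "y\<^sup>2 \<le> c * y\<^sup>2"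
      using assms mult_right_mono[of 1 a "x\<^sup>2"] mult_right_mono[of 1 c "y\<^sup>2"] by auto
    moreover have "0 \<le> a * x\<^sup>2" "0 \<le> c * y\<^sup>2" using assms by auto
    ultimately show "- int n \<le> x \<and> x \<le> int n \<and> - int n \<le> y \<and> y \<le> int n"
      using b[of x] b[of y] e by linarith
  qed
qed simp

lemma finite_prim_reps: "a > 0 \<Longrightarrow> c > 0 \<Longrightarrow> finite (prim_reps a c n)"
  by (rule finite_subset[OF _ finite_form_reps[of a c n]]) (auto simp: prim_reps_def)

text \<open>Gauss reduction of the form (a, 2b, c), of discriminant -4 D, with the unimodular
  substitution carried along, because the first column later supplies the representation of
  a.\<close>

lemma form_reduction:
  fixes a b c :: int
  assumes "a * c = b\<^sup>2 + D" "a > 0" "D > 0"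
  shows "\<exists>A B C p q r s. A * C = B\<^sup>2 + D \<and> 0 < A \<and> 2 * \<bar>B\<bar> \<le> A \<and> A \<le> C \<and> p * s - q * r = 1
    \<and> a = A * p\<^sup>2 + 2 * B * p * r + C * r\<^sup>2
    \<and> b = A * p * q + B * (p * s + q * r) + C * r * s
    \<and> c = A * q\<^sup>2 + 2 * B * q * s + C * s\<^sup>2"
  using assms(1,2)
proof (induction "nat a" arbitrary: a b c rule: less_induct)
  case less
  \<comment> \<open>The integer nearest to b / a; translating by it makes the middle coefficient at
    most a in absolute value.\<close>
  define t where "t = (2 * b + a) div (2 * a)"
  define b' where "b' = b - t * a"
  define c' where "c' = c - 2 * t * b + t\<^sup>2 * a"
  have "2 * b + a = 2 * a * t + (2 * b + a) mod (2 * a)"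
    by (simp add: t_def)
  moreover have "0 \<le> (2 * b + a) mod (2 * a)" "(2 * b + a) mod (2 * a) < 2 * a"
    using less.prems(2) by simp_all
  moreover have "2 * b' + a = (2 * b + a) - 2 * a * t" by (simp add: b'_def algebra_simps)
  ultimately have b'_le: "2 * \<bar>b'\<bar> \<le> a" by linarith
  have ac': "a * c' = b'\<^sup>2 + D"
    using less.prems(1) by (simp add: b'_def c'_def power2_eq_square algebra_simps)
  have b: "b = b' + t * a" and c: "c = c' + 2 * t * b' + t\<^sup>2 * a"
    by (simp_all add: b'_def c'_def power2_eq_square algebra_simps)
  show ?case
  proof (cases "a \<le> c'")
    case True
    show ?thesis
      by (rule exI[of _ a], rule exI[of _ b'], rule exI[of _ c'], rule exI[of _ 1],
          rule exI[of _ t], rule exI[of _ 0], rule exI[of _ 1])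
        (use True ac' b'_le less.prems(2) in \<open>simp add: b c algebra_simps power2_eq_square\<close>)
  next
    case False
    have "0 < b'\<^sup>2 + D" using assms(3) by (simp add: add_nonneg_pos)
    then have "0 < a * c'" using ac' by simp
    then have c'0: "0 < c'" using less.prems(2) by (simp add: zero_less_mult_iff)
    \<comment> \<open>Swapping the variables gives (c', -2 b', a), whose leading coefficient is
      smaller, so the induction applies.\<close>
    have "\<exists>A B C p q r s. A * C = B\<^sup>2 + D \<and> 0 < A \<and> 2 * \<bar>B\<bar> \<le> A \<and> A \<le> C \<and> p * s - q * r = 1
      \<and> c' = A * p\<^sup>2 + 2 * B * p * r + C * r\<^sup>2
      \<and> - b' = A * p * q + B * (p * s + q * r) + C * r * s
      \<and> a = A * q\<^sup>2 + 2 * B * q * s + C * s\<^sup>2"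
      by (rule less.hyps) (use False c'0 ac' in \<open>auto simp: algebra_simps\<close>)
    then obtain A B C p q r s where h: "A * C = B\<^sup>2 + D" "0 < A" "2 * \<bar>B\<bar> \<le> A" "A \<le> C" "p * s - q * r = 1"
      "c' = A * p\<^sup>2 + 2 * B * p * r + C * r\<^sup>2"
      "- b' = A * p * q + B * (p * s + q * r) + C * r * s"
      "a = A * q\<^sup>2 + 2 * B * q * s + C * s\<^sup>2"
      by blast
    have h7: "b' = - (A * p * q + B * (p * s + q * r) + C * r * s)" using h(7) by linarith
    have "q * (t * s - r) - (t * q - p) * s = 1"
      using h(5) by (simp add: algebra_simps)
    moreover have "b = A * q * (t * q - p) + B * (q * (t * s - r) + (t * q - p) * s) + C * s * (t * s - r)"
      by (simp add: b h7 h(8) power2_eq_square algebra_simps)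
    moreover have "c = A * (t * q - p)\<^sup>2 + 2 * B * (t * q - p) * (t * s - r) + C * (t * s - r)\<^sup>2"
      by (simp add: c h7 h(6,8) power2_eq_square algebra_simps)
    ultimately show ?thesis using h(1-4,8) by blast
  qed
qed

text \<open>Reducedness gives 3 A^2 <= 4 * 238, hence A <= 17 and |B| <= 8, leaving a finite search.
  The eight forms are the class number of discriminant -952.\<close>

lemma reduced_forms_238:
  fixes A B C :: int
  assumes "A * C = B\<^sup>2 + 238" "0 < A" "2 * \<bar>B\<bar> \<le> A" "A \<le> C"
  shows "(A, B, C) \<in> {(1,0,238), (2,0,119), (7,0,34), (14,0,17), (11,2,22), (11,-2,22), (13,3,19), (13,-3,19)}"
proof -
  have "A * A \<le> B\<^sup>2 + 238" using mult_left_mono[OF assms(4), of A] assms(1,2) by simp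
  moreover have "(2 * \<bar>B\<bar>)\<^sup>2 \<le> A\<^sup>2" using assms(3) by (intro power_mono) auto
  then have "4 * B\<^sup>2 \<le> A * A" by (simp add: power_mult_distrib power2_eq_square)
  ultimately have "3 * (A * A) \<le> 952" by linarith
  then have A17: "A \<le> 17"
    using mult_mono[of 18 A 18 A] by linarith
  have B8: "\<bar>B\<bar> \<le> 8" using A17 assms(3) by linarith
  obtain k where k: "B = int k \<or> B = - int k" "k \<le> 8"
    using B8 by (metis abs_if int_nat_eq nat_int nat_le_iff of_nat_numeral minus_minus nat_0_le zabs_def abs_ge_zero)
  have AC: "A * C = int k * int k + 238" using k assms(1) by (auto simp: power2_eq_square)
  have kA: "2 * int k \<le> A" using k assms(3) by auto
  obtain j where j: "A = int j" "0 < j" "j \<le> 17"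
    using A17 assms(2) by (metis nat_int nat_le_iff of_nat_numeral pos_int_cases of_nat_0_less_iff)
  from k(2) have "k \<in> {0,1,2,3,4,5,6,7,8}" by auto
  moreover from j(2,3) have "j \<in> {1,2,3,4,5,6,7,8,9,10,11,12,13,14,15,16,17}"
    by simp presburger
  ultimately show ?thesis
    using AC kA k(1) assms(4) unfolding j(1)
    by (elim insertE emptyE; simp; presburger)
qed

definition diag_forms :: "int set" where "diag_forms = {1, 2, 7, 14}"

text \<open>Makes y invertible modulo n. Since (a x)^2 + 238 y^2 = a n, the quotient a x / y is then
  a well-defined root of -238.\<close>

lemma prim_reps_coprime:
  assumes "a \<in> diag_forms" "coprime n 238" "(x, y) \<in> prim_reps a (238 div a) n"
  shows "coprime y (int n)"
proof -
  define d where "d = gcd y (int n)"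
  have xy: "coprime x y" and e: "a * x\<^sup>2 + (238 div a) * y\<^sup>2 = int n"
    using assms(3) by (auto simp: prim_reps_def)
  have dy: "d dvd y" and dn: "d dvd int n" by (simp_all add: d_def)
  have "d dvd int n - (238 div a) * y\<^sup>2"
    using dy dn by (simp add: power2_eq_square)
  moreover have "int n - (238 div a) * y\<^sup>2 = a * x\<^sup>2" using e by linarith
  ultimately have dax: "d dvd a * x\<^sup>2" by simp
  have "coprime d (x\<^sup>2)" using coprime_divisors[OF dy dvd_refl, of x] xy by (simp add: coprime_commute)
  then have "d dvd a" using dax by (simp add: coprime_dvd_mult_left_iff)
  moreover have "a dvd 238" using assms(1) by (auto simp: diag_forms_def)
  ultimately have "d dvd 238" by (rule dvd_trans)
  moreover have "coprime (int n) 238"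
    using assms(2) by (metis coprime_int_iff of_nat_numeral)
  ultimately have "is_unit d" using dn by (metis coprime_common_divisor)
  then show ?thesis by (simp add: d_def coprime_iff_gcd_eq_1)
qed

text \<open>The bound is 14 * 14, the largest product of two elements of \<open>diag_forms\<close>.
  Among those products only the ones with equal factors occur in this list of squares.\<close>

lemma int_square_small:
  fixes k :: int
  assumes "k\<^sup>2 = m" "m \<le> 196"
  shows "m \<in> {0,1,4,9,16,25,36,49,64,81,100,121,144,169,196}"
proof -
  have "\<bar>k\<bar> \<le> 14"
  proof (rule ccontr)
    assume "\<not> \<bar>k\<bar> \<le> 14"
    then have "15 * 15 \<le> \<bar>k\<bar> * \<bar>k\<bar>" by (intro mult_mono) auto
    then show False using assms by (simp add: power2_eq_square)
  qed
  then obtain j where j: "\<bar>k\<bar> = int j" "j \<le> 14"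
    by (metis abs_ge_zero nonneg_int_cases of_nat_le_iff of_nat_numeral)
  then have "j \<in> {0,1,2,3,4,5,6,7,8,9,10,11,12,13,14}" by simp presburger
  moreover have "m = int j * int j" using assms(1) j(1) by (metis abs_mult_self_eq power2_eq_square)
  ultimately show ?thesis by (elim insertE emptyE) simp_all
qed

text \<open>
  Both \<open>a x + y \<surd>-238\<close> and \<open>a' x' + y' \<surd>-238\<close> lie in the ideal of norm \<open>n\<close> attached to the root.
  Dividing one times the conjugate of the other by \<open>n\<close> gives an element \<open>A' + B' \<surd>-238\<close> of norm
  \<open>a a' < 238\<close>, so \<open>B' = 0\<close> and \<open>a a'\<close> is a square.
\<close>

lemma prim_reps_same_root:
  fixes b :: int
  assumes a: "a \<in> diag_forms" "a' \<in> diag_forms" and n: "n > 0"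
    and xy: "(x, y) \<in> prim_reps a (238 div a) n" and xy': "(x', y') \<in> prim_reps a' (238 div a') n"
    and r: "[b * y = a * x] (mod int n)" and r': "[b * y' = a' * x'] (mod int n)"
  shows "a = a' \<and> (x' = x \<and> y' = y \<or> x' = - x \<and> y' = - y)"
proof -
  have norm: "(a * x)\<^sup>2 + 238 * y\<^sup>2 = a * int n"
    using a(1) xy by (auto simp: diag_forms_def prim_reps_def power2_eq_square algebra_simps)
  have norm': "(a' * x')\<^sup>2 + 238 * y'\<^sup>2 = a' * int n"
    using a(2) xy' by (auto simp: diag_forms_def prim_reps_def power2_eq_square algebra_simps)
  define B where "B = a * x * y' - a' * x' * y"
  define A where "A = a * x * (a' * x') + 238 * (y * y')"
  have "[a * x * y' = b * y * y'] (mod int n)" by (rule cong_mult[OF cong_sym[OF r] cong_refl])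
  moreover have "[b * y' * y = a' * x' * y] (mod int n)" by (rule cong_mult[OF r' cong_refl])
  ultimately have "[a * x * y' = a' * x' * y] (mod int n)"
    by (metis cong_trans mult.assoc mult.commute)
  then have "int n dvd B" by (simp add: B_def cong_iff_dvd_diff)
  then obtain B' where B': "B = int n * B'" by auto
  have comp: "A\<^sup>2 + 238 * B\<^sup>2 = (int n)\<^sup>2 * (a * a')"
  proof -
    have "A\<^sup>2 + 238 * B\<^sup>2 = ((a * x)\<^sup>2 + 238 * y\<^sup>2) * ((a' * x')\<^sup>2 + 238 * y'\<^sup>2)"
      by (simp add: A_def B_def power2_eq_square algebra_simps)
    also have "\<dots> = (int n)\<^sup>2 * (a * a')"
      unfolding norm norm' by (simp add: power2_eq_square algebra_simps)
    finally show ?thesis .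
  qed
  then have "A\<^sup>2 = (int n)\<^sup>2 * (a * a' - 238 * B'\<^sup>2)"
    by (simp add: B' power2_eq_square algebra_simps)
  then have "(int n)\<^sup>2 dvd A\<^sup>2" by simp
  then have "int n dvd A" by simp
  then obtain A' where A': "A = int n * A'" by auto
  have "(int n)\<^sup>2 * (A'\<^sup>2 + 238 * B'\<^sup>2) = (int n)\<^sup>2 * (a * a')"
    using comp by (simp add: A' B' power2_eq_square algebra_simps)
  then have eq: "A'\<^sup>2 + 238 * B'\<^sup>2 = a * a'" using n by simp
  have aa: "a * a' \<le> 196" using a by (auto simp: diag_forms_def)
  have "B' = 0"
  proof (rule ccontr)
    assume "B' \<noteq> 0"
    then have "B'\<^sup>2 > 0" by simp
    then have "B'\<^sup>2 \<ge> 1" by linarith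
    moreover have "A'\<^sup>2 \<ge> 0" by simp
    ultimately show False using eq aa by linarith
  qed
  then have "A'\<^sup>2 = a * a'" using eq by simp
  then have same: "a = a'"
    using int_square_small[OF _ aa, of A'] a by (auto simp: diag_forms_def)
  have "a > 0" using a by (auto simp: diag_forms_def)
  have "B = 0" using \<open>B' = 0\<close> B' by simp
  \<comment> \<open>Two primitive vectors that are parallel agree up to sign.\<close>
  then have cross: "x * y' = x' * y"
    using same \<open>a > 0\<close> by (simp add: B_def)
  have cop: "coprime x y" "coprime x' y'" using xy xy' by (auto simp: prim_reps_def)
  have "y' dvd x' * y" "y dvd x * y'" using cross by (metis dvd_triv_right, metis cross dvd_triv_right)
  then have "y' dvd y" "y dvd y'"
    using cop by (simp_all add: coprime_dvd_mult_right_iff coprime_commute)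
  then have "\<bar>y\<bar> = \<bar>y'\<bar>" using zdvd_antisym_abs by blast
  then consider "y = 0" "y' = 0" | "y' = y" "y \<noteq> 0" | "y' = - y" "y \<noteq> 0" by linarith
  then have "x' = x \<and> y' = y \<or> x' = - x \<and> y' = - y"
  proof cases
    case 1
    then have "\<bar>x\<bar> = 1" "\<bar>x'\<bar> = 1" using cop by auto
    then show ?thesis using 1 by linarith
  next
    case 2
    then show ?thesis using cross by auto
  next
    case 3
    then have "- (x * y) = x' * y" using cross by simp
    then have "(x' + x) * y = 0" by (simp add: algebra_simps)
    then show ?thesis using 3 by (simp add: add_eq_0_iff)
  qed
  then show ?thesis using same by simp
qed

lemma chi8_int_mod:
  assumes "chi8 n = 1"
  shows "int n mod 8 = 1 \<or> int n mod 8 = 7"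
  using assms by (auto simp: chi8_def zmod_int split: if_splits) presburger+

lemma quadratic_form_mod:
  fixes p r :: int
  shows "(k * p\<^sup>2 + l * p * r + m * r\<^sup>2) mod d
      = (k * (p mod d) * (p mod d) + l * (p mod d) * (r mod d) + m * (r mod d) * (r mod d)) mod d"
proof -
  have p: "[p = p mod d] (mod d)" and r: "[r = r mod d] (mod d)" by (simp_all add: cong_def)
  have "[k * p * p + l * p * r + m * r * r
      = k * (p mod d) * (p mod d) + l * (p mod d) * (r mod d) + m * (r mod d) * (r mod d)] (mod d)"
    by (intro cong_add cong_mult cong_refl p r)
  then show ?thesis by (simp add: cong_def power2_eq_square mult.assoc)
qed

text \<open>\<open>chi8\<close> is a genus character and equals -1 on these four classes: their odd
  values are 3 or 5 modulo 8.\<close>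

lemma non_diag_mod8:
  fixes p r :: int
  assumes "(k, l, m) \<in> {(11, 4, 22), (11, -4, 22), (13, 6, 19), (13, -6, 19)}"
  shows "(k * p\<^sup>2 + l * p * r + m * r\<^sup>2) mod 8 \<notin> {1, 7}"
proof -
  have "\<forall>(k, l, m)\<in>set [(11, 4, 22), (11, -4, 22), (13, 6, 19), (13, -6, 19)].
      \<forall>i\<in>set [0..7]. \<forall>j\<in>set [0..7]. (k * i * i + l * i * j + m * j * j) mod 8 \<notin> {1, 7::int}"
    by code_simp
  then have "\<forall>i\<in>set [0..7]. \<forall>j\<in>set [0..7]. (k * i * i + l * i * j + m * j * j) mod 8 \<notin> {1, 7::int}"
    using assms by auto
  moreover have "p mod 8 \<in> set [0..7]" "r mod 8 \<in> set [0..7]" by auto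
  ultimately show ?thesis unfolding quadratic_form_mod by blast
qed

text \<open>A root b makes (n, 2b, c) a form of discriminant -952 that represents n; its residue
  modulo 8 forces the reduced form to be diagonal.\<close>

lemma root_represented:
  fixes b :: int
  assumes n: "n > 0" "chi8 n = 1" and b: "b \<in> roots (-238) n"
  shows "\<exists>a\<in>diag_forms. \<exists>x y. (x, y) \<in> prim_reps a (238 div a) n \<and> [b * y = a * x] (mod int n)"
proof -
  have "int n dvd b\<^sup>2 + 238" using b by (simp add: roots_def cong_iff_dvd_diff)
  then obtain c where "b\<^sup>2 + 238 = int n * c" by (rule dvdE)
  then have c: "int n * c = b\<^sup>2 + 238" by simp
  obtain A B C p q r s where h: "A * C = B\<^sup>2 + 238" "0 < A" "2 * \<bar>B\<bar> \<le> A" "A \<le> C" "p * s - q * r = 1"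
      "int n = A * p\<^sup>2 + 2 * B * p * r + C * r\<^sup>2"
      "b = A * p * q + B * (p * s + q * r) + C * r * s"
    using form_reduction[OF c] n(1) by auto
  have nm: "int n mod 8 \<in> {1, 7}" using chi8_int_mod[OF n(2)] by auto
  have "B = 0 \<and> A \<in> diag_forms \<and> C = 238 div A"
  proof -
    have "B = 0"
    proof (rule ccontr)
      assume "B \<noteq> 0"
      then have "(A, 2 * B, C) \<in> {(11, 4, 22), (11, -4, 22), (13, 6, 19), (13, -6, 19)}"
        using reduced_forms_238[OF h(1-4)] by auto
      from non_diag_mod8[OF this, of p r] show False using h(6) nm by metis
    qed
    then show ?thesis using reduced_forms_238[OF h(1-4)] by (auto simp: diag_forms_def)
  qed
  then have B: "B = 0" and A: "A \<in> diag_forms" and C: "C = 238 div A" by auto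
  have "is_unit d" if "d dvd p" "d dvd r" for d
  proof -
    have "d dvd p * s - q * r" using that by simp
    then show ?thesis using h(5) by simp
  qed
  then have "coprime (- p) r" by (simp add: coprime_def)
  \<comment> \<open>The sign comes from b r = -A p modulo n, obtained from b = A p q + C r s and p s
    - q r = 1.\<close>
  then have "(- p, r) \<in> prim_reps A (238 div A) n"
    using h(6) B C by (simp add: prim_reps_def)
  moreover have "b * r = A * (- p) + int n * s"
  proof -
    have "q * r = p * s - 1" using h(5) by simp
    have "b * r = A * p * (q * r) + C * r * r * s" using h(7) B by (simp add: algebra_simps)
    also have "\<dots> = A * (- p) + (A * p\<^sup>2 + C * r\<^sup>2) * s"
      unfolding \<open>q * r = p * s - 1\<close> by (simp add: power2_eq_square algebra_simps)
    finally show ?thesis using h(6) B by simp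
  qed
  then have "[b * r = A * (- p)] (mod int n)"
    by (simp add: cong_iff_dvd_diff)
  ultimately show ?thesis using A by blast
qed

text \<open>Sorting the representations by their root gives fibres of exactly two elements, a vector
  and its negative, in a single form.\<close>

lemma card_prim_reps_total:
  assumes n: "n > 0" "chi8 n = 1" "coprime n 238"
  shows "(\<Sum>a\<in>diag_forms. card (prim_reps a (238 div a) n)) = 2 * card (roots (-238) n)"
proof -
  define S where "S = (SIGMA a:diag_forms. prim_reps a (238 div a) n)"
  define fib where "fib b = {t \<in> S. [b * snd (snd t) = fst t * fst (snd t)] (mod int n)}" for b
  have fin: "finite (prim_reps a (238 div a) n)" if "a \<in> diag_forms" for a
    using that by (intro finite_prim_reps) (auto simp: diag_forms_def)
  have finS: "finite S" unfolding S_def using fin by (intro finite_SigmaI) (auto simp: diag_forms_def)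
  have "(\<Sum>a\<in>diag_forms. card (prim_reps a (238 div a) n)) = card S"
    unfolding S_def using fin by (subst card_SigmaI) (auto simp: diag_forms_def)
  also have "S = (\<Union>b\<in>roots (-238) n. fib b)"
  proof (intro equalityI subsetI)
    fix t assume t: "t \<in> S"
    obtain a x y where axy: "t = (a, x, y)" by (metis prod_cases3)
    have a: "a \<in> diag_forms" and xy: "(x, y) \<in> prim_reps a (238 div a) n" using t axy by (auto simp: S_def)
    have cop: "coprime y (int n)" using prim_reps_coprime[OF a n(3) xy] .
    obtain u where u: "[y * u = 1] (mod int n)" using cong_solve_coprime_int[OF cop] by blast
    \<comment> \<open>The root a x / y, with u the inverse of y modulo n.\<close>
    define b where "b = (a * x * u) mod int n"
    have "[b * y = a * x * u * y] (mod int n)" by (simp add: b_def cong_def mod_simps)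
    also have "a * x * u * y = a * x * (y * u)" by simp
    also have "[a * x * (y * u) = a * x * 1] (mod int n)" using u by (intro cong_mult) auto
    finally have bxy: "[b * y = a * x] (mod int n)" by simp
    have "[(b\<^sup>2 + 238) * y\<^sup>2 = (a * x)\<^sup>2 + 238 * y\<^sup>2] (mod int n)"
      using cong_pow[OF bxy, of 2] by (simp add: power_mult_distrib distrib_right cong_add)
    moreover have "(a * x)\<^sup>2 + 238 * y\<^sup>2 = a * int n"
      using a xy by (auto simp: diag_forms_def prim_reps_def power2_eq_square algebra_simps)
    ultimately have "int n dvd (b\<^sup>2 + 238) * y\<^sup>2"
      by (metis cong_dvd_iff dvd_triv_right)
    then have "int n dvd b\<^sup>2 + 238"
      using cop by (simp add: coprime_dvd_mult_left_iff coprime_commute)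
    then have "b \<in> roots (-238) n" using n(1) by (simp add: roots_def b_def cong_iff_dvd_diff)
    then show "t \<in> (\<Union>b\<in>roots (-238) n. fib b)" using t bxy axy by (auto simp: fib_def)
  qed (auto simp: fib_def)
  also have "card \<dots> = (\<Sum>b\<in>roots (-238) n. card (fib b))"
  proof (rule card_UN_disjoint)
    show "\<forall>b\<in>roots (-238) n. \<forall>b'\<in>roots (-238) n. b \<noteq> b' \<longrightarrow> fib b \<inter> fib b' = {}"
    proof (intro ballI impI, rule ccontr)
      fix b b' assume b: "b \<in> roots (-238) n" "b' \<in> roots (-238) n" "b \<noteq> b'" "fib b \<inter> fib b' \<noteq> {}"
      then obtain a x y where "(a, x, y) \<in> fib b" "(a, x, y) \<in> fib b'" by fastforce
      then have axy: "a \<in> diag_forms" "(x, y) \<in> prim_reps a (238 div a) n"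
        and "[b * y = b' * y] (mod int n)"
        by (auto simp: fib_def S_def intro: cong_trans cong_sym)
      then have "[b = b'] (mod int n)"
        using prim_reps_coprime[OF axy(1) n(3) axy(2)] by (simp add: cong_mult_rcancel)
      then show False using b(1-3) by (auto simp: roots_def cong_def)
    qed
  qed (use finS in \<open>auto simp: fib_def\<close>)
  also have "\<dots> = (\<Sum>b\<in>roots (-238) n. 2)"
  proof (rule sum.cong[OF refl])
    fix b assume "b \<in> roots (-238) n"
    from root_represented[OF n(1,2) this] obtain a x y where
      axy: "a \<in> diag_forms" "(x, y) \<in> prim_reps a (238 div a) n" "[b * y = a * x] (mod int n)" by blast
    have neg: "[b * (- y) = a * (- x)] (mod int n)" using axy(3) by (simp add: cong_minus_minus_iff)
    have "fib b = {(a, x, y), (a, - x, - y)}"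
    proof (intro equalityI subsetI)
      fix t assume t: "t \<in> fib b"
      obtain a' x' y' where "t = (a', x', y')" by (metis prod_cases3)
      then show "t \<in> {(a, x, y), (a, - x, - y)}"
        using t prim_reps_same_root[OF axy(1) _ n(1) axy(2) _ axy(3), of a' x' y']
        by (auto simp: fib_def S_def)
    next
      fix t assume "t \<in> {(a, x, y), (a, - x, - y)}"
      then show "t \<in> fib b" using axy neg by (auto simp: fib_def S_def prim_reps_def)
    qed
    moreover have "(a, x, y) \<noteq> (a, - x, - y)"
      using axy(2) by (auto simp: prim_reps_def)
    ultimately show "card (fib b) = 2" by simp
  qed
  finally show ?thesis by simp
qed

lemma prim_reps_chi8:
  assumes "a \<in> diag_forms" "odd n" "(x, y) \<in> prim_reps a (238 div a) n"
  shows "chi8 n = 1"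
proof -
  have *: "\<forall>a\<in>set [1,2,7,14]. \<forall>i\<in>set [0..7]. \<forall>j\<in>set [0..7].
      (a * i * i + 0 * i * j + (238 div a) * j * j) mod 8 \<in> {0,1,2,4,6,7::int}"
    by code_simp
  have xy8: "x mod 8 \<in> set [0..7]" "y mod 8 \<in> set [0..7]" by auto
  have "int n = a * x\<^sup>2 + 0 * x * y + (238 div a) * y\<^sup>2" using assms(3) by (simp add: prim_reps_def)
  then have "int n mod 8 = (a * (x mod 8) * (x mod 8) + 0 * (x mod 8) * (y mod 8) + (238 div a) * (y mod 8) * (y mod 8)) mod 8"
    by (simp only: quadratic_form_mod)
  also have "\<dots> \<in> {0,1,2,4,6,7}"
  proof -
    have "a \<in> set [1,2,7,14]" using assms(1) by (simp add: diag_forms_def)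
    from *[rule_format, OF this xy8] show ?thesis .
  qed
  finally have "int (n mod 8) \<in> {0,1,2,4,6,7}" by (simp add: zmod_int)
  then have "n mod 8 \<in> {0,1,2,4,6,7}" by auto
  moreover have "n mod 8 \<notin> {0,2,4,6}" using assms(2) by auto presburger+
  ultimately show ?thesis using assms(2) by (auto simp: chi8_def)
qed

text \<open>All four second coefficients 238 / a are divisible by 17, so n = a x^2 modulo 17 and
  chi17 n = chi17 a.\<close>

lemma prim_reps_chi17:
  assumes "a \<in> diag_forms" "\<not> 17 dvd n" "(x, y) \<in> prim_reps a (238 div a) n"
  shows "chi17 n = (if a \<in> {1, 2} then 1 else -1)"
proof -
  have *: "\<forall>a\<in>set [1,2,7,14]. \<forall>i\<in>set [0..16].
      (a * (i * i)) mod 17 \<noteq> (0::int) \<longrightarrow> chi17 (nat ((a * (i * i)) mod 17)) = (if a = 1 \<or> a = 2 then 1 else -1)"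
    by code_simp
  have x: "x mod 17 \<in> set [0..16]" by auto
  obtain c where c: "238 div a = 17 * c" using assms(1) by (auto simp: diag_forms_def)
  have "int n = a * x\<^sup>2 + 17 * c * y\<^sup>2" using assms(3) c by (simp add: prim_reps_def)
  then have "int n mod 17 = (a * x\<^sup>2) mod 17"
    by (metis mod_mult_self2 mult.assoc)
  also have "\<dots> = (a * ((x mod 17) * (x mod 17))) mod 17"
    using quadratic_form_mod[of a x 0 0 0 17] by (simp add: mult.assoc)
  finally have m: "int n mod 17 = (a * ((x mod 17) * (x mod 17))) mod 17" .
  then have n: "n mod 17 = nat ((a * ((x mod 17) * (x mod 17))) mod 17)"
    by (metis nat_int of_nat_numeral zmod_int)
  have nz: "(a * ((x mod 17) * (x mod 17))) mod 17 \<noteq> 0"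
    using assms(2) n by (metis dvd_eq_mod_eq_0 nat_0)
  have "a \<in> set [1,2,7,14]" using assms(1) by (simp add: diag_forms_def)
  from *[rule_format, OF this x nz] have "chi17 (n mod 17) = (if a = 1 \<or> a = 2 then 1 else -1)"
    unfolding n .
  then show ?thesis by (simp add: chi17_mod)
qed

text \<open>Sorts the representations by g = gcd x y; \<open>F g\<close> consists of those with this
  gcd.\<close>

lemma form_count_prim_reps:
  fixes a c :: int
  assumes ac: "a > 0" "c > 0" and n: "n > 0"
  shows "form_count a c n = (\<Sum>g | g\<^sup>2 dvd n. card (prim_reps a c (n div g\<^sup>2)))"
proof -
  define F where "F g = (\<lambda>(x, y). (int g * x, int g * y)) ` prim_reps a c (n div g\<^sup>2)" for g
  have gpos: "g > 0" if "g\<^sup>2 dvd n" for g using that n by (cases g) auto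
  have gcdF: "gcd (fst z) (snd z) = int g" if "z \<in> F g" for z g
    using that by (auto simp: F_def prim_reps_def gcd_mult_left coprime_iff_gcd_eq_1 coprime_imp_gcd_eq_1)
  have "{(x, y). a * x\<^sup>2 + c * y\<^sup>2 = int n} = (\<Union>g\<in>{g. g\<^sup>2 dvd n}. F g)"
  proof (intro equalityI subsetI)
    fix z assume "z \<in> {(x, y). a * x\<^sup>2 + c * y\<^sup>2 = int n}"
    then obtain x y where z: "z = (x, y)" and e: "a * x\<^sup>2 + c * y\<^sup>2 = int n" by auto
    have nz: "gcd x y \<noteq> 0" using e n by auto
    define g where "g = nat (gcd x y)"
    have ig: "int g = gcd x y" by (simp add: g_def)
    obtain x' y' where xy: "x = x' * int g" "y = y' * int g" "coprime x' y'"
      using gcd_coprime_exists[OF nz] unfolding ig by blast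
    have e': "(int g)\<^sup>2 * (a * x'\<^sup>2 + c * y'\<^sup>2) = int n"
      unfolding e[symmetric] by (simp add: xy(1,2) power_mult_distrib algebra_simps)
    then have "(int g)\<^sup>2 dvd int n" by (metis dvd_triv_left)
    then have gn: "g\<^sup>2 dvd n" by (metis of_nat_dvd_iff of_nat_power)
    have "a * x'\<^sup>2 + c * y'\<^sup>2 = int (n div g\<^sup>2)"
    proof -
      have "int n div (int g)\<^sup>2 = a * x'\<^sup>2 + c * y'\<^sup>2"
        unfolding e'[symmetric] using nz ig by simp
      then show ?thesis by (simp add: zdiv_int)
    qed
    then have "(x', y') \<in> prim_reps a c (n div g\<^sup>2)" using xy(3) by (simp add: prim_reps_def)
    moreover have "z = (int g * x', int g * y')" using xy(1,2) z by (simp add: mult.commute)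
    ultimately have "z \<in> F g" unfolding F_def by force
    then show "z \<in> (\<Union>g\<in>{g. g\<^sup>2 dvd n}. F g)" using gn by blast
  next
    fix z assume "z \<in> (\<Union>g\<in>{g. g\<^sup>2 dvd n}. F g)"
    then obtain g x y where g: "g\<^sup>2 dvd n" and xy: "a * x\<^sup>2 + c * y\<^sup>2 = int (n div g\<^sup>2)"
      and z: "z = (int g * x, int g * y)"
      by (auto simp: F_def prim_reps_def)
    have "a * (int g * x)\<^sup>2 + c * (int g * y)\<^sup>2 = (int g)\<^sup>2 * (a * x\<^sup>2 + c * y\<^sup>2)"
      by (simp add: power_mult_distrib algebra_simps)
    also have "\<dots> = int (g\<^sup>2 * (n div g\<^sup>2))" unfolding xy by simp
    also have "\<dots> = int n" using g by simp
    finally show "z \<in> {(x, y). a * x\<^sup>2 + c * y\<^sup>2 = int n}" using z by simp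
  qed
  then have "form_count a c n = card (\<Union>g\<in>{g. g\<^sup>2 dvd n}. F g)" by (simp add: form_count_def)
  also have "\<dots> = (\<Sum>g | g\<^sup>2 dvd n. card (F g))"
  proof (rule card_UN_disjoint)
    show "\<forall>i\<in>{g. g\<^sup>2 dvd n}. \<forall>j\<in>{g. g\<^sup>2 dvd n}. i \<noteq> j \<longrightarrow> F i \<inter> F j = {}"
      using gcdF by (metis disjoint_iff nat_int)
    show "\<forall>i\<in>{g. g\<^sup>2 dvd n}. finite (F i)"
      using finite_prim_reps[OF ac] by (simp add: F_def)
  qed (use finite_square_divisors[OF n] in simp)
  also have "\<dots> = (\<Sum>g | g\<^sup>2 dvd n. card (prim_reps a c (n div g\<^sup>2)))"
  proof (rule sum.cong[OF refl])
    fix g assume "g \<in> {g. g\<^sup>2 dvd n}"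
    then have "int g \<noteq> 0" using gpos by auto
    then show "card (F g) = card (prim_reps a c (n div g\<^sup>2))"
      unfolding F_def by (intro card_image) (auto simp: inj_on_def)
  qed
  finally show ?thesis .
qed

text \<open>Up to sign, the forms in \<open>diag_forms\<close> are permuted by the primes \<open>2\<close>, \<open>7\<close>, \<open>17\<close> dividing the discriminant,
  which reduces the comparison of \<open>genus_count\<close> with \<open>chi_conv\<close> to arguments coprime to \<open>238\<close>.\<close>

definition genus_count :: "nat \<Rightarrow> int" where
  "genus_count n = int (form_count 1 238 n) + int (form_count 2 119 n)
     - int (form_count 7 34 n) - int (form_count 14 17 n)"

definition chi_conv :: "nat \<Rightarrow> int" where
  "chi_conv n = (\<Sum>d | d dvd n. chi17 d * (chi8 (n div d) * chi7 (n div d)))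
     + (\<Sum>d | d dvd n. chi8 d * chi17 d * chi7 (n div d))"

text \<open>If chi8 n = -1 nothing is represented. If chi8 n = 1, all twice-the-roots
  representations belong to the two forms whose sign in the combination is chi17 n.\<close>

lemma prim_genus_count:
  assumes n: "n > 0" "coprime n 238"
  shows "int (card (prim_reps 1 238 n)) + int (card (prim_reps 2 119 n))
    - int (card (prim_reps 7 34 n)) - int (card (prim_reps 14 17 n))
    = (1 + chi8 n) * chi17 n * int (card (roots (-238) n))"
proof -
  have "odd n" using n(2) by (metis coprime_common_divisor dvd_triv_left even_numeral odd_one)
  have "\<not> 17 dvd n"
  proof
    assume "17 dvd n"
    moreover have "17 dvd (238::nat)" by simp
    ultimately have "is_unit (17::nat)" using n(2) by (metis coprime_common_divisor)
    then show False by simp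
  qed
  have e8: "prim_reps a (238 div a) n = {}" if "a \<in> diag_forms" "chi8 n \<noteq> 1" for a
    using prim_reps_chi8[OF that(1) \<open>odd n\<close>] that(2) by auto
  have e17: "prim_reps a (238 div a) n = {}" if "a \<in> diag_forms" "chi17 n \<noteq> (if a \<in> {1, 2} then 1 else -1)" for a
    using prim_reps_chi17[OF that(1) \<open>\<not> 17 dvd n\<close>] that(2) by (metis equals0I surj_pair)
  show ?thesis
  proof (cases "chi8 n = 1")
    case False
    then have "chi8 n = -1" using \<open>odd n\<close> by (auto simp: chi8_def split: if_splits)
    then show ?thesis using e8[of 1] e8[of 2] e8[of 7] e8[of 14] by (simp add: diag_forms_def)
  next
    case True
    have tot: "card (prim_reps 1 238 n) + card (prim_reps 2 119 n)
      + card (prim_reps 7 34 n) + card (prim_reps 14 17 n) = 2 * card (roots (-238) n)"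
      using card_prim_reps_total[OF n(1) True n(2)] by (simp add: diag_forms_def)
    have "chi17 n = 1 \<or> chi17 n = -1"
      using \<open>\<not> 17 dvd n\<close> by (auto simp: chi17_def mod_eq_0_iff_dvd)
    then show ?thesis
      using tot True e17[of 1] e17[of 2] e17[of 7] e17[of 14] by (auto simp: diag_forms_def)
  qed
qed

lemma divisor_sum_reverse:
  fixes f :: "nat \<Rightarrow> int"
  assumes "n > 0"
  shows "(\<Sum>d | d dvd n. f (n div d)) = (\<Sum>d | d dvd n. f d)"
  by (rule sum.reindex_bij_witness[where i = "\<lambda>d. n div d" and j = "\<lambda>d. n div d"])
     (use assms in \<open>auto simp: div_dvd_iff_mult dvd_div_eq_0_iff elim: dvdE\<close>)

text \<open>For n = d e the squares of the signs at e are 1, so chi17 n * chiD e = chi17 d * (chi8 e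
  * chi7 e), and the extra factor chi8 n moves chi8 from e to d. The two parts of 1 + chi8 n thus
  become the two convolutions.\<close>

lemma genus_count_coprime:
  assumes n: "n > 0" "coprime n 238"
  shows "genus_count n = chi_conv n"
proof -
  have sgn: "chi8 d * chi8 d = 1" "chi17 d * chi17 d = 1" if "d dvd n" for d
  proof -
    have c: "coprime d 238" using that n(2) by (metis coprime_divisors dvd_refl)
    have "odd d" using c by (metis coprime_common_divisor dvd_triv_left even_numeral odd_one)
    moreover have "\<not> 17 dvd d"
    proof
      assume "17 dvd d"
      moreover have "17 dvd (238::nat)" by simp
      ultimately have "is_unit (17::nat)" using c by (metis coprime_common_divisor)
      then show False by simp
    qed
    ultimately show "chi8 d * chi8 d = 1" "chi17 d * chi17 d = 1"
      by (auto simp: chi8_def chi17_def mod_eq_0_iff_dvd)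
  qed
  have P: "form_count a c n = (\<Sum>g | g\<^sup>2 dvd n. card (prim_reps a c (n div g\<^sup>2)))" if "a > 0" "c > 0" for a c
    using form_count_prim_reps[OF that n(1)] .
  have "genus_count n = (\<Sum>g | g\<^sup>2 dvd n. int (card (prim_reps 1 238 (n div g\<^sup>2))) + int (card (prim_reps 2 119 (n div g\<^sup>2)))
      - int (card (prim_reps 7 34 (n div g\<^sup>2))) - int (card (prim_reps 14 17 (n div g\<^sup>2))))"
    by (simp add: genus_count_def P sum.distrib sum_subtractf)
  also have "\<dots> = (\<Sum>g | g\<^sup>2 dvd n. (1 + chi8 n) * chi17 n * int (card (roots (-238) (n div g\<^sup>2))))"
  proof (rule sum.cong[OF refl])
    fix g assume "g \<in> {g. g\<^sup>2 dvd n}"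
    then obtain m where m: "n = g\<^sup>2 * m" by auto
    have g0: "g > 0" and m0: "m > 0" using n(1) m by (auto intro: Nat.gr0I)
    have mdef: "n div g\<^sup>2 = m" using m g0 by simp
    have "coprime m 238" using n(2) m by simp
    have "g dvd n" using m by (simp add: power2_eq_square)
    \<comment> \<open>n and m differ by a square prime to the moduli, so the characters do not see
      the passage to primitive representations.\<close>
    have "chi8 n = chi8 m" "chi17 n = chi17 m"
      using sgn[OF \<open>g dvd n\<close>] by (simp_all add: m chi8_mult chi17_mult power2_eq_square)
    then show "int (card (prim_reps 1 238 (n div g\<^sup>2))) + int (card (prim_reps 2 119 (n div g\<^sup>2)))
      - int (card (prim_reps 7 34 (n div g\<^sup>2))) - int (card (prim_reps 14 17 (n div g\<^sup>2)))
      = (1 + chi8 n) * chi17 n * int (card (roots (-238) (n div g\<^sup>2)))"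
      unfolding mdef using prim_genus_count[OF m0 \<open>coprime m 238\<close>] by simp
  qed
  also have "\<dots> = (1 + chi8 n) * chi17 n * (\<Sum>d | d dvd n. chiD d)"
    using sum_card_roots[OF n] by (simp add: sum_distrib_left[symmetric])
  also have "\<dots> = (\<Sum>d | d dvd n. chi17 n * chiD (n div d)) + (\<Sum>d | d dvd n. chi8 n * chi17 n * chiD (n div d))"
    unfolding sum_distrib_left[symmetric] divisor_sum_reverse[OF n(1)] by (simp add: algebra_simps)
  also have "\<dots> = chi_conv n"
    unfolding chi_conv_def
  proof (intro arg_cong2[of _ _ _ _ "(+)"] sum.cong refl)
    fix d assume "d \<in> {d. d dvd n}"
    then obtain e where e: "n = d * e" by auto
    have de: "n div d = e" using n(1) e by (cases "d = 0") auto
    have "e dvd n" using e by simp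
    note s = sgn[OF this]
    have "chi17 n * chiD e = chi17 d * (chi17 e * chi17 e) * (chi8 e * chi7 e)"
      by (simp add: e chiD_def chi17_mult)
    then show "chi17 n * chiD (n div d) = chi17 d * (chi8 (n div d) * chi7 (n div d))"
      unfolding de s by simp
    have "chi8 n * chi17 n * chiD e = chi8 d * chi17 d * ((chi8 e * chi8 e) * (chi17 e * chi17 e)) * chi7 e"
      by (simp add: e chiD_def chi17_mult chi8_mult)
    then show "chi8 n * chi17 n * chiD (n div d) = chi8 d * chi17 d * chi7 (n div d)"
      unfolding de s by simp
  qed
  finally show ?thesis .
qed

text \<open>Where g vanishes at p, divisors involving p drop out on the g side, and the additional
  prime always falls to f. Both orders of the convolution occur below.\<close>

lemma convolution_ramified:
  fixes f g :: "nat \<Rightarrow> int"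
  assumes f: "\<And>m n. f (m * n) = f m * f n" and g: "\<And>m n. g (m * n) = g m * g n"
    and p: "prime p" "g p = 0" and n: "n > 0"
  shows "(\<Sum>d | d dvd p * n. f d * g (p * n div d)) = f p * (\<Sum>d | d dvd n. f d * g (n div d))"
    and "(\<Sum>d | d dvd p * n. g d * f (p * n div d)) = f p * (\<Sum>d | d dvd n. g d * f (n div d))"
proof -
  have p0: "p > 0" using p(1) by (simp add: prime_gt_0_nat)
  have gp: "g d = 0" if "p dvd d" for d using that p(2) g by (auto elim!: dvdE)
  have "(\<Sum>d | d dvd p * n. g d * f (p * n div d)) = (\<Sum>d | d dvd n. g d * f (p * n div d))"
  proof (rule sum.mono_neutral_right)
    show "finite {d. d dvd p * n}" using n p0 by simp
    show "\<forall>d\<in>{d. d dvd p * n} - {d. d dvd n}. g d * f (p * n div d) = 0"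
    proof
      fix d assume d: "d \<in> {d. d dvd p * n} - {d. d dvd n}"
      have "p dvd d"
      proof (rule ccontr)
        assume "\<not> p dvd d"
        then have "coprime p d" using p(1) by (simp add: prime_imp_coprime)
        then show False using d by (auto simp: coprime_dvd_mult_right_iff coprime_commute)
      qed
      then show "g d * f (p * n div d) = 0" using gp by simp
    qed
  qed auto
  also have "\<dots> = (\<Sum>d | d dvd n. f p * (g d * f (n div d)))"
    by (intro sum.cong refl) (auto simp: div_mult_swap[symmetric] f)
  finally show 2: "(\<Sum>d | d dvd p * n. g d * f (p * n div d)) = f p * (\<Sum>d | d dvd n. g d * f (n div d))"
    by (simp add: sum_distrib_left)
  have sw: "(\<Sum>d | d dvd m. f d * g (m div d)) = (\<Sum>d | d dvd m. g d * f (m div d))" if "m > 0" for m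
    by (rule sum.reindex_bij_witness[where i = "\<lambda>d. m div d" and j = "\<lambda>d. m div d"])
      (use that in \<open>auto simp: div_dvd_iff_mult dvd_div_eq_0_iff elim: dvdE\<close>)
  show "(\<Sum>d | d dvd p * n. f d * g (p * n div d)) = f p * (\<Sum>d | d dvd n. f d * g (n div d))"
    using 2 sw[of n] sw[of "p * n"] n p0 by simp
qed

lemma chi87_mult: "chi8 (m * n) * chi7 (m * n) = (chi8 m * chi7 m) * (chi8 n * chi7 n)"
  and chi817_mult: "chi8 (m * n) * chi17 (m * n) = (chi8 m * chi17 m) * (chi8 n * chi17 n)"
  by (simp_all add: chi8_mult chi7_mult chi17_mult)

text \<open>At each of 2, 7, 17 exactly one character of either product vanishes; the surviving ones
  take the same value there, 1 at 2 and -1 at 7 and 17.\<close>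

lemma chi_conv_ramified:
  assumes "n > 0"
  shows "chi_conv (2 * n) = chi_conv n" "chi_conv (7 * n) = - chi_conv n" "chi_conv (17 * n) = - chi_conv n"
proof -
  note r = convolution_ramified[OF _ _ _ _ assms]
  have v: "chi17 2 = 1" "chi17 7 = -1" "chi17 17 = 0" "chi7 2 = 1" "chi7 7 = 0" "chi7 17 = -1"
     "chi8 2 = 0" "chi8 7 = 1" "chi8 17 = 1"
    by (simp_all add: chi17_def chi7_def chi8_def)
  show "chi_conv (2 * n) = chi_conv n"
    unfolding chi_conv_def
    using r(1)[of chi17 "\<lambda>n. chi8 n * chi7 n" 2, OF chi17_mult chi87_mult]
      r(2)[of chi7 "\<lambda>n. chi8 n * chi17 n" 2, OF chi7_mult chi817_mult] v by simp
  show "chi_conv (7 * n) = - chi_conv n"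
    unfolding chi_conv_def
    using r(1)[of chi17 "\<lambda>n. chi8 n * chi7 n" 7, OF chi17_mult chi87_mult]
      r(1)[of "\<lambda>n. chi8 n * chi17 n" chi7 7, OF chi817_mult chi7_mult] v by simp
  show "chi_conv (17 * n) = - chi_conv n"
    unfolding chi_conv_def
    using r(2)[of "\<lambda>n. chi8 n * chi7 n" chi17 17, OF chi87_mult chi17_mult]
      r(2)[of chi7 "\<lambda>n. chi8 n * chi17 n" 17, OF chi7_mult chi817_mult] v by simp
qed

lemma form_count_swap: "form_count a c n = form_count c a n"
  unfolding form_count_def
  by (rule bij_betw_same_card[of prod.swap], rule bij_betw_byWitness[of _ prod.swap]) (auto simp: add.commute)

text \<open>Divisibility forces p to divide x; dividing the equation by p then moves p from the
  second coefficient to the first.\<close>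

lemma form_count_ramified:
  fixes a c p :: int
  assumes "prime p" "\<not> p dvd a" "p > 0"
  shows "form_count a (p * c) (nat p * n) = form_count (p * a) c n"
proof -
  have "bij_betw (\<lambda>(x, y). (p * x, y)) {(x, y). p * a * x\<^sup>2 + c * y\<^sup>2 = int n}
      {(x, y). a * x\<^sup>2 + p * c * y\<^sup>2 = int (nat p * n)}"
  proof (intro bij_betw_imageI equalityI subsetI)
    show "inj_on (\<lambda>(x, y). (p * x, y)) {(x, y). p * a * x\<^sup>2 + c * y\<^sup>2 = int n}"
      using assms(3) by (auto simp: inj_on_def)
  next
    fix z assume "z \<in> (\<lambda>(x, y). (p * x, y)) ` {(x, y). p * a * x\<^sup>2 + c * y\<^sup>2 = int n}"
    then obtain x y where z: "z = (p * x, y)" and e: "p * a * x\<^sup>2 + c * y\<^sup>2 = int n" by auto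
    have "a * (p * x)\<^sup>2 + p * c * y\<^sup>2 = p * (p * a * x\<^sup>2 + c * y\<^sup>2)"
      by (simp add: power2_eq_square algebra_simps)
    then show "z \<in> {(x, y). a * x\<^sup>2 + p * c * y\<^sup>2 = int (nat p * n)}"
      using z e assms(3) by simp
  next
    fix z assume "z \<in> {(x, y). a * x\<^sup>2 + p * c * y\<^sup>2 = int (nat p * n)}"
    then obtain x y where z: "z = (x, y)" and e: "a * x\<^sup>2 + p * c * y\<^sup>2 = p * int n"
      using assms(3) by auto
    have "a * x\<^sup>2 = p * (int n - c * y\<^sup>2)" using e by (simp add: algebra_simps)
    then have "p dvd a * x\<^sup>2" by simp
    then have "p dvd x" using assms(1,2) by (metis prime_dvd_mult_iff prime_dvd_power)
    then obtain x' where x': "x = p * x'" by auto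
    have "p * (p * a * x'\<^sup>2 + c * y\<^sup>2) = p * int n"
      using e by (simp add: x' power2_eq_square algebra_simps)
    then have "p * a * x'\<^sup>2 + c * y\<^sup>2 = int n" using assms(3) by simp
    then show "z \<in> (\<lambda>(x, y). (p * x, y)) ` {(x, y). p * a * x\<^sup>2 + c * y\<^sup>2 = int n}"
      using z x' by force
  qed
  from bij_betw_same_card[OF this] show ?thesis by (simp add: form_count_def)
qed

text \<open>By leading coefficient, 2 exchanges 1 with 2 and 7 with 14, keeping the signs; 7
  exchanges 1 with 7 and 2 with 14; 17 exchanges 1 with 14 and 2 with 7.\<close>

lemma genus_count_ramified:
  "genus_count (2 * n) = genus_count n" "genus_count (7 * n) = - genus_count n"
  "genus_count (17 * n) = - genus_count n"
proof -
  note sw = form_count_swap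
  note r2 = form_count_ramified[of 2 _ _ n, simplified]
  note r7 = form_count_ramified[of 7 _ _ n, simplified]
  note r17 = form_count_ramified[of 17 _ _ n, simplified]
  show "genus_count (2 * n) = genus_count n"
    unfolding genus_count_def
    using r2[of 1 119] r2[of 119 1] r2[of 7 17] r2[of 17 7]
      sw[of 2 119 "2 * n"] sw[of 14 17 "2 * n"] sw[of 238 1 n] sw[of 34 7 n] by simp
  show "genus_count (7 * n) = - genus_count n"
    unfolding genus_count_def
    using r7[of 1 34] r7[of 34 1] r7[of 2 17] r7[of 17 2]
      sw[of 7 34 "7 * n"] sw[of 14 17 "7 * n"] sw[of 238 1 n] sw[of 119 2 n] by simp
  show "genus_count (17 * n) = - genus_count n"
    unfolding genus_count_def
    using r17[of 1 14] r17[of 14 1] r17[of 2 7] r17[of 7 2]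
      sw[of 17 14 n] sw[of 238 1 n] sw[of 119 2 n] sw[of 34 7 n] by simp
qed

theorem genus_count_eq:
  assumes "n > 0"
  shows "genus_count n = chi_conv n"
  using assms
proof (induction n rule: less_induct)
  case (less n)
  show ?case
  proof (cases "coprime n 238")
    case True
    then show ?thesis using genus_count_coprime less.prems by blast
  next
    case False
    then have "gcd n 238 \<noteq> 1" using coprime_iff_gcd_eq_1 by blast
    then obtain p where p: "prime p" "p dvd gcd n 238" using prime_factor_nat by blast
    then have "p dvd n" "p dvd 238" by simp_all
    then have "p dvd 2 * (7 * 17)" by simp
    then have "p dvd 2 \<or> p dvd 7 \<or> p dvd 17" using p(1) by (metis prime_dvd_mult_iff)
    then have p': "p = 2 \<or> p = 7 \<or> p = 17" using p(1) by (auto simp: primes_dvd_imp_eq)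
    obtain m where m: "n = p * m" using \<open>p dvd n\<close> by auto
    have "m > 0" "m < n" using m less.prems p' by auto
    then have "genus_count m = chi_conv m" using less.IH by blast
    then show ?thesis
      using p' m genus_count_ramified chi_conv_ramified[OF \<open>m > 0\<close>] by auto
  qed
qed

subsection \<open>Kronecker's limit formula for diagonal forms\<close>

text \<open>The integral test with error at most f 0; an antiderivative with a limit stands in for
  the improper integral.\<close>

lemma integral_comparison:
  fixes f F :: "real \<Rightarrow> real"
  assumes der: "\<And>x. x \<ge> 0 \<Longrightarrow> (F has_real_derivative f x) (at x)"
    and F0: "F 0 = 0"
    and dec: "\<And>x y. 0 \<le> x \<Longrightarrow> x \<le> y \<Longrightarrow> f y \<le> f x"
    and nonneg: "\<And>x. 0 \<le> x \<Longrightarrow> 0 \<le> f x"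
    and lim: "(\<lambda>n. F (real n)) \<longlonglongrightarrow> L"
  shows "summable (\<lambda>k. f (real (Suc k)))" "L \<le> f 0 + (\<Sum>k. f (real (Suc k)))" "(\<Sum>k. f (real (Suc k))) \<le> L"
proof -
  have step: "f (real (Suc k)) \<le> F (real (Suc k)) - F (real k) \<and> F (real (Suc k)) - F (real k) \<le> f (real k)" for k
  proof -
    have "\<exists>z>real k. z < real (Suc k) \<and> F (real (Suc k)) - F (real k) = (real (Suc k) - real k) * f z"
      by (rule MVT2) (auto intro: der)
    then obtain z where z: "real k < z" "z < real (Suc k)" "F (real (Suc k)) - F (real k) = f z" by auto
    then show ?thesis using dec[of z "real (Suc k)"] dec[of "real k" z] by auto
  qed
  have tel: "(\<Sum>k<n. F (real (Suc k)) - F (real k)) = F (real n)" for n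
    using sum_lessThan_telescope[of "\<lambda>k. F (real k)" n] F0 by simp
  have "incseq (\<lambda>n. F (real n))"
    by (rule incseq_SucI) (use step nonneg in \<open>smt (verit) of_nat_0_le_iff\<close>)
  then have FL: "F (real n) \<le> L" for n using lim by (rule incseq_le)
  have up: "(\<Sum>k<n. f (real (Suc k))) \<le> L" for n
    using sum_mono[of "{..<n}" "\<lambda>k. f (real (Suc k))"] step tel[of n] FL[of n] by (smt (verit))
  show sm: "summable (\<lambda>k. f (real (Suc k)))"
    by (rule summableI_nonneg_bounded[where x = L]) (use nonneg up in auto)
  show "(\<Sum>k. f (real (Suc k))) \<le> L" by (rule suminf_le_const[OF sm]) (use up in auto)
  have "F (real n) \<le> f 0 + (\<Sum>k. f (real (Suc k)))" for n
  proof -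
    have "F (real n) \<le> (\<Sum>k<n. f (real k))"
      using sum_mono[of "{..<n}" "\<lambda>k. F (real (Suc k)) - F (real k)" "\<lambda>k. f (real k)"] step tel[of n] by simp
    also have "\<dots> \<le> (\<Sum>k<Suc n. f (real k))" using nonneg by simp
    also have "\<dots> = f 0 + (\<Sum>k<n. f (real (Suc k)))"
      by (subst sum.lessThan_Suc_shift) simp
    also have "\<dots> \<le> f 0 + (\<Sum>k. f (real (Suc k)))"
      using sum_le_suminf[OF sm, of "{..<n}"] nonneg by auto
    finally show ?thesis .
  qed
  then show "L \<le> f 0 + (\<Sum>k. f (real (Suc k)))"
    by (intro LIMSEQ_le_const2[OF lim]) auto
qed

text \<open>Starting the integral at \<open>-1\<close> makes \<open>0\<close> an interior point, so the derivatives are two-sided.\<close>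

definition kernel_int :: "real \<Rightarrow> real \<Rightarrow> real" where
  "kernel_int s X = integral {-1..X} (\<lambda>u. (1 + u\<^sup>2) powr - s) - integral {-1..0} (\<lambda>u. (1 + u\<^sup>2) powr - s)"

lemma one_plus_square_pos: "0 < 1 + (u::real)\<^sup>2"
  by (simp add: add_pos_nonneg)

lemma kernel_int_0 [simp]: "kernel_int s 0 = 0"
  by (simp add: kernel_int_def)

lemma kernel_int_deriv:
  assumes "X \<ge> 0"
  shows "(kernel_int s has_real_derivative (1 + X\<^sup>2) powr - s) (at X)"
proof -
  have "continuous_on {-1..X + 1} (\<lambda>u. (1 + u\<^sup>2) powr - s)"
    using one_plus_square_pos by (intro continuous_intros) (metis less_irrefl)
  then have "((\<lambda>X. integral {-1..X} (\<lambda>u. (1 + u\<^sup>2) powr - s)) has_real_derivative (1 + X\<^sup>2) powr - s) (at X within {-1..X + 1})"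
    using assms by (intro integral_has_real_derivative) auto
  moreover have "at X within {-1..X + 1} = at X"
    using assms by (intro at_within_interior) auto
  ultimately show ?thesis
    unfolding kernel_int_def[abs_def] by (auto intro!: derivative_eq_intros)
qed

lemma kernel_int_mono:
  assumes "0 \<le> X" "X \<le> Y"
  shows "kernel_int s X \<le> kernel_int s Y"
proof (rule DERIV_nonneg_imp_nondecreasing[OF assms(2)])
  fix x assume "X \<le> x" "x \<le> Y"
  then show "\<exists>y. (kernel_int s has_real_derivative y) (at x) \<and> 0 \<le> y"
    using kernel_int_deriv[of x s] assms by auto
qed

lemma kernel_int_le_arctan:
  assumes "s \<ge> 1" "X \<ge> 0"
  shows "kernel_int s X \<le> arctan X"
proof -
  have "arctan 0 - kernel_int s 0 \<le> arctan X - kernel_int s X"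
  proof (rule DERIV_nonneg_imp_nondecreasing[OF assms(2)])
    fix x assume x: "0 \<le> x" "x \<le> X"
    have "((\<lambda>x. arctan x - kernel_int s x) has_real_derivative inverse (1 + x\<^sup>2) - (1 + x\<^sup>2) powr - s) (at x)"
      using kernel_int_deriv[OF x(1)] by (intro DERIV_diff DERIV_arctan)
    moreover have "(1 + x\<^sup>2) powr - s \<le> (1 + x\<^sup>2) powr - 1" using assms by (intro powr_mono) auto
    ultimately show "\<exists>y. ((\<lambda>x. arctan x - kernel_int s x) has_real_derivative y) (at x) \<and> 0 \<le> y"
      using one_plus_square_pos[of x] by (auto simp: powr_minus powr_one)
  qed
  then show ?thesis by simp
qed

text \<open>On [0, X] the integrand is at least (1 + X^2)^(1 - s) times its value for s = 1, a bound
  that becomes sharp as s tends to 1 with X fixed.\<close>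

lemma kernel_int_ge:
  assumes "s \<ge> 1" "X \<ge> 0"
  shows "(1 + X\<^sup>2) powr (1 - s) * arctan X \<le> kernel_int s X"
proof -
  define C where "C = (1 + X\<^sup>2) powr (1 - s)"
  have "kernel_int s 0 - C * arctan 0 \<le> kernel_int s X - C * arctan X"
  proof (rule DERIV_nonneg_imp_nondecreasing[OF assms(2)])
    fix x assume x: "0 \<le> x" "x \<le> X"
    have "((\<lambda>x. kernel_int s x - C * arctan x) has_real_derivative (1 + x\<^sup>2) powr - s - C * inverse (1 + x\<^sup>2)) (at x)"
      using kernel_int_deriv[OF x(1)] by (intro DERIV_diff DERIV_cmult DERIV_arctan)
    moreover have "C * inverse (1 + x\<^sup>2) \<le> (1 + x\<^sup>2) powr (1 - s) * inverse (1 + x\<^sup>2)"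
      unfolding C_def using assms x one_plus_square_pos[of x]
      by (intro mult_right_mono powr_mono2') (auto intro: power_mono)
    moreover have "(1 + x\<^sup>2) powr (1 - s) * inverse (1 + x\<^sup>2) = (1 + x\<^sup>2) powr - s"
    proof -
      have "inverse (1 + x\<^sup>2) = (1 + x\<^sup>2) powr - 1" using one_plus_square_pos[of x] by (simp add: powr_minus)
      then show ?thesis unfolding powr_add[symmetric] by (simp only: powr_add[symmetric]) simp
    qed
    ultimately show "\<exists>y. ((\<lambda>x. kernel_int s x - C * arctan x) has_real_derivative y) (at x) \<and> 0 \<le> y"
      by (intro exI[of _ "(1 + x\<^sup>2) powr - s - C * inverse (1 + x\<^sup>2)"]) auto
  qed
  then show ?thesis by (simp add: C_def)
qed

text \<open>The integral over the half-line, taken as a supremum because \<open>kernel_int\<close>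
  is monotone in X.\<close>

definition kernel_lim :: "real \<Rightarrow> real" where
  "kernel_lim s = (SUP X\<in>{0..}. kernel_int s X)"

lemma kernel_int_bdd: "s \<ge> 1 \<Longrightarrow> bdd_above (kernel_int s ` {0..})"
  using kernel_int_le_arctan arctan_ubound by (intro bdd_aboveI2[of _ _ "pi / 2"]) (meson atLeast_iff less_imp_le order_trans)

lemma kernel_int_le_lim: "s \<ge> 1 \<Longrightarrow> X \<ge> 0 \<Longrightarrow> kernel_int s X \<le> kernel_lim s"
  unfolding kernel_lim_def by (intro cSUP_upper kernel_int_bdd) auto

lemma kernel_int_tendsto:
  assumes "s \<ge> 1"
  shows "(kernel_int s \<longlongrightarrow> kernel_lim s) at_top"
proof (rule increasing_tendsto)
  show "\<forall>\<^sub>F X in at_top. kernel_int s X \<le> kernel_lim s"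
    using eventually_ge_at_top[of 0] by eventually_elim (use kernel_int_le_lim assms in auto)
  fix x assume "x < kernel_lim s"
  then obtain X0 where X0: "X0 \<ge> 0" "x < kernel_int s X0"
    unfolding kernel_lim_def using less_cSUP_iff[OF _ kernel_int_bdd[OF assms]] by auto
  show "\<forall>\<^sub>F X in at_top. x < kernel_int s X"
    using eventually_ge_at_top[of X0] by eventually_elim (use X0 kernel_int_mono in \<open>meson less_le_trans\<close>)
qed

lemma kernel_lim_le: "s \<ge> 1 \<Longrightarrow> kernel_lim s \<le> pi / 2"
  unfolding kernel_lim_def
proof (rule cSUP_least)
  fix X :: real assume "s \<ge> 1" "X \<in> {0..}"
  then show "kernel_int s X \<le> pi / 2"
    using kernel_int_le_arctan[of s X] arctan_ubound[of X] by auto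
qed auto

text \<open>Fix X with arctan X above the target first, and only then let s tend to 1.\<close>

lemma kernel_lim_tendsto: "(kernel_lim \<longlongrightarrow> pi / 2) (at_right 1)"
proof (rule increasing_tendsto)
  show "\<forall>\<^sub>F s in at_right 1. kernel_lim s \<le> pi / 2"
    using eventually_at_right_less[of 1] by eventually_elim (use kernel_lim_le in auto)
  fix x :: real assume "x < pi / 2"
  then have "\<forall>\<^sub>F X in at_top. x < arctan X" using tendsto_arctan_at_top order_tendstoD(1) by blast
  then have "\<forall>\<^sub>F X in at_top. x < arctan X \<and> X \<ge> (0::real)" using eventually_ge_at_top[of 0] by eventually_elim auto
  then obtain X :: real where X: "x < arctan X" "X \<ge> 0" by (auto simp: eventually_at_top_linorder)
  have "((\<lambda>s. (1 + X\<^sup>2) powr (1 - s) * arctan X) \<longlongrightarrow> (1 + X\<^sup>2) powr (1 - 1) * arctan X) (at_right 1)"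
    using one_plus_square_pos[of X] by (intro tendsto_intros) auto
  then have "((\<lambda>s. (1 + X\<^sup>2) powr (1 - s) * arctan X) \<longlongrightarrow> arctan X) (at_right 1)"
    using one_plus_square_pos[of X] by simp
  then have "\<forall>\<^sub>F s in at_right 1. x < (1 + X\<^sup>2) powr (1 - s) * arctan X"
    using X(1) order_tendstoD(1) by blast
  then show "\<forall>\<^sub>F s in at_right 1. x < kernel_lim s"
    using eventually_at_right_less[of 1]
  proof eventually_elim
    case (elim s)
    then show ?case using kernel_int_ge[of s X] kernel_int_le_lim[of s X] X by auto
  qed
qed

lemma kernel_lim_1: "kernel_lim 1 = pi / 2"
proof (rule tendsto_unique[OF _ kernel_int_tendsto])
  have eq: "kernel_int 1 X = arctan X" if "X \<ge> 0" for X
    using kernel_int_ge[of 1 X] kernel_int_le_arctan[of 1 X] one_plus_square_pos[of X] that by simp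
  have "\<forall>\<^sub>F X in at_top. arctan X = kernel_int 1 X"
    using eventually_ge_at_top[of "0::real"] by eventually_elim (simp add: eq)
  with tendsto_arctan_at_top show "(kernel_int 1 \<longlongrightarrow> pi / 2) at_top"
    by (rule Lim_transform_eventually)
qed auto

text \<open>The sum of \<open>(a x\<^sup>2 + e) powr - s\<close> over all integers \<open>x\<close>; for \<open>e = 0\<close> the term \<open>x = 0\<close> is \<open>0 powr - s = 0\<close>.\<close>

definition row_sum :: "real \<Rightarrow> real \<Rightarrow> real \<Rightarrow> real" where
  "row_sum a e s = e powr - s + 2 * (\<Sum>k. (a * (real (Suc k))\<^sup>2 + e) powr - s)"

text \<open>Comparison of a row with its integral: the summand decreases in |x|, so the error is at
  most the central term.\<close>

lemma row_bound:
  assumes a: "a > 0" and e: "e > 0" and s: "s \<ge> 1"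
  shows "summable (\<lambda>k. (a * (real (Suc k))\<^sup>2 + e) powr - s)"
    and "\<bar>row_sum a e s - 2 * kernel_lim s * e powr (1/2 - s) / sqrt a\<bar> \<le> e powr - s"
proof -
  \<comment> \<open>The substitution x = l u turns a x^2 + e into e (1 + u^2).\<close>
  define l where "l = sqrt (e / a)"
  have l: "l > 0" using a e by (simp add: l_def)
  have l2: "l\<^sup>2 = e / a" using a e by (simp add: l_def)
  define f where "f x = (a * x\<^sup>2 + e) powr - s" for x
  define F where "F x = e powr - s * l * kernel_int s (x / l)" for x
  define L where "L = e powr - s * l * kernel_lim s"
  have der: "(F has_real_derivative f x) (at x)" if "x \<ge> 0" for x
  proof -
    have "((\<lambda>x. kernel_int s (x / l)) has_real_derivative (1 + (x / l)\<^sup>2) powr - s * (1 / l)) (at x)"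
      using that l by (intro DERIV_chain'[OF _ kernel_int_deriv]) (auto intro!: derivative_eq_intros)
    from DERIV_cmult[OF this, of "e powr - s * l"]
    have "(F has_real_derivative e powr - s * (1 + (x / l)\<^sup>2) powr - s) (at x)"
      using l by (simp add: F_def[abs_def] mult_ac)
    moreover have "e powr - s * (1 + (x / l)\<^sup>2) powr - s = (e * (1 + (x / l)\<^sup>2)) powr - s"
      using e by (simp add: powr_mult)
    moreover have "e * (1 + (x / l)\<^sup>2) = a * x\<^sup>2 + e"
      using a e by (simp add: power_divide l2 field_simps)
    ultimately show ?thesis by (simp add: f_def)
  qed
  have lim: "(\<lambda>n. F (real n)) \<longlonglongrightarrow> L"
  proof -
    have "filterlim (\<lambda>n. real n / l) at_top at_top"
      using filterlim_tendsto_pos_mult_at_top[OF tendsto_const, of "1 / l" real sequentially] l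
      by (simp add: filterlim_real_sequentially)
    from filterlim_compose[OF kernel_int_tendsto[OF s] this] show ?thesis
      unfolding F_def L_def by (intro tendsto_intros)
  qed
  have pos: "0 < a * x\<^sup>2 + e" for x using a e by (simp add: add_nonneg_pos)
  have dec: "f y \<le> f x" if "0 \<le> x" "x \<le> y" for x y
    unfolding f_def using that a pos[of x] s by (intro powr_mono2') (auto intro!: mult_left_mono power_mono)
  note c = integral_comparison[of F f L, OF der _ dec _ lim]
  have nn: "0 \<le> f x" for x by (simp add: f_def)
  show "summable (\<lambda>k. (a * (real (Suc k))\<^sup>2 + e) powr - s)"
    using c(1) nn unfolding f_def by (simp add: F_def)
  have "L \<le> f 0 + (\<Sum>k. f (real (Suc k)))" "(\<Sum>k. f (real (Suc k))) \<le> L"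
    using c(2,3) nn by (simp_all add: F_def)
  moreover have "f 0 = e powr - s" by (simp add: f_def)
  moreover have "row_sum a e s = f 0 + 2 * (\<Sum>k. f (real (Suc k)))" by (simp add: row_sum_def f_def)
  moreover have "2 * kernel_lim s * e powr (1/2 - s) / sqrt a = 2 * L"
  proof -
    have "e powr (1/2 - s) = e powr - s * sqrt e"
      using e by (simp add: powr_half_sqrt[symmetric] powr_add[symmetric])
    then show ?thesis by (simp add: L_def l_def real_sqrt_divide)
  qed
  ultimately show "\<bar>row_sum a e s - 2 * kernel_lim s * e powr (1/2 - s) / sqrt a\<bar> \<le> e powr - s"
    by linarith
qed

text \<open>The logarithmic derivative of the reflection formula gives pi cot(pi z) = Digamma(1 - z)
  - Digamma(z); the series of Digamma then yields partial fractions.\<close>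

lemma pi_cot_sum:
  fixes z :: complex
  assumes z: "z \<notin> \<int>"
  shows "(\<lambda>k. - 2 * z / (of_nat (Suc k) ^ 2 - z\<^sup>2)) sums (of_real pi * cot (of_real pi * z) - 1 / z)"
proof -
  have nz: "z \<noteq> 0" using z by auto
  have n1: "1 - z \<notin> \<int>" "1 + z \<notin> \<int>" using z by (metis Ints_1 Ints_diff diff_diff_eq2 add_diff_cancel_left', metis Ints_1 Ints_diff add_diff_cancel_left')
  then have n2: "1 - z \<notin> \<int>\<^sub>\<le>\<^sub>0" "1 + z \<notin> \<int>\<^sub>\<le>\<^sub>0" "z \<notin> \<int>\<^sub>\<le>\<^sub>0" using n1 z nonpos_Ints_subset_Ints by blast+
  have refl: "rGamma w * rGamma (1 - w) = sin (of_real pi * w) / of_real pi" for w :: complex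
    by (rule rGamma_reflection_complex)
  have d1: "((\<lambda>w. rGamma w * rGamma (1 - w)) has_field_derivative
     (- rGamma z * Digamma z) * rGamma (1 - z) + (- (- rGamma (1 - z) * Digamma (1 - z))) * rGamma z) (at z)"
    using n2 by (auto intro!: derivative_eq_intros)
  have d2: "((\<lambda>w. sin (of_real pi * w) / of_real pi) has_field_derivative cos (of_real pi * z)) (at z)"
    by (auto intro!: derivative_eq_intros)
  have "(- rGamma z * Digamma z) * rGamma (1 - z) + (- (- rGamma (1 - z) * Digamma (1 - z))) * rGamma z = cos (of_real pi * z)"
    using DERIV_unique[OF d1] d2 unfolding refl by blast
  then have "(Digamma (1 - z) - Digamma z) * (rGamma z * rGamma (1 - z)) = cos (of_real pi * z)"
    by (simp add: algebra_simps)
  then have e: "(Digamma (1 - z) - Digamma z) * sin (of_real pi * z) = of_real pi * cos (of_real pi * z)"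
    unfolding refl by (simp add: divide_eq_eq mult.commute)
  have "rGamma z * rGamma (1 - z) \<noteq> 0" using n2 by (simp add: rGamma_eq_zero_iff)
  then have s0: "sin (of_real pi * z) \<noteq> 0" unfolding refl by simp
  have D: "Digamma (1 - z) - Digamma z = of_real pi * cot (of_real pi * z)"
    using e s0 by (simp add: cot_def field_simps)
  \<comment> \<open>Replacing z by 1 + z pairs the denominators k + z and k - z with the same k >=
    1, at the cost of the term 1 / z.\<close>
  have D1: "Digamma (z + 1) = Digamma z + 1 / z" using nz by (rule Digamma_plus1)
  have Dig: "(\<lambda>k. inverse (of_nat (Suc k)) - inverse (w + of_nat k)) sums (Digamma w + euler_mascheroni)"
    if "w \<noteq> 0" for w :: complex
    using summable_sums[OF summable_Digamma[OF that]] by (simp add: Digamma_def)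
  have "1 - z \<noteq> 0" "1 + z \<noteq> 0" using n1 Ints_0 by metis+
  from sums_diff[OF Dig[OF this(1)] Dig[OF this(2)]]
  have "(\<lambda>k. inverse ((1 + z) + of_nat k) - inverse ((1 - z) + of_nat k)) sums (Digamma (1 - z) - Digamma (1 + z))"
    by simp
  also have "(\<lambda>k. inverse ((1 + z) + of_nat k) - inverse ((1 - z) + of_nat k)) = (\<lambda>k. - 2 * z / (of_nat (Suc k) ^ 2 - z\<^sup>2))"
  proof
    fix k :: nat
    have "of_nat (Suc k) + z \<noteq> 0" "of_nat (Suc k) - z \<noteq> 0"
      using z by (metis Ints_minus Ints_of_nat add_eq_0_iff minus_minus, metis Ints_of_nat eq_iff_diff_eq_0)
    moreover have "of_nat (Suc k) ^ 2 - z\<^sup>2 = (of_nat (Suc k) + z) * (of_nat (Suc k) - z)"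
      by (simp add: power2_eq_square algebra_simps)
    ultimately show "inverse ((1 + z) + of_nat k) - inverse ((1 - z) + of_nat k) = - 2 * z / (of_nat (Suc k) ^ 2 - z\<^sup>2)"
      by (simp add: field_simps)
  qed
  also have "Digamma (1 - z) - Digamma (1 + z) = of_real pi * cot (of_real pi * z) - 1 / z"
    using D D1 by (simp add: add.commute algebra_simps)
  finally show ?thesis .
qed

section \<open>Dominated convergence and the zeta sums\<close>

lemma tannery:
  fixes a :: "nat \<Rightarrow> 'b \<Rightarrow> real" and b :: "nat \<Rightarrow> real"
  assumes lim: "\<And>k. (a k \<longlongrightarrow> b k) F"
    and bound: "\<forall>\<^sub>F s in F. \<forall>k. \<bar>a k s\<bar> \<le> M k"
    and M: "summable M" and F: "F \<noteq> bot"
  shows "((\<lambda>s. \<Sum>k. a k s) \<longlongrightarrow> (\<Sum>k. b k)) F" "summable b"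
proof -
  have "eventually (\<lambda>(k, s). norm (a k s) \<le> M k) (at_top \<times>\<^sub>F F)"
    unfolding eventually_prod_filter
    by (rule exI[of _ "\<lambda>_. True"], rule exI[of _ "\<lambda>s. \<forall>k. \<bar>a k s\<bar> \<le> M k"]) (use bound in auto)
  note t = tannerys_theorem[OF lim this M F]
  show "((\<lambda>s. \<Sum>k. a k s) \<longlongrightarrow> (\<Sum>k. b k)) F" using t by blast
  show "summable b" using t by (auto intro: summable_rabs_cancel)
qed

text \<open>The Riemann zeta function at real t > 1.\<close>

definition zsum :: "real \<Rightarrow> real" where "zsum t = (\<Sum>k. real (Suc k) powr - t)"

lemma zsum_bounds:
  assumes "t > 1"
  shows "summable (\<lambda>k. real (Suc k) powr - t)" "1 / (t - 1) \<le> zsum t" "zsum t \<le> 1 + 1 / (t - 1)"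
proof -
  define f where "f x = (1 + x) powr - t" for x :: real
  define F where "F x = (1 - (1 + x) powr (1 - t)) / (t - 1)" for x :: real
  have der: "(F has_real_derivative f x) (at x)" if "x \<ge> 0" for x
  proof -
    have "((\<lambda>x. (1 + x) powr (1 - t)) has_real_derivative (1 - t) * (1 + x) powr (1 - t - 1)) (at x)"
      using that by (auto intro!: derivative_eq_intros)
    from DERIV_cdivide[OF DERIV_diff[OF DERIV_const this], of 1 "t - 1"]
    have "(F has_real_derivative (0 - (1 - t) * (1 + x) powr (1 - t - 1)) / (t - 1)) (at x)"
      by (simp add: F_def[abs_def])
    moreover have "(0 - (1 - t) * p) / (t - 1) = p" for p using assms by (simp add: divide_eq_eq algebra_simps)
    ultimately show ?thesis by (simp add: f_def)
  qed
  have F0: "F 0 = 0" by (simp add: F_def)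
  have dec: "f y \<le> f x" if "0 \<le> x" "x \<le> y" for x y
    unfolding f_def using that assms by (intro powr_mono2') auto
  have lim: "(\<lambda>n. F (real n)) \<longlonglongrightarrow> (1 - 0) / (t - 1)"
    unfolding F_def
  proof (intro tendsto_intros)
    have "filterlim (\<lambda>n. 1 + real n) at_top sequentially"
      by (intro filterlim_tendsto_add_at_top[OF tendsto_const] filterlim_real_sequentially)
    then show "(\<lambda>n. (1 + real n) powr (1 - t)) \<longlonglongrightarrow> 0"
      using assms by (intro tendsto_neg_powr) auto
  qed (use assms in auto)
  have nn: "0 \<le> f x" for x by (simp add: f_def)
  note c = integral_comparison[of F f, OF der F0 dec nn lim]
  have f: "f (real (Suc k)) = real (Suc (Suc k)) powr - t" for k by (simp add: f_def add.commute)
  have "summable (\<lambda>k. real (Suc (Suc k)) powr - t)" using c(1) unfolding f by simp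
  then show sm: "summable (\<lambda>k. real (Suc k) powr - t)" by (subst (asm) summable_Suc_iff)
  have "zsum t = (\<Sum>k. real (Suc (Suc k)) powr - t) + 1"
    unfolding zsum_def using suminf_split_head[OF sm] by simp
  then show "1 / (t - 1) \<le> zsum t" "zsum t \<le> 1 + 1 / (t - 1)"
    using c(2,3) unfolding f by (simp_all add: f_def)
qed

text \<open>The pole of zeta at 1 has residue 1; the half comes from the argument 2 s - 1.\<close>

lemma zsum_pole: "((\<lambda>s. (s - 1) * zsum (2 * s - 1)) \<longlongrightarrow> 1 / 2) (at_right 1)"
proof (rule tendsto_sandwich)
  show "\<forall>\<^sub>F s in at_right 1. 1 / 2 \<le> (s - 1) * zsum (2 * s - 1)"
    using eventually_at_right_less[of 1]
  proof eventually_elim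
    case (elim s)
    then have "(s - 1) * (1 / (2 * s - 1 - 1)) \<le> (s - 1) * zsum (2 * s - 1)"
      using zsum_bounds(2)[of "2 * s - 1"] by (intro mult_left_mono) auto
    moreover have "(s - 1) * (1 / (2 * s - 1 - 1)) = 1 / 2" using elim by (simp add: field_simps)
    ultimately show ?case by linarith
  qed
  show "\<forall>\<^sub>F s in at_right 1. (s - 1) * zsum (2 * s - 1) \<le> (s - 1) + 1 / 2"
    using eventually_at_right_less[of 1]
  proof eventually_elim
    case (elim s)
    then have "(s - 1) * zsum (2 * s - 1) \<le> (s - 1) * (1 + 1 / (2 * s - 1 - 1))"
      using zsum_bounds(3)[of "2 * s - 1"] by (intro mult_left_mono) auto
    moreover have "(s - 1) * (1 + 1 / (2 * s - 1 - 1)) = (s - 1) + 1 / 2" using elim by (simp add: field_simps)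
    ultimately show ?case by linarith
  qed
  have "((\<lambda>s::real. (s - 1) + 1 / 2) \<longlongrightarrow> (1 - 1) + 1 / 2) (at_right 1)" by (intro tendsto_intros)
  then show "((\<lambda>s::real. (s - 1) + 1 / 2) \<longlongrightarrow> 1 / 2) (at_right 1)" by simp
qed auto

lemma summable_inverse_square: "summable (\<lambda>k. real (Suc k) powr - 2)"
  using zsum_bounds(1)[of 2] by simp

lemma zsum_tendsto: "((\<lambda>s. zsum (2 * s)) \<longlongrightarrow> pi\<^sup>2 / 6) (at_right 1)"
proof -
  have "((\<lambda>s. \<Sum>k. real (Suc k) powr - (2 * s)) \<longlongrightarrow> (\<Sum>k. real (Suc k) powr - (2 * 1))) (at_right 1)"
  proof (rule tannery(1)[OF _ _ summable_inverse_square])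
    show "((\<lambda>s. real (Suc k) powr - (2 * s)) \<longlongrightarrow> real (Suc k) powr - (2 * 1)) (at_right 1)" for k
      by (intro tendsto_intros) auto
    show "\<forall>\<^sub>F s in at_right 1. \<forall>k. \<bar>real (Suc k) powr - (2 * s)\<bar> \<le> real (Suc k) powr - 2"
      using eventually_at_right_less[of 1] by eventually_elim (auto intro!: powr_mono)
  qed auto
  moreover have "(\<Sum>k. real (Suc k) powr - (2 * 1)) = pi\<^sup>2 / 6"
  proof -
    have "real (Suc k) powr - (2 * 1) = 1 / real ((k + 1)\<^sup>2)" for k
    proof -
      have "real (Suc k) powr - (2 * 1) = 1 / real (Suc k) powr 2" by (simp add: powr_minus_divide)
      also have "real (Suc k) powr 2 = (real (Suc k))\<^sup>2" by (rule powr_numeral) simp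
      finally show ?thesis by simp
    qed
    then show ?thesis using sums_unique[OF inverse_squares_sums] by (simp only:)
  qed
  ultimately show ?thesis by (simp only: zsum_def)
qed

text \<open>Tonelli's theorem: nonnegativity turns iterated sums into an unordered double
  sum.\<close>

lemma nonneg_has_sum_SigmaI:
  fixes f :: "'a \<times> 'b \<Rightarrow> real"
  assumes nn: "\<And>x y. x \<in> A \<Longrightarrow> y \<in> B x \<Longrightarrow> 0 \<le> f (x, y)"
    and f: "\<And>x. x \<in> A \<Longrightarrow> ((\<lambda>y. f (x, y)) has_sum g x) (B x)"
    and g: "(g has_sum S) A"
  shows "(f has_sum S) (Sigma A B)"
proof (rule has_sum_SigmaI[OF f g])
  have n: "norm (f (x, y)) = f (x, y)" if "x \<in> A" "y \<in> B x" for x y using nn that by simp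
  have s: "((\<lambda>y. norm (f (x, y))) has_sum g x) (B x)" if "x \<in> A" for x
    using f[OF that] by (subst has_sum_cong[OF n[OF that]]) auto
  have g0: "norm (\<Sum>\<^sub>\<infinity>y\<in>B x. norm (f (x, y))) = g x" if "x \<in> A" for x
  proof -
    have "(\<Sum>\<^sub>\<infinity>y\<in>B x. norm (f (x, y))) = g x" using s[OF that] by (rule infsumI)
    moreover have "0 \<le> g x" using f[OF that] nn that by (metis has_sum_nonneg)
    ultimately show ?thesis by simp
  qed
  have "(\<lambda>p. norm (f p)) summable_on Sigma A B"
    unfolding Infinite_Sum.abs_summable_on_Sigma_iff
  proof (intro conjI ballI)
    show "(\<lambda>y. norm (f (x, y))) summable_on B x" if "x \<in> A" for x
      using s[OF that] by (rule has_sum_imp_summable)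
    show "(\<lambda>x. norm (\<Sum>\<^sub>\<infinity>y\<in>B x. norm (f (x, y)))) summable_on A"
      using g by (subst summable_on_cong[OF g0]) (auto intro: has_sum_imp_summable)
  qed
  then show "f summable_on Sigma A B" by (rule abs_summable_summable)
qed auto

text \<open>The row y = m + 1 minus its integral. These remainders stay summable at s = 1, while the
  integrals carry the pole.\<close>

definition row_rem :: "real \<Rightarrow> real \<Rightarrow> real \<Rightarrow> nat \<Rightarrow> real" where
  "row_rem a c s m = row_sum a (c * (real (Suc m))\<^sup>2) s
     - 2 * kernel_lim s * (c * (real (Suc m))\<^sup>2) powr (1/2 - s) / sqrt a"

text \<open>The Epstein zeta function of a x^2 + c y^2, arranged as the row y = 0, the integrals of
  the other rows, and their remainders. Rows y and -y coincide, hence the factors 2;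
  \<open>epstein_has_sum\<close> identifies it with the lattice sum.\<close>

definition epstein :: "real \<Rightarrow> real \<Rightarrow> real \<Rightarrow> real" where
  "epstein a c s = 2 * a powr - s * zsum (2 * s)
     + 4 * kernel_lim s * c powr (1/2 - s) / sqrt a * zsum (2 * s - 1) + 2 * (\<Sum>m. row_rem a c s m)"

lemma powr_mult_square: "0 < c \<Longrightarrow> (c * (real (Suc m))\<^sup>2) powr t = c powr t * real (Suc m) powr (2 * t)"
  by (simp add: powr_mult powr_powr[symmetric])

text \<open>The bound is uniform in s >= 1, so the limit s -> 1 can be taken term by term.\<close>

lemma row_rem_bound:
  assumes "a > 0" "c \<ge> 1" "s \<ge> 1"
  shows "\<bar>row_rem a c s m\<bar> \<le> real (Suc m) powr - 2"
proof -
  have "\<bar>row_rem a c s m\<bar> \<le> (c * (real (Suc m))\<^sup>2) powr - s"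
    unfolding row_rem_def using assms by (intro row_bound(2)) auto
  also have "\<dots> = c powr - s * real (Suc m) powr (- (2 * s))"
    using powr_mult_square[of c m "- s"] assms by simp
  also have "\<dots> \<le> 1 * real (Suc m) powr - 2"
    using assms powr_mono2'[of "- s" 1 c] by (intro mult_mono powr_mono) auto
  finally show ?thesis by simp
qed

lemma summable_row_rem: "a > 0 \<Longrightarrow> c \<ge> 1 \<Longrightarrow> s \<ge> 1 \<Longrightarrow> summable (row_rem a c s)"
  using row_rem_bound by (intro summable_comparison_test'[OF summable_inverse_square]) auto

lemma epstein_has_sum:
  assumes a: "a \<ge> 1" and c: "c \<ge> 1" and s: "s > 1"
  shows "((\<lambda>(y::int, x::int). (a * (real_of_int x)\<^sup>2 + c * (real_of_int y)\<^sup>2) powr - s) has_sum epstein a c s) UNIV"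
proof -
  define g where "g y = row_sum a (c * (real_of_int y)\<^sup>2) s" for y :: int
  have row0: "summable (\<lambda>k. (a * (real (Suc k))\<^sup>2) powr - s)" "row_sum a 0 s = 2 * a powr - s * zsum (2 * s)"
  proof -
    have e: "(a * (real (Suc k))\<^sup>2) powr - s = a powr - s * real (Suc k) powr - (2 * s)" for k
      using powr_mult_square[of a k "- s"] a by simp
    have sm: "summable (\<lambda>k. real (Suc k) powr - (2 * s))" using zsum_bounds(1)[of "2 * s"] s by simp
    show "summable (\<lambda>k. (a * (real (Suc k))\<^sup>2) powr - s)" unfolding e by (rule summable_mult[OF sm])
    show "row_sum a 0 s = 2 * a powr - s * zsum (2 * s)"
      unfolding row_sum_def add_0_right e zsum_def suminf_mult[OF sm] by simp
  qed
  have rows: "((\<lambda>x::int. (a * (real_of_int x)\<^sup>2 + c * (real_of_int y)\<^sup>2) powr - s) has_sum g y) UNIV" for y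
  proof -
    let ?f = "\<lambda>x::int. (a * (real_of_int x)\<^sup>2 + c * (real_of_int y)\<^sup>2) powr - s"
    have "summable (\<lambda>k. (a * (real (Suc k))\<^sup>2 + c * (real_of_int y)\<^sup>2) powr - s)"
    proof (cases "y = 0")
      case True
      then show ?thesis using row0(1) by simp
    next
      case False
      then show ?thesis using a c s by (intro row_bound(1)) auto
    qed
    then have "(?f has_sum ?f 0 + 2 * (\<Sum>n. ?f (int (Suc n)))) UNIV"
      by (intro has_sum_int_even) (simp_all del: of_nat_Suc)
    then show ?thesis by (simp add: g_def row_sum_def del: of_nat_Suc)
  qed
  define D where "D = 2 * kernel_lim s * c powr (1/2 - s) / sqrt a"
  have grem: "g (int (Suc m)) = D * real (Suc m) powr - (2 * s - 1) + row_rem a c s m" for m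
    unfolding g_def row_rem_def of_int_of_nat_eq using powr_mult_square[of c m "1/2 - s"] c
    by (simp add: D_def algebra_simps del: of_nat_Suc)
  have sz: "summable (\<lambda>m. real (Suc m) powr - (2 * s - 1))" using zsum_bounds(1)[of "2 * s - 1"] s by simp
  have sr: "summable (row_rem a c s)" using a c s by (intro summable_row_rem) auto
  have sg: "(\<lambda>m. g (int (Suc m))) sums (D * zsum (2 * s - 1) + (\<Sum>m. row_rem a c s m))"
    unfolding grem zsum_def by (intro sums_add sums_mult summable_sums sz sr)
  have gnn: "0 \<le> g y" for y using rows by (rule has_sum_nonneg) auto
  have "(g has_sum g 0 + 2 * (\<Sum>n. g (int (Suc n)))) UNIV"
    by (rule has_sum_int_even) (use sg gnn in \<open>auto simp: g_def[of "- _"] g_def[symmetric] sums_iff\<close>)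
  moreover have "g 0 + 2 * (\<Sum>n. g (int (Suc n))) = epstein a c s"
    unfolding sums_unique[OF sg, symmetric] using row0(2) by (simp add: g_def[of 0] epstein_def D_def algebra_simps)
  ultimately have "(g has_sum epstein a c s) UNIV" by simp
  then have "((\<lambda>(y::int, x::int). (a * (real_of_int x)\<^sup>2 + c * (real_of_int y)\<^sup>2) powr - s) has_sum epstein a c s) (UNIV \<times> UNIV)"
    by (intro nonneg_has_sum_SigmaI[where g = g]) (use rows in auto)
  then show ?thesis by simp
qed

lemma row_rem_suminf_tendsto:
  assumes a: "a \<ge> 1" and c: "c \<ge> 1"
  shows "((\<lambda>s. \<Sum>m. row_rem a c s m) \<longlongrightarrow> (\<Sum>m. row_rem a c 1 m)) (at_right 1)"
proof (rule tannery(1)[OF _ _ summable_inverse_square])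
  show "\<forall>\<^sub>F s in at_right 1. \<forall>k. \<bar>row_rem a c s k\<bar> \<le> real (Suc k) powr - 2"
    using eventually_at_right_less[of 1]
  proof eventually_elim
    case (elim s)
    show ?case using a c elim by (intro allI row_rem_bound) auto
  qed
  fix m
  define e where "e = c * (real (Suc m))\<^sup>2"
  have "1 * 1 \<le> e" unfolding e_def using c by (intro mult_mono) auto
  then have e: "e \<ge> 1" by simp
  have "((\<lambda>s. row_sum a e s) \<longlongrightarrow> row_sum a e 1) (at_right 1)"
    unfolding row_sum_def
  proof (intro tendsto_add tendsto_mult tendsto_const tannery(1)[OF _ _ summable_inverse_square])
    show "((\<lambda>s. e powr - s) \<longlongrightarrow> e powr - 1) (at_right 1)"
      using e by (intro tendsto_intros) auto
    have pos: "1 \<le> a * (real (Suc k))\<^sup>2 + e" "(real (Suc k))\<^sup>2 \<le> a * (real (Suc k))\<^sup>2 + e" for k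
    proof -
      have "1 * (real (Suc k))\<^sup>2 \<le> a * (real (Suc k))\<^sup>2" by (intro mult_right_mono a) simp
      moreover have "0 \<le> (real (Suc k))\<^sup>2" by simp
      ultimately show "1 \<le> a * (real (Suc k))\<^sup>2 + e" "(real (Suc k))\<^sup>2 \<le> a * (real (Suc k))\<^sup>2 + e"
        using e by linarith+
    qed
    show "((\<lambda>s. (a * (real (Suc k))\<^sup>2 + e) powr - s) \<longlongrightarrow> (a * (real (Suc k))\<^sup>2 + e) powr - 1) (at_right 1)" for k
      using pos(1)[of k] by (intro tendsto_intros) auto
    show "\<forall>\<^sub>F s in at_right 1. \<forall>k. \<bar>(a * (real (Suc k))\<^sup>2 + e) powr - s\<bar> \<le> real (Suc k) powr - 2"
      using eventually_at_right_less[of 1]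
    proof eventually_elim
      case (elim s)
      have "(a * (real (Suc k))\<^sup>2 + e) powr - s \<le> real (Suc k) powr - 2" for k
      proof -
        have "(a * (real (Suc k))\<^sup>2 + e) powr - s \<le> (a * (real (Suc k))\<^sup>2 + e) powr - 1"
          using pos(1)[of k] elim by (intro powr_mono) auto
        also have "\<dots> \<le> ((real (Suc k))\<^sup>2) powr - 1"
          using pos(2)[of k] by (intro powr_mono2') auto
        also have "\<dots> = real (Suc k) powr - 2"
          using powr_mult_square[of 1 k "-1"] by simp
        finally show ?thesis .
      qed
      then show ?case by simp
    qed
  qed auto
  then show "((\<lambda>s. row_rem a c s m) \<longlongrightarrow> row_rem a c 1 m) (at_right 1)"
    unfolding row_rem_def e_def[symmetric] kernel_lim_1 using e a kernel_lim_tendsto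
    by (intro tendsto_intros) auto
qed auto

text \<open>The cotangent series at z = i t; the bracket is coth(pi t) = 1 + 2 / (exp(2 pi t) -
  1).\<close>

lemma coth_sum:
  fixes t :: real
  assumes t: "t > 0"
  shows "(\<lambda>k. 1 / ((real (Suc k))\<^sup>2 + t\<^sup>2)) sums (pi / (2 * t) * (1 + 2 / (exp (2 * pi * t) - 1)) - 1 / (2 * t\<^sup>2))"
proof -
  define z where "z = \<i> * of_real t"
  have z: "z \<notin> \<int>" using t by (auto simp: z_def complex_eq_iff elim!: Ints_cases)
  define E where "E = exp (pi * t)"
  have E: "E > 1" using t by (simp add: E_def)
  have e1: "exp (\<i> * (of_real pi * z)) = of_real (1 / E)"
  proof -
    have "\<i> * (of_real pi * z) = of_real (- (pi * t))" by (simp add: z_def algebra_simps)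
    then show ?thesis unfolding E_def by (simp only: exp_of_real exp_minus inverse_eq_divide)
  qed
  have e2: "exp (- (\<i> * (of_real pi * z))) = of_real E"
    unfolding exp_minus e1 using E by (simp add: inverse_eq_divide)
  have cotz: "cot (of_real pi * z) = - \<i> * of_real ((E\<^sup>2 + 1) / (E\<^sup>2 - 1))"
  proof -
    have c: "cos (of_real pi * z) = of_real ((1 / E + E) / 2)"
      unfolding cos_exp_eq e1 e2 by simp
    have s: "sin (of_real pi * z) = \<i> * of_real ((E - 1 / E) / 2)"
      unfolding sin_exp_eq e1 e2 by (simp add: field_simps)
    have "1 / E + E = (E\<^sup>2 + 1) / E" "E - 1 / E = (E\<^sup>2 - 1) / E"
      using E by (simp_all add: field_simps power2_eq_square)
    then have "(1 / E + E) / 2 / ((E - 1 / E) / 2) = (E\<^sup>2 + 1) / (E\<^sup>2 - 1)"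
      using E by simp
    then show ?thesis unfolding cot_def c s
      by (metis (no_types, lifting) of_real_divide divide_divide_eq_left mult.commute inverse_i inverse_eq_divide times_divide_eq_right mult_1_right times_divide_eq_left)
  qed
  have iz: "1 / z = - \<i> * of_real (1 / t)" using t by (simp add: z_def field_simps)
  have c: "of_real pi * cot (of_real pi * z) - 1 / z = - \<i> * of_real (pi * ((E\<^sup>2 + 1) / (E\<^sup>2 - 1)) - 1 / t)"
    unfolding cotz iz by (simp add: algebra_simps)
  have "(\<lambda>k. (\<i> / of_real (2 * t)) * (- 2 * z / (of_nat (Suc k) ^ 2 - z\<^sup>2)))
      sums ((\<i> / of_real (2 * t)) * (of_real pi * cot (of_real pi * z) - 1 / z))"
    by (intro sums_mult pi_cot_sum z)
  also have "(\<lambda>k. (\<i> / of_real (2 * t)) * (- 2 * z / (of_nat (Suc k) ^ 2 - z\<^sup>2)))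
      = (\<lambda>k. of_real (1 / ((real (Suc k))\<^sup>2 + t\<^sup>2)))"
    using t by (auto simp: z_def power_mult_distrib)
  also have "(\<i> / of_real (2 * t)) * (of_real pi * cot (of_real pi * z) - 1 / z)
     = of_real ((pi * ((E\<^sup>2 + 1) / (E\<^sup>2 - 1)) - 1 / t) / (2 * t))"
  proof -
    have "(\<i> / of_real (2 * t)) * (- \<i> * of_real w) = of_real (w / (2 * t))" for w by simp
    then show ?thesis unfolding c .
  qed
  finally have "(\<lambda>k. 1 / ((real (Suc k))\<^sup>2 + t\<^sup>2)) sums ((pi * ((E\<^sup>2 + 1) / (E\<^sup>2 - 1)) - 1 / t) / (2 * t))"
    by (simp only: sums_of_real_iff)
  also have "(pi * ((E\<^sup>2 + 1) / (E\<^sup>2 - 1)) - 1 / t) / (2 * t)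
     = pi / (2 * t) * (1 + 2 / (exp (2 * pi * t) - 1)) - 1 / (2 * t\<^sup>2)"
  proof -
    have E2: "exp (2 * pi * t) = E\<^sup>2" by (simp add: E_def exp_double[symmetric] mult.assoc)
    have "E\<^sup>2 > 1" using E by simp
    then have "(E\<^sup>2 + 1) / (E\<^sup>2 - 1) = 1 + 2 / (E\<^sup>2 - 1)" by (simp add: field_simps)
    then show ?thesis unfolding E2 using t by (simp add: field_simps power2_eq_square)
  qed
  finally show ?thesis .
qed

text \<open>At s = 1 the integral is exactly the summand 1 of the coth, and the -1 / (2 t^2) cancels
  the central term x = 0. Only the exponentially small part survives.\<close>

lemma row_rem_1:
  assumes a: "a > 0" and c: "c > 0"
  shows "row_rem a c 1 m = 2 * pi / sqrt (a * c) * (1 / (real (Suc m) * (exp (2 * pi * (sqrt (c / a) * real (Suc m))) - 1)))"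
proof -
  define e where "e = c * (real (Suc m))\<^sup>2"
  define t where "t = sqrt (c / a) * real (Suc m)"
  have e: "e > 0" using c by (simp add: e_def)
  have t: "t > 0" using a c by (simp add: t_def)
  have t2: "e = a * t\<^sup>2" using a c by (simp add: t_def e_def power_mult_distrib)
  define X where "X = 2 / (exp (2 * pi * t) - 1)"
  define S where "S = pi / (2 * t) * (1 + X) - 1 / (2 * t\<^sup>2)"
  have "(\<lambda>k. (1 / a) * (1 / ((real (Suc k))\<^sup>2 + t\<^sup>2))) sums ((1 / a) * S)"
    unfolding S_def X_def by (intro sums_mult coth_sum t)
  moreover have "(1 / a) * (1 / ((real (Suc k))\<^sup>2 + t\<^sup>2)) = (a * (real (Suc k))\<^sup>2 + e) powr - 1" for k
  proof -
    have "0 < a * (real (Suc k))\<^sup>2 + e" using a e by (simp add: add_nonneg_pos)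
    then have A: "(a * (real (Suc k))\<^sup>2 + e) powr - 1 = 1 / (a * (real (Suc k))\<^sup>2 + e)" by (simp add: powr_minus_divide)
    have B: "a * (real (Suc k))\<^sup>2 + e = a * ((real (Suc k))\<^sup>2 + t\<^sup>2)" by (simp add: t2 algebra_simps)
    show ?thesis unfolding A unfolding B by simp
  qed
  ultimately have "(\<Sum>k. (a * (real (Suc k))\<^sup>2 + e) powr - 1) = (1 / a) * S"
    by (simp add: sums_iff del: of_nat_Suc)
  then have "row_sum a e 1 = 1 / e + 2 * ((1 / a) * S)"
    using e by (simp add: row_sum_def powr_minus_divide)
  also have "\<dots> = pi / (a * t) * (1 + X)"
    unfolding S_def t2 using a t by (simp add: field_simps power2_eq_square)
  finally have r: "row_sum a e 1 = pi / (a * t) * (1 + X)" .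
  have "e powr (1 / 2 - 1) / sqrt a = 1 / (a * t)"
  proof -
    have "e powr (1 / 2 - 1) = 1 / sqrt e" using e by (simp add: powr_minus_divide powr_half_sqrt)
    moreover have "sqrt e = sqrt a * t" unfolding t2 using a t by (simp add: real_sqrt_mult)
    ultimately show ?thesis using a by (simp add: mult.assoc[symmetric])
  qed
  then have "row_rem a c 1 m = pi / (a * t) * (1 + X) - 2 * (pi / 2) * (1 / (a * t))"
    unfolding row_rem_def e_def[symmetric] r kernel_lim_1 by (metis times_divide_eq_right)
  also have "\<dots> = pi / (a * t) * X" by (simp add: distrib_left)
  also have "a * t = sqrt (a * c) * real (Suc m)"
  proof -
    have "a * sqrt (c / a) = sqrt (a * c)"
    proof -
      have "a * sqrt (c / a) = sqrt a * (sqrt a * sqrt (c / a))" using a by (simp add: mult.assoc[symmetric])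
      also have "sqrt a * sqrt (c / a) = sqrt c" using a by (simp add: real_sqrt_mult[symmetric])
      finally show ?thesis by (simp add: real_sqrt_mult)
    qed
    then show ?thesis by (simp only: t_def mult.assoc[symmetric])
  qed
  finally show ?thesis by (simp add: X_def t_def mult_ac del: of_nat_Suc)
qed

section \<open>Lambert series and the logarithm of the Euler product\<close>

lemma ln_one_minus_sums:
  fixes x :: real
  assumes "0 \<le> x" "x < 1"
  shows "(\<lambda>m. x ^ Suc m / real (Suc m)) sums (- ln (1 - x))"
proof -
  have "(\<lambda>n. - ((- (- x)) ^ n) / of_nat n) sums ln (1 + (- x))" using assms by (intro ln_series') auto
  then have "(\<lambda>n. x ^ n / of_nat n) sums (- ln (1 - x))" using sums_minus by fastforce
  then show ?thesis by (subst sums_Suc_iff) simp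
qed

text \<open>Expand each -ln(1 - q^n) as a power series and sum over n first, which is a geometric
  series. All terms are nonnegative, so the order may be exchanged.\<close>

lemma lambert_ln_euler:
  fixes q :: real
  assumes q: "0 < q" "q < 1"
  shows "(\<lambda>m. q ^ Suc m / (1 - q ^ Suc m) / real (Suc m)) sums (- ln (euler_fn q))"
proof -
  define h where "h = (\<lambda>(n, m). q ^ (Suc n * Suc m) / real (Suc m))"
  have qn: "0 \<le> q ^ Suc n" "q ^ Suc n < 1" for n using q by (auto simp: power_less_one_iff simp del: power_Suc)
  have hnn: "0 \<le> h p" for p using q by (cases p) (simp add: h_def)
  have r1: "((\<lambda>m. h (n, m)) has_sum (- ln (1 - q ^ Suc n))) UNIV" for n
  proof (rule sums_nonneg_imp_has_sum)
    show "(\<lambda>m. h (n, m)) sums (- ln (1 - q ^ Suc n))"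
      using ln_one_minus_sums[OF qn] by (simp only: h_def case_prod_conv power_mult)
  qed (use hnn in auto)
  have "(\<lambda>n. - ln (1 - q ^ Suc n)) sums (- ln (euler_fn q))"
    unfolding euler_fn_def ln_exp using q by (intro sums_minus summable_sums summable_ln_euler) auto
  then have r2: "((\<lambda>n. - ln (1 - q ^ Suc n)) has_sum (- ln (euler_fn q))) UNIV"
  proof (rule sums_nonneg_imp_has_sum)
    show "0 \<le> - ln (1 - q ^ Suc n)" for n using qn[of n] by (simp del: power_Suc)
  qed
  have "(h has_sum (- ln (euler_fn q))) (UNIV \<times> UNIV)"
    by (rule nonneg_has_sum_SigmaI[OF _ r1 r2]) (use hnn in auto)
  then have "((\<lambda>(m, n). h (n, m)) has_sum (- ln (euler_fn q))) (UNIV \<times> UNIV)"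
    using has_sum_swap by blast
  moreover have r3: "((\<lambda>n. (\<lambda>(m, n). h (n, m)) (m, n)) has_sum (q ^ Suc m / (1 - q ^ Suc m) / real (Suc m))) UNIV" for m
  proof (rule sums_nonneg_imp_has_sum)
    have "(\<lambda>n. (q ^ Suc m) ^ n) sums (1 / (1 - q ^ Suc m))"
      using qn[of m] by (intro geometric_sums) (simp del: power_Suc)
    from sums_mult[OF this, of "q ^ Suc m / real (Suc m)"]
    have "(\<lambda>n. q ^ Suc m / real (Suc m) * (q ^ Suc m) ^ n) sums (q ^ Suc m / (1 - q ^ Suc m) / real (Suc m))"
      by (simp add: mult.commute del: power_Suc of_nat_Suc)
    moreover have "q ^ Suc m / real (Suc m) * (q ^ Suc m) ^ n = h (n, m)" for n
    proof -
      have "q ^ (Suc n * Suc m) = q ^ Suc m * (q ^ Suc m) ^ n" by (metis mult.commute power_Suc power_mult)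
      then show ?thesis by (simp only: h_def case_prod_conv times_divide_eq_left)
    qed
    ultimately show "(\<lambda>n. (\<lambda>(m, n). h (n, m)) (m, n)) sums (q ^ Suc m / (1 - q ^ Suc m) / real (Suc m))"
      by (simp only: case_prod_conv)
  qed (use hnn in auto)
  ultimately have "((\<lambda>m. q ^ Suc m / (1 - q ^ Suc m) / real (Suc m)) has_sum (- ln (euler_fn q))) UNIV"
    by (rule has_sum_SigmaD)
  then show ?thesis by (rule has_sum_imp_sums)
qed

lemma row_rem_suminf:
  assumes a: "a > 0" and c: "c > 0"
  shows "(\<Sum>m. row_rem a c 1 m) = - (2 * pi / sqrt (a * c)) * ln (euler_fn (exp (- 2 * pi * sqrt (c / a))))"
proof -
  define q where "q = exp (- 2 * pi * sqrt (c / a))"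
  have q: "0 < q" "q < 1" using a c by (simp_all add: q_def)
  have "row_rem a c 1 m = 2 * pi / sqrt (a * c) * (q ^ Suc m / (1 - q ^ Suc m) / real (Suc m))" for m
  proof -
    have "exp (2 * pi * (sqrt (c / a) * real (Suc m))) = 1 / q ^ Suc m"
      by (simp add: q_def exp_of_nat_mult[symmetric] exp_minus[symmetric] divide_inverse del: power_Suc of_nat_Suc)
    moreover have "0 < q ^ Suc m" "q ^ Suc m < 1" using q by (auto simp: power_less_one_iff simp del: power_Suc)
    moreover have "1 / (M * (1 / Q - 1)) = Q / (1 - Q) / M" if "0 < Q" "Q < 1" for M Q :: real
    proof -
      have "1 / Q - 1 = (1 - Q) / Q" using that by (simp add: field_simps)
      then show ?thesis using that by simp
    qed
    ultimately show ?thesis unfolding row_rem_1[OF a c] by (simp only:)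
  qed
  then show ?thesis
    using sums_unique[OF sums_mult[OF lambert_ln_euler[OF q], of "2 * pi / sqrt (a * c)"]]
    by (simp add: q_def del: power_Suc of_nat_Suc)
qed

text \<open>The Euler product belonging to the form a x^2 + (238 / a) y^2, for which sqrt (c / a) =
  sqrt 238 / a.\<close>

definition euler_at :: "real \<Rightarrow> real" where
  "euler_at a = euler_fn (exp (- 2 * pi * (sqrt 238 / a)))"

text \<open>The term 3 pi^2 / 7 is (pi^2 / 3) (1 + 1/2 - 1/7 - 1/14) from the rows y = 0; ln 49
  comes from the pole, the Euler products from the row remainders.\<close>

lemma genus_epstein_tendsto:
  "((\<lambda>s. epstein 1 238 s + epstein 2 119 s - epstein 7 34 s - epstein 14 17 s) \<longlongrightarrow>
    3 * pi\<^sup>2 / 7 - pi * ln 49 / sqrt 238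
    - 4 * pi / sqrt 238 * (ln (euler_at 1) + ln (euler_at 2) - ln (euler_at 7) - ln (euler_at 14))) (at_right 1)"
proof -
  \<comment> \<open>The total coefficient of the pole. All four summands equal 1 / sqrt 238 at s =
    1, so G vanishes there and the pole picks out its derivative.\<close>
  define G where "G s = 238 powr (1/2 - s) / sqrt 1 + 119 powr (1/2 - s) / sqrt 2 - 34 powr (1/2 - s) / sqrt 7 - 17 powr (1/2 - s) / sqrt 14" for s :: real
  have v: "c powr (1/2 - 1) / sqrt a = 1 / sqrt 238" if "a > 0" "c > 0" "a * c = 238" for a c :: real
  proof -
    have "c powr (1/2 - 1) = 1 / sqrt c" using that by (simp add: powr_minus_divide powr_half_sqrt)
    then show ?thesis using that by (simp add: real_sqrt_mult[symmetric] mult.commute)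
  qed
  have G1: "G 1 = 0" unfolding G_def using v[of 1 238] v[of 2 119] v[of 7 34] v[of 14 17] by simp
  have dv: "((\<lambda>s. c powr (1/2 - s) / sqrt a) has_real_derivative - ln c * (1 / sqrt 238)) (at 1)"
    if "a > 0" "c > 0" "a * c = 238" for a c :: real
  proof -
    have "((\<lambda>s. c powr (1/2 - s) / sqrt a) has_real_derivative - ln c * (c powr (1/2 - 1) / sqrt a)) (at 1)"
    proof -
      have "((\<lambda>s. c powr (1/2 - s)) has_real_derivative - ln c * c powr (1/2 - 1)) (at 1)"
        using that by (auto intro!: derivative_eq_intros)
      from DERIV_cdivide[OF this, of "sqrt a"] show ?thesis by simp
    qed
    then show ?thesis unfolding v[OF that] .
  qed
  have "(G has_real_derivative - ln 238 * (1 / sqrt 238) + - ln 119 * (1 / sqrt 238) - - ln 34 * (1 / sqrt 238) - - ln 17 * (1 / sqrt 238)) (at 1)"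
    unfolding G_def[abs_def] by (intro DERIV_add DERIV_diff dv) auto
  also have "- ln 238 * (1 / sqrt 238) + - ln 119 * (1 / sqrt 238) - - ln 34 * (1 / sqrt 238) - - ln 17 * (1 / sqrt 238)
     = - ln 49 / sqrt (238 :: real)"
  proof -
    have "ln (49 * (34 * 17)) = ln (238 * 119 :: real)" by simp
    \<comment> \<open>Differentiating brings down -ln c for each form, and 238 * 119 / (34 * 17) =
      49.\<close>
    then have "ln 49 + (ln 34 + ln 17) = ln 238 + ln (119 :: real)"
      using ln_mult[of "49::real" 578] ln_mult[of "34::real" 17] ln_mult[of "238::real" 119] by simp
    then have e: "ln 49 = ln 238 + ln 119 - ln 34 - ln (17 :: real)" by linarith
    show ?thesis unfolding e by (simp add: field_simps)
  qed
  finally have "((\<lambda>s. (G s - G 1) / (s - 1)) \<longlongrightarrow> - ln 49 / sqrt 238) (at 1)"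
    by (simp add: has_field_derivative_iff)
  then have Glim: "((\<lambda>s. G s / (s - 1)) \<longlongrightarrow> - ln 49 / sqrt 238) (at_right 1)"
    using tendsto_mono[OF at_le[of "{1<..}" UNIV 1]] by (simp add: G1)
  have pole: "((\<lambda>s. 4 * kernel_lim s * (((s - 1) * zsum (2 * s - 1)) * (G s / (s - 1)))) \<longlongrightarrow>
      4 * (pi / 2) * ((1 / 2) * (- ln 49 / sqrt 238))) (at_right 1)"
    by (intro tendsto_intros kernel_lim_tendsto zsum_pole Glim)
  have pole': "((\<lambda>s. 4 * kernel_lim s * zsum (2 * s - 1) * G s) \<longlongrightarrow> - pi * ln 49 / sqrt 238) (at_right 1)"
  proof (rule Lim_transform_eventually)
    show "((\<lambda>s. 4 * kernel_lim s * (((s - 1) * zsum (2 * s - 1)) * (G s / (s - 1)))) \<longlongrightarrow> - pi * ln 49 / sqrt 238) (at_right 1)"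
      using pole by simp
    show "\<forall>\<^sub>F s in at_right 1. 4 * kernel_lim s * (((s - 1) * zsum (2 * s - 1)) * (G s / (s - 1))) = 4 * kernel_lim s * zsum (2 * s - 1) * G s"
      using eventually_at_right_less[of 1] by eventually_elim (simp add: field_simps)
  qed
  have z: "((\<lambda>s. 2 * a powr - s * zsum (2 * s)) \<longlongrightarrow> 2 * a powr - 1 * (pi\<^sup>2 / 6)) (at_right 1)" if "a > 0" for a :: real
    using that by (intro tendsto_intros zsum_tendsto) auto
  have r: "((\<lambda>s. 2 * (\<Sum>m. row_rem a c s m)) \<longlongrightarrow> 2 * (- (2 * pi / sqrt 238) * ln (euler_at a))) (at_right 1)"
    if "a \<ge> 1" "c \<ge> 1" "a * c = 238" for a c :: real
  proof -
    have "sqrt (c / a) = sqrt 238 / a"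
    proof -
      have "c / a = 238 / a\<^sup>2" using that by (simp add: power2_eq_square field_simps)
      then show ?thesis using that by (simp add: real_sqrt_divide)
    qed
    then have L: "(\<Sum>m. row_rem a c 1 m) = - (2 * pi / sqrt 238) * ln (euler_at a)"
      using row_rem_suminf[of a c] that by (simp add: euler_at_def)
    from tendsto_mult[OF tendsto_const row_rem_suminf_tendsto[OF that(1,2)], of 2]
    show ?thesis unfolding L .
  qed
  have lim: "((\<lambda>s. (2 * 1 powr - s * zsum (2 * s) + 2 * 2 powr - s * zsum (2 * s) - 2 * 7 powr - s * zsum (2 * s) - 2 * 14 powr - s * zsum (2 * s))
      + 4 * kernel_lim s * zsum (2 * s - 1) * G s
      + (2 * (\<Sum>m. row_rem 1 238 s m) + 2 * (\<Sum>m. row_rem 2 119 s m) - 2 * (\<Sum>m. row_rem 7 34 s m) - 2 * (\<Sum>m. row_rem 14 17 s m)))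
    \<longlongrightarrow> (2 * 1 powr - 1 * (pi\<^sup>2 / 6) + 2 * 2 powr - 1 * (pi\<^sup>2 / 6) - 2 * 7 powr - 1 * (pi\<^sup>2 / 6) - 2 * 14 powr - 1 * (pi\<^sup>2 / 6))
      + - pi * ln 49 / sqrt 238
      + (2 * (- (2 * pi / sqrt 238) * ln (euler_at 1)) + 2 * (- (2 * pi / sqrt 238) * ln (euler_at 2))
         - 2 * (- (2 * pi / sqrt 238) * ln (euler_at 7)) - 2 * (- (2 * pi / sqrt 238) * ln (euler_at 14)))) (at_right 1)"
    by (intro tendsto_add tendsto_diff z pole' r) auto
  have E1: "(2 * 1 powr - s * zsum (2 * s) + 2 * 2 powr - s * zsum (2 * s) - 2 * 7 powr - s * zsum (2 * s) - 2 * 14 powr - s * zsum (2 * s))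
      + 4 * kernel_lim s * zsum (2 * s - 1) * G s
      + (2 * (\<Sum>m. row_rem 1 238 s m) + 2 * (\<Sum>m. row_rem 2 119 s m) - 2 * (\<Sum>m. row_rem 7 34 s m) - 2 * (\<Sum>m. row_rem 14 17 s m))
      = epstein 1 238 s + epstein 2 119 s - epstein 7 34 s - epstein 14 17 s" for s
    unfolding epstein_def G_def by (simp add: algebra_simps)
  have E2: "(2 * 1 powr - 1 * (pi\<^sup>2 / 6) + 2 * 2 powr - 1 * (pi\<^sup>2 / 6) - 2 * 7 powr - 1 * (pi\<^sup>2 / 6) - 2 * 14 powr - 1 * (pi\<^sup>2 / 6))
      + - pi * ln 49 / sqrt 238
      + (2 * (- (2 * pi / sqrt 238) * ln (euler_at 1)) + 2 * (- (2 * pi / sqrt 238) * ln (euler_at 2))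
         - 2 * (- (2 * pi / sqrt 238) * ln (euler_at 7)) - 2 * (- (2 * pi / sqrt 238) * ln (euler_at 14)))
    = 3 * pi\<^sup>2 / 7 - pi * ln 49 / sqrt 238
    - 4 * pi / sqrt 238 * (ln (euler_at 1) + ln (euler_at 2) - ln (euler_at 7) - ln (euler_at 14))"
    by (simp add: powr_minus_divide field_simps)
  show ?thesis using lim unfolding E1 E2 .
qed

subsection \<open>Factorization into Dirichlet $L$-series\<close>

text \<open>Groups the lattice points by the value of the form, turning the Epstein zeta function
  into a Dirichlet series.\<close>

lemma form_count_has_sum:
  fixes a c :: int
  assumes a: "a \<ge> 1" and c: "c \<ge> 1" and s: "s > 1"
  shows "((\<lambda>n. real (form_count a c n) * real n powr - s) has_sum epstein (real_of_int a) (real_of_int c) s) UNIV"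
proof -
  let ?S = "\<lambda>n. {(x, y). a * x\<^sup>2 + c * y\<^sup>2 = int n}"
  have nn: "0 \<le> a * x\<^sup>2 + c * y\<^sup>2" for x y :: int using a c by simp
  have val: "real_of_int a * (real_of_int x)\<^sup>2 + real_of_int c * (real_of_int y)\<^sup>2 = real (nat (a * x\<^sup>2 + c * y\<^sup>2))" for x y
    using nn[of x y] by simp
  have "((\<lambda>p. real (fst p) powr - s) has_sum epstein (real_of_int a) (real_of_int c) s) (Sigma UNIV ?S)
    \<longleftrightarrow> ((\<lambda>(y::int, x::int). (real_of_int a * (real_of_int x)\<^sup>2 + real_of_int c * (real_of_int y)\<^sup>2) powr - s) has_sum epstein (real_of_int a) (real_of_int c) s) UNIV"
    by (rule has_sum_reindex_bij_witness[of _ "\<lambda>(y, x). (nat (a * x\<^sup>2 + c * y\<^sup>2), (x, y))" "\<lambda>(n, (x, y)). (y, x)"])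
       (auto simp: val nn simp del: of_nat_nat)
  then have "((\<lambda>p. real (fst p) powr - s) has_sum epstein (real_of_int a) (real_of_int c) s) (Sigma UNIV ?S)"
    using epstein_has_sum[of "real_of_int a" "real_of_int c" s] a c s by simp
  moreover have "((\<lambda>z. real (fst (n, z)) powr - s) has_sum (real (form_count a c n) * real n powr - s)) (?S n)" for n
  proof -
    have "finite (?S n)" using a c by (intro finite_form_reps) auto
    from has_sum_finite[OF this, of "\<lambda>z. real (fst (n, z)) powr - s"] show ?thesis
      by (simp add: form_count_def)
  qed
  ultimately show ?thesis by (rule has_sum_SigmaD)
qed

lemma has_sum_diff_real:
  fixes f g :: "'a \<Rightarrow> real"
  assumes "(f has_sum S) A" "(g has_sum T) A"
  shows "((\<lambda>x. f x - g x) has_sum (S - T)) A"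
  using has_sum_add[OF assms(1) has_sum_cmult_right[OF assms(2), of "-1"]] by simp

definition dirichlet_L :: "(nat \<Rightarrow> int) \<Rightarrow> real \<Rightarrow> real" where
  "dirichlet_L f s = (\<Sum>k. real_of_int (f (Suc k)) * real (Suc k) powr - s)"

lemma dirichlet_L_has_sum:
  assumes "\<And>n. \<bar>f n\<bar> \<le> 1" "s > 1"
  shows "((\<lambda>n. real_of_int (f n) * real n powr - s) has_sum dirichlet_L f s) {0<..}"
    and "(\<lambda>n. norm (real_of_int (f n) * real n powr - s)) summable_on {0<..}"
proof -
  have le: "norm (real_of_int (f (Suc k)) * real (Suc k) powr - s) \<le> real (Suc k) powr - s" for k
  proof -
    have "\<bar>real_of_int (f (Suc k))\<bar> \<le> 1" using assms(1)[of "Suc k"] by linarith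
    then have "\<bar>real_of_int (f (Suc k))\<bar> * real (Suc k) powr - s \<le> 1 * real (Suc k) powr - s"
      by (intro mult_right_mono) auto
    then show ?thesis by (simp add: abs_mult)
  qed
  have sm: "summable (\<lambda>k. norm (real_of_int (f (Suc k)) * real (Suc k) powr - s))"
    by (rule summable_comparison_test'[OF zsum_bounds(1)[OF assms(2)]]) (use le in simp)
  have "((\<lambda>k. real_of_int (f (Suc k)) * real (Suc k) powr - s) has_sum dirichlet_L f s) UNIV"
    unfolding dirichlet_L_def
    by (rule norm_summable_imp_has_sum[OF sm]) (rule summable_sums[OF summable_norm_cancel[OF sm]])
  moreover have re: "((\<lambda>k. h (Suc k)) has_sum x) UNIV \<longleftrightarrow> (h has_sum x) {0<..}" for h :: "nat \<Rightarrow> real" and x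
    by (rule has_sum_reindex_bij_witness[of _ "\<lambda>n. n - 1" Suc]) auto
  ultimately show "((\<lambda>n. real_of_int (f n) * real n powr - s) has_sum dirichlet_L f s) {0<..}"
    using re[of "\<lambda>n. real_of_int (f n) * real n powr - s" "dirichlet_L f s"] by blast
  have "((\<lambda>k. norm (real_of_int (f (Suc k)) * real (Suc k) powr - s)) has_sum
      (\<Sum>k. norm (real_of_int (f (Suc k)) * real (Suc k) powr - s))) UNIV"
    by (rule sums_nonneg_imp_has_sum[OF summable_sums[OF sm]]) simp
  then have "((\<lambda>n. norm (real_of_int (f n) * real n powr - s)) has_sum
      (\<Sum>k. norm (real_of_int (f (Suc k)) * real (Suc k) powr - s))) {0<..}"
    using re[of "\<lambda>n. norm (real_of_int (f n) * real n powr - s)"] by blast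
  then show "(\<lambda>n. norm (real_of_int (f n) * real n powr - s)) summable_on {0<..}"
    by (rule has_sum_imp_summable)
qed

text \<open>Absolute convergence allows the pairs (d, e) to be grouped by their product. Zero is
  left out because every number divides it.\<close>

lemma dirichlet_convolution_has_sum:
  assumes f: "\<And>n. \<bar>f n\<bar> \<le> 1" and g: "\<And>n. \<bar>g n\<bar> \<le> 1" and s: "s > 1"
  shows "((\<lambda>n. real_of_int (\<Sum>d | d dvd n. f d * g (n div d)) * real n powr - s)
    has_sum (dirichlet_L f s * dirichlet_L g s)) {0<..}"
proof -
  define u where "u n = real_of_int (f n) * real n powr - s" for n
  define v where "v n = real_of_int (g n) * real n powr - s" for n
  have U: "(u has_sum dirichlet_L f s) {0<..}" "(\<lambda>n. norm (u n)) summable_on {0<..}"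
    using dirichlet_L_has_sum[of f s, OF f s] unfolding u_def by blast+
  have V: "(v has_sum dirichlet_L g s) {0<..}" "(\<lambda>n. norm (v n)) summable_on {0<..}"
    using dirichlet_L_has_sum[of g s, OF g s] unfolding v_def by blast+
  have "((\<lambda>p. u (fst p) * v (snd p)) has_sum (dirichlet_L f s * dirichlet_L g s)) (Sigma {0<..} (\<lambda>_. {0<..}))"
  proof (rule has_sum_SigmaI)
    show "((\<lambda>y. u (fst (x, y)) * v (snd (x, y))) has_sum u x * dirichlet_L g s) {0<..}" for x
      using has_sum_cmult_right[OF V(1)] by simp
    show "((\<lambda>x. u x * dirichlet_L g s) has_sum dirichlet_L f s * dirichlet_L g s) {0<..}"
      by (rule has_sum_cmult_left[OF U(1)])
    have "(\<lambda>p. norm (u (fst p) * v (snd p))) summable_on Sigma {0<..} (\<lambda>_. {0<..})"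
      unfolding Infinite_Sum.abs_summable_on_Sigma_iff
    proof (intro conjI ballI)
      show "(\<lambda>y. norm (u (fst (x, y)) * v (snd (x, y)))) summable_on {0<..}" for x
        using summable_on_cmult_right[OF V(2), of "norm (u x)"] by (simp add: abs_mult)
      have "(\<lambda>x. norm (u x) * norm (\<Sum>\<^sub>\<infinity>y\<in>{0<..}. norm (v y))) summable_on {0<..}"
        by (rule summable_on_cmult_left[OF U(2)])
      then show "(\<lambda>x. norm (\<Sum>\<^sub>\<infinity>y\<in>{0<..}. norm (u (fst (x, y)) * v (snd (x, y))))) summable_on {0<..}"
        by (simp add: abs_mult infsum_cmult_right')
    qed
    then show "(\<lambda>p. u (fst p) * v (snd p)) summable_on Sigma {0<..} (\<lambda>_. {0<..})"
      by (rule abs_summable_summable)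
  qed
  moreover have "((\<lambda>p. u (snd p) * v (fst p div snd p)) has_sum (dirichlet_L f s * dirichlet_L g s)) (Sigma {0<..} (\<lambda>n. {d. d dvd n}))
    \<longleftrightarrow> ((\<lambda>p. u (fst p) * v (snd p)) has_sum (dirichlet_L f s * dirichlet_L g s)) (Sigma {0<..} (\<lambda>_. {0<..}))"
    by (rule has_sum_reindex_bij_witness[of _ "\<lambda>(d, e). (d * e, d)" "\<lambda>(n, d). (d, n div d)"])
       (auto intro: Nat.gr0I simp: dvd_div_eq_0_iff)
  ultimately have "((\<lambda>p. u (snd p) * v (fst p div snd p)) has_sum (dirichlet_L f s * dirichlet_L g s)) (Sigma {0<..} (\<lambda>n. {d. d dvd n}))"
    by simp
  then show ?thesis
  proof (rule has_sum_SigmaD)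
    fix n :: nat assume n: "n \<in> {0<..}"
    have "((\<lambda>d. u (snd (n, d)) * v (fst (n, d) div snd (n, d))) has_sum (\<Sum>d | d dvd n. u d * v (n div d))) {d. d dvd n}"
      using has_sum_finite[of "{d. d dvd n}"] n by simp
    also have "(\<Sum>d | d dvd n. u d * v (n div d)) = (\<Sum>d | d dvd n. real_of_int (f d * g (n div d)) * real n powr - s)"
    proof (rule sum.cong[OF refl])
      fix d assume "d \<in> {d. d dvd n}"
      then have "real n = real d * real (n div d)" by (simp flip: of_nat_mult)
      then have "real n powr - s = real d powr - s * real (n div d) powr - s" by (simp only: powr_mult of_nat_0_le_iff)
      then show "u d * v (n div d) = real_of_int (f d * g (n div d)) * real n powr - s"
        by (simp add: u_def v_def)
    qed
    finally show "((\<lambda>d. u (snd (n, d)) * v (fst (n, d) div snd (n, d))) has_sum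
        (real_of_int (\<Sum>d | d dvd n. f d * g (n div d)) * real n powr - s)) {d. d dvd n}"
      by (simp add: sum_distrib_right)
  qed
qed

text \<open>The Kronecker character of discriminant -56 = 8 * (-7); \<open>chi136\<close> is that of
  136 = 8 * 17.\<close>

definition chi56 :: "nat \<Rightarrow> int" where "chi56 n = chi8 n * chi7 n"
definition chi136 :: "nat \<Rightarrow> int" where "chi136 n = chi8 n * chi17 n"

lemma chi_bounds: "\<bar>chi7 n\<bar> \<le> 1" "\<bar>chi8 n\<bar> \<le> 1" "\<bar>chi17 n\<bar> \<le> 1" "\<bar>chi56 n\<bar> \<le> 1" "\<bar>chi136 n\<bar> \<le> 1"
  by (auto simp: chi7_def chi8_def chi17_def chi56_def chi136_def)

lemma epstein_L_factorization:
  assumes s: "s > 1"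
  shows "epstein 1 238 s + epstein 2 119 s - epstein 7 34 s - epstein 14 17 s
    = dirichlet_L chi17 s * dirichlet_L chi56 s + dirichlet_L chi136 s * dirichlet_L chi7 s"
proof -
  have F: "((\<lambda>n. real (form_count a c n) * real n powr - s) has_sum epstein (real_of_int a) (real_of_int c) s) {0<..}"
    if "a \<ge> 1" "c \<ge> 1" for a c :: int
  proof -
    have "((\<lambda>n. real (form_count a c n) * real n powr - s) has_sum epstein (real_of_int a) (real_of_int c) s) UNIV
      \<longleftrightarrow> ((\<lambda>n. real (form_count a c n) * real n powr - s) has_sum epstein (real_of_int a) (real_of_int c) s) {0<..}"
      by (rule has_sum_cong_neutral) auto
    then show ?thesis using form_count_has_sum[OF that s] by blast
  qed
  have "((\<lambda>n. real (form_count 1 238 n) * real n powr - s + real (form_count 2 119 n) * real n powr - s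
      - real (form_count 7 34 n) * real n powr - s - real (form_count 14 17 n) * real n powr - s)
    has_sum (epstein 1 238 s + epstein 2 119 s - epstein 7 34 s - epstein 14 17 s)) {0<..}"
    using F[of 1 238] F[of 2 119] F[of 7 34] F[of 14 17] by (intro has_sum_diff_real has_sum_add) auto
  moreover have "real (form_count 1 238 n) * real n powr - s + real (form_count 2 119 n) * real n powr - s
      - real (form_count 7 34 n) * real n powr - s - real (form_count 14 17 n) * real n powr - s
    = real_of_int (genus_count n) * real n powr - s" for n
    by (simp add: genus_count_def algebra_simps)
  ultimately have 1: "((\<lambda>n. real_of_int (genus_count n) * real n powr - s)
    has_sum (epstein 1 238 s + epstein 2 119 s - epstein 7 34 s - epstein 14 17 s)) {0<..}" by simp
  have "((\<lambda>n. real_of_int (\<Sum>d | d dvd n. chi17 d * chi56 (n div d)) * real n powr - s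
      + real_of_int (\<Sum>d | d dvd n. chi136 d * chi7 (n div d)) * real n powr - s)
    has_sum (dirichlet_L chi17 s * dirichlet_L chi56 s + dirichlet_L chi136 s * dirichlet_L chi7 s)) {0<..}"
    by (intro has_sum_add dirichlet_convolution_has_sum chi_bounds s)
  moreover have "real_of_int (\<Sum>d | d dvd n. chi17 d * chi56 (n div d)) * real n powr - s
      + real_of_int (\<Sum>d | d dvd n. chi136 d * chi7 (n div d)) * real n powr - s
    = real_of_int (chi_conv n) * real n powr - s" for n
    by (simp add: chi_conv_def chi56_def chi136_def algebra_simps)
  ultimately have 2: "((\<lambda>n. real_of_int (chi_conv n) * real n powr - s)
    has_sum (dirichlet_L chi17 s * dirichlet_L chi56 s + dirichlet_L chi136 s * dirichlet_L chi7 s)) {0<..}" by simp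
  have "((\<lambda>n. real_of_int (genus_count n) * real n powr - s) has_sum S) {0<..}
    \<longleftrightarrow> ((\<lambda>n. real_of_int (chi_conv n) * real n powr - s) has_sum S) {0<..}" for S
    by (rule has_sum_cong) (simp add: genus_count_eq)
  then show ?thesis using 1 2 has_sum_unique by blast
qed

subsection \<open>Values of $L$-series at $1$\<close>

text \<open>Summation by parts: the differences of g telescope, and two boundary terms
  remain.\<close>

lemma abel_tail_bound:
  fixes u g :: "nat \<Rightarrow> real"
  assumes bd: "\<And>n. \<bar>\<Sum>k<n. u k\<bar> \<le> B" and dec: "\<And>k. g (Suc k) \<le> g k" and nn: "\<And>k. 0 \<le> g k"
  shows "\<bar>\<Sum>k\<in>{m..<m + j}. u k * g k\<bar> \<le> 2 * B * g m"
proof (cases j)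
  case 0
  have "0 \<le> B" using bd[of 0] by simp
  then show ?thesis using 0 nn by simp
next
  case (Suc i)
  define A where "A n = (\<Sum>k<n. u k)" for n
  have Abd: "\<bar>A n\<bar> \<le> B" for n using bd by (simp only: A_def)
  have "(\<Sum>k\<in>{m..<m + Suc i}. u k * g k)
      = A (m + Suc i) * g (m + i) - A m * g m + (\<Sum>k<i. A (m + Suc k) * (g (m + k) - g (m + Suc k)))"
  proof (induction i)
    case 0
    show ?case by (simp add: A_def algebra_simps)
  next
    case (Suc i)
    have "{m..<m + Suc (Suc i)} = insert (m + Suc i) {m..<m + Suc i}" by auto
    then have "(\<Sum>k\<in>{m..<m + Suc (Suc i)}. u k * g k) = u (m + Suc i) * g (m + Suc i) + (\<Sum>k\<in>{m..<m + Suc i}. u k * g k)"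
      by simp
    moreover have "A (m + Suc (Suc i)) = A (m + Suc i) + u (m + Suc i)" by (simp add: A_def)
    ultimately show ?case unfolding Suc by (simp add: algebra_simps)
  qed
  also have "\<bar>\<dots>\<bar> \<le> B * g (m + i) + B * g m + (\<Sum>k<i. B * (g (m + k) - g (m + Suc k)))"
  proof -
    have 1: "\<bar>A (m + Suc i) * g (m + i)\<bar> \<le> B * g (m + i)" "\<bar>A m * g m\<bar> \<le> B * g m"
      using Abd nn by (auto simp: abs_mult intro!: mult_right_mono)
    have 2: "\<bar>\<Sum>k<i. A (m + Suc k) * (g (m + k) - g (m + Suc k))\<bar> \<le> (\<Sum>k<i. B * (g (m + k) - g (m + Suc k)))"
    proof (rule order_trans[OF sum_abs], rule sum_mono)
      fix k
      have "0 \<le> g (m + k) - g (m + Suc k)" using dec[of "m + k"] by simp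
      then show "\<bar>A (m + Suc k) * (g (m + k) - g (m + Suc k))\<bar> \<le> B * (g (m + k) - g (m + Suc k))"
        by (simp add: abs_mult mult_right_mono Abd)
    qed
    show ?thesis using 1 2 by linarith
  qed
  also have "(\<Sum>k<i. B * (g (m + k) - g (m + Suc k))) = B * (g m - g (m + i))"
    by (induction i) (auto simp: algebra_simps)
  also have "B * g (m + i) + B * g m + B * (g m - g (m + i)) = 2 * B * g m" by (simp add: algebra_simps)
  finally show ?thesis using Suc by simp
qed

text \<open>Comparing g with 1 / (k + 1) makes the tail estimate the same for all weights g, which
  is the uniformity needed to exchange limits.\<close>

lemma abel_summable:
  fixes u g :: "nat \<Rightarrow> real"
  assumes bd: "\<And>n. \<bar>\<Sum>k<n. u k\<bar> \<le> B" and dec: "\<And>k. g (Suc k) \<le> g k" and nn: "\<And>k. 0 \<le> g k"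
    and le: "\<And>k. g k \<le> 1 / real (Suc k)"
  shows "summable (\<lambda>k. u k * g k)" "\<bar>(\<Sum>k<n. u k * g k) - (\<Sum>k. u k * g k)\<bar> \<le> 2 * B / real (Suc n)"
proof -
  have B0: "0 \<le> B" using bd[of 0] by simp
  have tail: "\<bar>(\<Sum>k<m + j. u k * g k) - (\<Sum>k<m. u k * g k)\<bar> \<le> 2 * B / real (Suc m)" for m j
  proof -
    have "(\<Sum>k<m + j. u k * g k) - (\<Sum>k<m. u k * g k) = (\<Sum>k\<in>{m..<m + j}. u k * g k)"
      using sum_diff_nat_ivl[of 0 m "m + j" "\<lambda>k. u k * g k"] by (simp add: lessThan_atLeast0)
    then have "\<bar>(\<Sum>k<m + j. u k * g k) - (\<Sum>k<m. u k * g k)\<bar> \<le> 2 * B * g m"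
      using abel_tail_bound[of u B g, OF bd dec nn] by simp
    also have "\<dots> \<le> 2 * B * (1 / real (Suc m))" using B0 le by (intro mult_left_mono) auto
    finally show ?thesis by simp
  qed
  have "Cauchy (\<lambda>n. \<Sum>k<n. u k * g k)"
  proof (rule metric_CauchyI)
    fix e :: real assume e: "e > 0"
    obtain M where M: "2 * B / e < real M" using reals_Archimedean2 by blast
    show "\<exists>M. \<forall>m\<ge>M. \<forall>n\<ge>M. dist (\<Sum>k<m. u k * g k) (\<Sum>k<n. u k * g k) < e"
    proof (intro exI[of _ M] allI impI)
      have small: "2 * B / real (Suc m) < e" if "m \<ge> M" for m
      proof -
        have "2 * B / e < real (Suc m)" using M that by linarith
        then show ?thesis using e by (simp add: field_simps)
      qed
      fix m n assume mn: "M \<le> m" "M \<le> n"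
      show "dist (\<Sum>k<m. u k * g k) (\<Sum>k<n. u k * g k) < e"
      proof (cases "m \<le> n")
        case True
        then show ?thesis using tail[of m "n - m"] small[OF mn(1)] by (simp add: dist_real_def abs_minus_commute)
      next
        case False
        then show ?thesis using tail[of n "m - n"] small[OF mn(2)] by (simp add: dist_real_def)
      qed
    qed
  qed
  then show sm: "summable (\<lambda>k. u k * g k)"
    by (simp add: summable_iff_convergent Cauchy_convergent_iff)
  have "(\<lambda>j. \<bar>(\<Sum>k<j + n. u k * g k) - (\<Sum>k<n. u k * g k)\<bar>) \<longlonglongrightarrow> \<bar>(\<Sum>k. u k * g k) - (\<Sum>k<n. u k * g k)\<bar>"
    by (intro tendsto_intros LIMSEQ_ignore_initial_segment summable_LIMSEQ sm)
  then have "\<bar>(\<Sum>k. u k * g k) - (\<Sum>k<n. u k * g k)\<bar> \<le> 2 * B / real (Suc n)"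
    by (rule LIMSEQ_le_const2) (use tail[of n] in \<open>auto simp: add.commute\<close>)
  then show "\<bar>(\<Sum>k<n. u k * g k) - (\<Sum>k. u k * g k)\<bar> \<le> 2 * B / real (Suc n)"
    by (simp add: abs_minus_commute)
qed

text \<open>Both \<open>n powr - s\<close> (as \<open>s\<close> tends to \<open>1\<close>) and \<open>x ^ n / n\<close> (as \<open>x\<close> tends to \<open>1\<close>)
  are instances of this summation method, so the two limits coincide.\<close>

lemma abel_limit:
  fixes u :: "nat \<Rightarrow> real" and f :: "nat \<Rightarrow> 'a \<Rightarrow> real"
  assumes bd: "\<And>n. \<bar>\<Sum>k<n. u k\<bar> \<le> B"
    and ev: "\<forall>\<^sub>F t in F. \<forall>k. f (Suc k) t \<le> f k t \<and> 0 \<le> f k t \<and> f k t \<le> 1 / real (Suc k)"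
    and lim: "\<And>k. (f k \<longlongrightarrow> 1 / real (Suc k)) F"
  shows "((\<lambda>t. \<Sum>k. u k * f k t) \<longlongrightarrow> (\<Sum>k. u k * (1 / real (Suc k)))) F"
proof (rule swap_uniform_limit')
  let ?S = "{t. \<forall>k. f (Suc k) t \<le> f k t \<and> 0 \<le> f k t \<and> f k t \<le> 1 / real (Suc k)}"
  show "\<forall>\<^sub>F n in sequentially. ((\<lambda>t. \<Sum>k<n. u k * f k t) \<longlongrightarrow> (\<Sum>k<n. u k * (1 / real (Suc k)))) F"
    by (intro always_eventually allI tendsto_intros lim)
  show "(\<lambda>n. \<Sum>k<n. u k * (1 / real (Suc k))) \<longlonglongrightarrow> (\<Sum>k. u k * (1 / real (Suc k)))"
    by (intro summable_LIMSEQ abel_summable[OF bd]) (auto simp: frac_le)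
  \<comment> \<open>The Abel bound 2 B / (n + 1) does not depend on t.\<close>
  show "uniform_limit ?S (\<lambda>n t. \<Sum>k<n. u k * f k t) (\<lambda>t. \<Sum>k. u k * f k t) sequentially"
  proof (rule uniform_limitI)
    fix e :: real assume e: "e > 0"
    obtain M where M: "2 * B / e < real M" using reals_Archimedean2 by blast
    show "\<forall>\<^sub>F n in sequentially. \<forall>t\<in>?S. dist (\<Sum>k<n. u k * f k t) (\<Sum>k. u k * f k t) < e"
      using eventually_ge_at_top[of M]
    proof eventually_elim
      case (elim n)
      have "2 * B / e < real (Suc n)" using M elim by linarith
      then have small: "2 * B / real (Suc n) < e" using e by (simp add: field_simps)
      show ?case
      proof
        fix t assume "t \<in> ?S"
        then have t: "\<And>k. f (Suc k) t \<le> f k t" "\<And>k. 0 \<le> f k t" "\<And>k. f k t \<le> 1 / real (Suc k)" by auto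
        have "\<bar>(\<Sum>k<n. u k * f k t) - (\<Sum>k. u k * f k t)\<bar> \<le> 2 * B / real (Suc n)"
          by (rule abel_summable(2)[of u B "\<lambda>k. f k t", OF bd t])
        then show "dist (\<Sum>k<n. u k * f k t) (\<Sum>k. u k * f k t) < e"
          using small by (simp add: dist_real_def)
      qed
    qed
  qed
  show "\<forall>\<^sub>F t in F. t \<in> ?S" using ev by simp
qed auto

text \<open>Full periods cancel, so only an incomplete last period contributes.\<close>

lemma periodic_sum_bounded:
  fixes u :: "nat \<Rightarrow> real"
  assumes per: "\<And>n. u (n + d) = u n" and zero: "(\<Sum>k<d. u k) = 0" and le: "\<And>n. \<bar>u n\<bar> \<le> 1" and d: "d > 0"
  shows "\<bar>\<Sum>k<n. u k\<bar> \<le> real d"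
proof (induction n rule: less_induct)
  case (less n)
  show ?case
  proof (cases "n < d")
    case True
    have "\<bar>\<Sum>k<n. u k\<bar> \<le> (\<Sum>k<n. \<bar>u k\<bar>)" by (rule sum_abs)
    also have "\<dots> \<le> (\<Sum>k<n. 1)" by (intro sum_mono le)
    finally show ?thesis using True by simp
  next
    case False
    define m where "m = n - d"
    have n: "n = d + m" and "m < n" using False d by (auto simp: m_def)
    have "(\<Sum>k<d + m. u k) = (\<Sum>k<d. u k) + (\<Sum>k<m. u (k + d))"
      by (induction m) (auto simp: add.commute)
    then have "(\<Sum>k<n. u k) = (\<Sum>k<m. u k)" by (simp add: n zero per)
    then show ?thesis using less[OF \<open>m < n\<close>] by simp
  qed
qed

section \<open>Fourier series of the complex logarithm\<close>

lemma minus_Ln_series: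
  fixes z :: complex
  assumes "norm z < 1"
  shows "(\<lambda>k. z ^ Suc k / of_nat (Suc k)) sums (- Ln (1 - z))"
proof -
  have "(\<lambda>n. (-1) ^ Suc n / of_nat n * (- z) ^ n) sums ln (1 + (- z))"
    by (rule Ln_series) (use assms in simp)
  from sums_minus[OF this] have "(\<lambda>n. - ((-1) ^ Suc n / of_nat n * (- z) ^ n)) sums (- Ln (1 - z))" by simp
  moreover have "- ((-1) ^ Suc n / of_nat n * (- z) ^ n) = z ^ n / of_nat n" for n
    by (cases "even n") simp_all
  ultimately have "(\<lambda>n. z ^ n / of_nat n) sums (- Ln (1 - z))" by (simp only:)
  then show ?thesis by (subst sums_Suc_iff) simp
qed

text \<open>The real part of -Ln(1 - x cis \<theta>), that is, minus the logarithm of a distance, in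
  real terms.\<close>

definition cos_log :: "real \<Rightarrow> real \<Rightarrow> real" where
  "cos_log \<theta> x = - ln (1 - 2 * x * cos \<theta> + x\<^sup>2) / 2"

definition sin_log :: "real \<Rightarrow> real \<Rightarrow> real" where
  "sin_log \<theta> x = Im (- Ln (1 - of_real x * cis \<theta>))"

lemma trig_log_series:
  assumes x: "0 \<le> x" "x < 1"
  shows "(\<lambda>k. cos (real (Suc k) * \<theta>) * (x ^ Suc k / real (Suc k))) sums cos_log \<theta> x"
    and "(\<lambda>k. sin (real (Suc k) * \<theta>) * (x ^ Suc k / real (Suc k))) sums sin_log \<theta> x"
proof -
  define z where "z = of_real x * cis \<theta>"
  have nz: "norm z < 1" using x by (simp add: z_def norm_mult)
  have zp: "z ^ Suc k / of_nat (Suc k) = of_real (x ^ Suc k / real (Suc k)) * cis (real (Suc k) * \<theta>)" for k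
    by (simp only: z_def power_mult_distrib Complex.DeMoivre of_real_power of_real_divide of_real_of_nat_eq times_divide_eq_left)
  have s: "(\<lambda>k. z ^ Suc k / of_nat (Suc k)) sums (- Ln (1 - z))" by (rule minus_Ln_series[OF nz])
  have "1 - z \<noteq> 0" using nz by auto
  have "(\<lambda>k. Re (z ^ Suc k / of_nat (Suc k))) sums Re (- Ln (1 - z))" using s by (rule sums_Re)
  moreover have "Re (- Ln (1 - z)) = cos_log \<theta> x"
  proof -
    have "norm (1 - z) ^ 2 = 1 - 2 * x * cos \<theta> + x\<^sup>2"
    proof -
      have "norm (1 - z) ^ 2 = (1 - x * cos \<theta>)\<^sup>2 + (x * sin \<theta>)\<^sup>2"
        by (simp add: cmod_power2 z_def)
      also have "\<dots> = 1 - 2 * x * cos \<theta> + x\<^sup>2 * ((sin \<theta>)\<^sup>2 + (cos \<theta>)\<^sup>2)"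
      proof -
        have "(1 - x * c)\<^sup>2 + (x * s)\<^sup>2 = 1 - 2 * x * c + x\<^sup>2 * (s\<^sup>2 + c\<^sup>2)" for c s :: real
          by (simp add: power2_eq_square algebra_simps)
        then show ?thesis .
      qed
      finally show ?thesis by simp
    qed
    moreover have "ln (norm (1 - z) ^ 2) = 2 * ln (norm (1 - z))"
      using \<open>1 - z \<noteq> 0\<close> by (simp add: ln_realpow)
    ultimately have "ln (norm (1 - z)) = ln (1 - 2 * x * cos \<theta> + x\<^sup>2) / 2" by simp
    then show ?thesis using \<open>1 - z \<noteq> 0\<close> by (simp add: cos_log_def)
  qed
  moreover have "Re (z ^ Suc k / of_nat (Suc k)) = cos (real (Suc k) * \<theta>) * (x ^ Suc k / real (Suc k))" for k
    unfolding zp by (simp del: of_nat_Suc power_Suc)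
  ultimately show "(\<lambda>k. cos (real (Suc k) * \<theta>) * (x ^ Suc k / real (Suc k))) sums cos_log \<theta> x"
    by (simp only:)
  have "(\<lambda>k. Im (z ^ Suc k / of_nat (Suc k))) sums Im (- Ln (1 - z))" using s by (rule sums_Im)
  moreover have "Im (z ^ Suc k / of_nat (Suc k)) = sin (real (Suc k) * \<theta>) * (x ^ Suc k / real (Suc k))" for k
    unfolding zp by (simp del: of_nat_Suc power_Suc)
  ultimately show "(\<lambda>k. sin (real (Suc k) * \<theta>) * (x ^ Suc k / real (Suc k))) sums sin_log \<theta> x"
    by (simp only: sin_log_def z_def)
qed

lemma cos_log_tendsto:
  assumes "cos \<theta> < 1"
  shows "(cos_log \<theta> \<longlongrightarrow> - ln (2 - 2 * cos \<theta>) / 2) (at_left 1)"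
proof -
  have "((\<lambda>x. - ln (1 - 2 * x * cos \<theta> + x\<^sup>2) / 2) \<longlongrightarrow> - ln (1 - 2 * 1 * cos \<theta> + 1\<^sup>2) / 2) (at_left 1)"
    using assms by (intro tendsto_intros) auto
  then show ?thesis by (simp add: cos_log_def[abs_def])
qed

text \<open>The sawtooth: 1 - cis \<theta> has modulus 2 sin(\<theta> / 2) and argument (\<theta> -
  pi) / 2, which is the principal one because 0 < \<theta> < 2 pi.\<close>

lemma sin_log_tendsto:
  assumes t: "0 < \<theta>" "\<theta> < 2 * pi"
  shows "(sin_log \<theta> \<longlongrightarrow> (pi - \<theta>) / 2) (at_left 1)"
proof -
  define r where "r = 2 * sin (\<theta> / 2)"
  have r: "r > 0" using t by (auto simp: r_def intro: sin_gt_zero)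
  have e: "1 - cis \<theta> = exp (Complex (ln r) ((\<theta> - pi) / 2))"
  proof -
    have "cos \<theta> = 1 - 2 * (sin (\<theta> / 2))\<^sup>2" "sin \<theta> = 2 * sin (\<theta> / 2) * cos (\<theta> / 2)"
      using cos_double_sin[of "\<theta> / 2"] sin_double[of "\<theta> / 2"] by auto
    moreover have "cos ((\<theta> - pi) / 2) = sin (\<theta> / 2)" "sin ((\<theta> - pi) / 2) = - cos (\<theta> / 2)"
      by (simp_all add: diff_divide_distrib cos_diff sin_diff)
    ultimately show ?thesis using r
      by (auto simp: complex_eq_iff Re_exp Im_exp r_def power2_eq_square)
  qed
  have "Ln (1 - cis \<theta>) = Complex (ln r) ((\<theta> - pi) / 2)"
    unfolding e by (rule Ln_exp) (use t in auto)
  then have v: "Im (- Ln (1 - of_real 1 * cis \<theta>)) = (pi - \<theta>) / 2" by (simp add: field_simps)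
  have "Re (1 - cis \<theta>) > 0"
  proof -
    have "Re (1 - cis \<theta>) = r\<^sup>2 / 2"
      using cos_double_sin[of "\<theta> / 2"] by (simp add: r_def power_mult_distrib)
    moreover have "r\<^sup>2 > 0" using r by simp
    ultimately show ?thesis by linarith
  qed
  then have "1 - of_real 1 * cis \<theta> \<notin> \<real>\<^sub>\<le>\<^sub>0" by (auto simp: complex_nonpos_Reals_iff)
  then have "((\<lambda>x. Im (- Ln (1 - of_real x * cis \<theta>))) \<longlongrightarrow> Im (- Ln (1 - of_real 1 * cis \<theta>))) (at_left 1)"
    by (intro tendsto_intros)
  then show ?thesis unfolding v by (simp add: sin_log_def[abs_def])
qed

definition cosd :: "nat \<Rightarrow> nat \<Rightarrow> real" where "cosd d k = cos (real k * (2 * pi / real d))"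
definition sind :: "nat \<Rightarrow> nat \<Rightarrow> real" where "sind d k = sin (real k * (2 * pi / real d))"

section \<open>Trigonometric values at the points of division of the circle\<close>

lemma trig_plus_periods:
  "cos (x + 2 * pi * real k) = cos x" "sin (x + 2 * pi * real k) = sin x"
proof (induction k)
  case (Suc k)
  have e: "x + 2 * pi * real (Suc k) = (x + 2 * pi * real k) + 2 * pi" by (simp add: algebra_simps)
  { case 1 show ?case unfolding e cos_periodic by (rule Suc) }
  { case 2 show ?case unfolding e sin_periodic by (rule Suc) }
qed simp_all

lemma trigd_mod:
  assumes "d > 0"
  shows "cosd d (k mod d) = cosd d k" "sind d (k mod d) = sind d k"
proof -
  have "real k = real (k mod d) + real d * real (k div d)"
    by (metis add.commute mod_mult_div_eq of_nat_add of_nat_mult)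
  then have "real k * (2 * pi / real d) = real (k mod d) * (2 * pi / real d) + 2 * pi * real (k div d)"
    using assms by (simp add: field_simps)
  then show "cosd d (k mod d) = cosd d k" "sind d (k mod d) = sind d k"
    unfolding cosd_def sind_def by (simp_all only: trig_plus_periods)
qed

lemma trigd_reflect:
  assumes "d > 0" "j + k = d"
  shows "cosd d j = cosd d k" "sind d j = - sind d k"
proof -
  have "real j = real d - real k" using assms(2) by auto
  then have e: "real j * (2 * pi / real d) = 2 * pi - real k * (2 * pi / real d)"
    using assms(1) by (simp add: left_diff_distrib diff_divide_distrib)
  show "cosd d j = cosd d k" "sind d j = - sind d k"
    unfolding cosd_def sind_def e by (simp_all add: cos_diff sin_diff)
qed

lemma trigd_0: "cosd d 0 = 1" "sind d 0 = 0"
  by (simp_all add: cosd_def sind_def)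

lemma cosd_mult_cosd:
  assumes "k \<le> j"
  shows "2 * cosd d j * cosd d k = cosd d (j + k) + cosd d (j - k)"
proof -
  define w where "w = 2 * pi / real d"
  have "real (j + k) * w = real j * w + real k * w" "real (j - k) * w = real j * w - real k * w"
    using assms by (simp_all add: algebra_simps of_nat_diff)
  then show ?thesis unfolding cosd_def sind_def w_def[symmetric] by (simp add: cos_add cos_diff)
qed

lemma sind_mult_sind:
  assumes "k \<le> j"
  shows "2 * sind d j * sind d k = cosd d (j - k) - cosd d (j + k)"
proof -
  define w where "w = 2 * pi / real d"
  have "real (j + k) * w = real j * w + real k * w" "real (j - k) * w = real j * w - real k * w"
    using assms by (simp_all add: algebra_simps of_nat_diff)
  then show ?thesis unfolding cosd_def sind_def w_def[symmetric] by (simp add: cos_add cos_diff)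
qed

lemma sum_cosd_zero:
  assumes "d > 1"
  shows "(\<Sum>k<d. cosd d k) = 0"
proof -
  define w where "w = cis (2 * pi / real d)"
  have "w \<noteq> 1"
  proof
    assume "w = 1"
    then have "cos (2 * pi / real d) = 1" by (simp add: w_def complex_eq_iff)
    then obtain n :: int where n: "2 * pi / real d = of_int n * 2 * pi" by (auto simp: cos_one_2pi_int)
    then have "1 = of_int n * real d" using assms by (simp add: field_simps)
    then have "1 = n * int d" by (metis of_int_1 of_int_eq_iff of_int_mult of_int_of_nat_eq)
    then show False using assms by (metis dvd_triv_right int_dvd_int_iff nat_dvd_1_iff_1 of_nat_1 less_irrefl)
  qed
  have "w ^ d = 1" using assms by (simp add: w_def Complex.DeMoivre)
  then have "(\<Sum>k<d. w ^ k) = 0" using \<open>w \<noteq> 1\<close> by (simp add: geometric_sum)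
  then have "(\<Sum>k<d. Re (w ^ k)) = 0" by (metis Re_sum zero_complex.simps(1))
  then show ?thesis by (simp add: w_def Complex.DeMoivre cosd_def)
qed

lemma cosd8: "cosd 8 1 = sqrt 2 / 2" "cosd 8 2 = 0" "cosd 8 3 = - sqrt 2 / 2" "cosd 8 4 = -1"
  "cosd 8 5 = - sqrt 2 / 2" "cosd 8 6 = 0" "cosd 8 7 = sqrt 2 / 2"
proof -
  show c1: "cosd 8 1 = sqrt 2 / 2" using cos_45 by (simp add: cosd_def field_simps)
  show c2: "cosd 8 2 = 0" using cos_pi_half by (simp add: cosd_def field_simps)
  show c4: "cosd 8 4 = -1" by (simp add: cosd_def)
  show c3: "cosd 8 3 = - sqrt 2 / 2"
    using cosd_mult_cosd[of 1 2 8] c1 c2 by simp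
  show "cosd 8 5 = - sqrt 2 / 2" "cosd 8 6 = 0" "cosd 8 7 = sqrt 2 / 2"
    using trigd_reflect(1)[of 8 5 3] trigd_reflect(1)[of 8 6 2] trigd_reflect(1)[of 8 7 1] c1 c2 c3 by simp_all
qed

lemma cosd_sind7:
  "cosd 7 4 = cosd 7 3" "cosd 7 5 = cosd 7 2" "cosd 7 6 = cosd 7 1"
  "sind 7 4 = - sind 7 3" "sind 7 5 = - sind 7 2" "sind 7 6 = - sind 7 1"
  using trigd_reflect[of 7 4 3] trigd_reflect[of 7 5 2] trigd_reflect[of 7 6 1] by simp_all

text \<open>The imaginary part of the Gauss sum modulo 7, the residue 4 folded onto 3 with a minus
  sign. The product formulas give its square; comparing sines settles the sign.\<close>

lemma gauss_sum_7: "2 * (sind 7 1 + sind 7 2 - sind 7 3) = sqrt 7"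
proof -
  define G where "G = sind 7 1 + sind 7 2 - sind 7 3"
  have z: "1 + 2 * (cosd 7 1 + cosd 7 2 + cosd 7 3) = 0"
  proof -
    have "{..<7::nat} = {0,1,2,3,4,5,6}" by auto
    then show ?thesis using sum_cosd_zero[of 7] by (simp add: cosd_sind7 trigd_0)
  qed
  have m: "2 * (sind 7 1 * sind 7 1) = 1 - cosd 7 2" "2 * (sind 7 2 * sind 7 2) = 1 - cosd 7 3"
    "2 * (sind 7 3 * sind 7 3) = 1 - cosd 7 1" "2 * (sind 7 2 * sind 7 1) = cosd 7 1 - cosd 7 3"
    "2 * (sind 7 3 * sind 7 1) = cosd 7 2 - cosd 7 3" "2 * (sind 7 3 * sind 7 2) = cosd 7 1 - cosd 7 2"
    using sind_mult_sind[of 1 1 7] sind_mult_sind[of 2 2 7] sind_mult_sind[of 3 3 7]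
      sind_mult_sind[of 1 2 7] sind_mult_sind[of 1 3 7] sind_mult_sind[of 2 3 7]
    by (simp_all add: cosd_sind7 trigd_0 numeral_2_eq_2[symmetric])
  have "G * G = sind 7 1 * sind 7 1 + sind 7 2 * sind 7 2 + sind 7 3 * sind 7 3
     + 2 * (sind 7 2 * sind 7 1) - 2 * (sind 7 3 * sind 7 1) - 2 * (sind 7 3 * sind 7 2)"
    by (simp add: G_def algebra_simps)
  then have sq: "(2 * G)\<^sup>2 = 7" using m z by (simp add: power2_eq_square)
  have "sind 7 1 > 0" unfolding sind_def by (rule sin_gt_zero) (auto simp: field_simps)
  moreover have "sind 7 3 < sind 7 2"
  proof -
    have e: "sind 7 3 = sin (pi / 7)" "sind 7 2 = sin (3 * pi / 7)"
    proof -
      have w: "real 3 * (2 * pi / real 7) = pi - pi / 7" "real 2 * (2 * pi / real 7) = pi - 3 * pi / 7"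
        by (simp_all add: field_simps)
      show "sind 7 3 = sin (pi / 7)" "sind 7 2 = sin (3 * pi / 7)"
        unfolding sind_def w by (simp_all only: sin_pi_minus)
    qed
    show ?thesis unfolding e by (rule sin_monotone_2pi) (auto simp: field_simps)
  qed
  ultimately have "2 * G > 0" by (simp add: G_def)
  then have "2 * G = sqrt 7" using sq by (metis real_sqrt_unique less_imp_le)
  then show ?thesis by (simp add: G_def)
qed

text \<open>The trace zeta^k + zeta^(-k) of a 17th root of unity; the factor 2 keeps all product
  formulas integral.\<close>

definition c17 :: "nat \<Rightarrow> real" where "c17 k = 2 * cosd 17 k"

lemma c17_reflect: "c17 9 = c17 8" "c17 10 = c17 7" "c17 11 = c17 6" "c17 12 = c17 5"
  "c17 13 = c17 4" "c17 14 = c17 3" "c17 15 = c17 2" "c17 16 = c17 1" "c17 0 = 2"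
  unfolding c17_def
  using trigd_reflect(1)[of 17 9 8] trigd_reflect(1)[of 17 10 7] trigd_reflect(1)[of 17 11 6]
    trigd_reflect(1)[of 17 12 5] trigd_reflect(1)[of 17 13 4] trigd_reflect(1)[of 17 14 3]
    trigd_reflect(1)[of 17 15 2] trigd_reflect(1)[of 17 16 1] by (simp_all add: trigd_0)

lemma c17_mult: "k \<le> j \<Longrightarrow> c17 j * c17 k = c17 (j + k) + c17 (j - k)"
  using cosd_mult_cosd[of k j 17] by (simp add: c17_def)

text \<open>The quadratic residues modulo 17 are 1, 2, 4, 8 and their negatives, so this is a
  Gaussian period of degree 2; \<open>gauss_period'\<close> is its conjugate.\<close>

definition gauss_period :: "real" where "gauss_period = c17 1 + c17 2 + c17 4 + c17 8"
definition gauss_period' :: "real" where "gauss_period' = c17 3 + c17 5 + c17 6 + c17 7"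

text \<open>Linearises all products of the eight cosines, so that the polynomial identities below
  reduce to linear arithmetic.\<close>

lemma c17_products:
  "c17 1 * c17 1 = c17 2 + 2" "c17 2 * c17 2 = c17 4 + 2" "c17 4 * c17 4 = c17 8 + 2" "c17 8 * c17 8 = c17 1 + 2"
  "c17 2 * c17 1 = c17 3 + c17 1" "c17 3 * c17 1 = c17 4 + c17 2" "c17 4 * c17 1 = c17 5 + c17 3"
  "c17 5 * c17 1 = c17 6 + c17 4" "c17 6 * c17 1 = c17 7 + c17 5" "c17 7 * c17 1 = c17 8 + c17 6"
  "c17 8 * c17 1 = c17 8 + c17 7" "c17 3 * c17 2 = c17 5 + c17 1" "c17 4 * c17 2 = c17 6 + c17 2"
  "c17 5 * c17 2 = c17 7 + c17 3" "c17 6 * c17 2 = c17 8 + c17 4" "c17 7 * c17 2 = c17 8 + c17 5"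
  "c17 8 * c17 2 = c17 7 + c17 6" "c17 4 * c17 3 = c17 7 + c17 1" "c17 5 * c17 3 = c17 8 + c17 2"
  "c17 6 * c17 3 = c17 8 + c17 3" "c17 7 * c17 3 = c17 7 + c17 4" "c17 8 * c17 3 = c17 6 + c17 5"
  "c17 5 * c17 4 = c17 8 + c17 1" "c17 6 * c17 4 = c17 7 + c17 2" "c17 7 * c17 4 = c17 6 + c17 3"
  "c17 8 * c17 4 = c17 5 + c17 4" "c17 6 * c17 5 = c17 6 + c17 1" "c17 7 * c17 5 = c17 5 + c17 2"
  "c17 8 * c17 5 = c17 4 + c17 3" "c17 7 * c17 6 = c17 4 + c17 1" "c17 8 * c17 6 = c17 3 + c17 2"
  "c17 8 * c17 7 = c17 2 + c17 1"
  using c17_mult[of 1 1] c17_mult[of 2 2] c17_mult[of 4 4] c17_mult[of 8 8]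
    c17_mult[of 1 2] c17_mult[of 1 3] c17_mult[of 1 4] c17_mult[of 1 5] c17_mult[of 1 6] c17_mult[of 1 7] c17_mult[of 1 8]
    c17_mult[of 2 3] c17_mult[of 2 4] c17_mult[of 2 5] c17_mult[of 2 6] c17_mult[of 2 7] c17_mult[of 2 8]
    c17_mult[of 3 4] c17_mult[of 3 5] c17_mult[of 3 6] c17_mult[of 3 7] c17_mult[of 3 8]
    c17_mult[of 4 5] c17_mult[of 4 6] c17_mult[of 4 7] c17_mult[of 4 8]
    c17_mult[of 5 6] c17_mult[of 5 7] c17_mult[of 5 8] c17_mult[of 6 7] c17_mult[of 6 8] c17_mult[of 7 8]
  by (simp_all add: c17_reflect numeral_2_eq_2[symmetric])

lemma gauss_period_sum: "gauss_period + gauss_period' = -1"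
proof -
  have "(\<Sum>k<17. c17 k) = 0"
    using sum_cosd_zero[of 17] by (simp add: c17_def sum_distrib_left[symmetric])
  moreover have "{..<17::nat} = {0,1,2,3,4,5,6,7,8,9,10,11,12,13,14,15,16}" by (auto simp: less_Suc_eq numeral_eq_Suc)
  ultimately show ?thesis by (simp add: c17_reflect gauss_period_def gauss_period'_def)
qed

lemmas c17_products_sym = c17_products c17_products[THEN trans[OF mult.commute]]

lemma gauss_period_mult: "gauss_period * gauss_period' = -4"
proof -
  have "gauss_period * gauss_period' = 4 * (gauss_period + gauss_period')"
    unfolding gauss_period_def gauss_period'_def distrib_left distrib_right c17_products_sym by linarith
  then show ?thesis using gauss_period_sum by simp
qed

lemma gauss_period_eq: "gauss_period = (sqrt 17 - 1) / 2" "gauss_period' = (- sqrt 17 - 1) / 2"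
proof -
  have "(gauss_period - gauss_period')\<^sup>2 = (gauss_period + gauss_period')\<^sup>2 - 4 * (gauss_period * gauss_period')"
    by (simp add: power2_eq_square algebra_simps)
  then have sq: "(gauss_period - gauss_period')\<^sup>2 = 17" unfolding gauss_period_sum gauss_period_mult by simp
  \<comment> \<open>Crude estimates, 1 + 1 + 0 - 2 >= 0, suffice to decide which root of x^2 + x - 4
    each period is.\<close>
  have "c17 1 \<ge> 1" "c17 2 \<ge> 1" "c17 4 \<ge> 0" "c17 8 \<ge> -2"
  proof -
    have "cos (pi / 3) \<le> cosd 17 1" "cos (pi / 3) \<le> cosd 17 2" "cos (pi / 2) \<le> cosd 17 4"
      unfolding cosd_def by (rule cos_monotone_0_pi_le; simp add: field_simps)+
    then show "c17 1 \<ge> 1" "c17 2 \<ge> 1" "c17 4 \<ge> 0" by (simp_all add: c17_def cos_60)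
    show "c17 8 \<ge> -2" using cos_ge_minus_one[of "real 8 * (2 * pi / real 17)"] unfolding c17_def cosd_def by linarith
  qed
  then have "gauss_period \<ge> 0" by (simp add: gauss_period_def)
  then have "gauss_period - gauss_period' > 0" using gauss_period_sum by linarith
  then have "gauss_period - gauss_period' = sqrt 17" using sq by (metis real_sqrt_unique less_imp_le)
  then show "gauss_period = (sqrt 17 - 1) / 2" "gauss_period' = (- sqrt 17 - 1) / 2" using gauss_period_sum by (simp_all add: field_simps)
qed

lemma quartic_product:
  fixes x u v w z :: real
  shows "(x - u) * (x - v) * (x - w) * (x - z) = x ^ 4 - (u + v + w + z) * x ^ 3
     + (w * z + u * v + (u + v) * (w + z)) * x\<^sup>2 - ((u + v) * (w * z) + (w + z) * (u * v)) * x + (u * v) * (w * z)"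
  by (simp add: power2_eq_square power3_eq_cube power4_eq_xxxx algebra_simps)

text \<open>The minimal polynomial of \<open>c17 1\<close> over the field of sqrt 17: doubling
  permutes 1, 2, 4, 8 cyclically up to sign, so its coefficients depend on the period alone. It will
  be evaluated at 2 and at the square roots of 2.\<close>

lemma quartic_residues:
  "(x - c17 1) * (x - c17 2) * (x - c17 4) * (x - c17 8)
    = x ^ 4 - gauss_period * x ^ 3 - (2 + gauss_period) * x\<^sup>2 + (3 + 2 * gauss_period) * x - 1"
proof -
  have "c17 4 * c17 8 + c17 1 * c17 2 + (c17 1 + c17 2) * (c17 4 + c17 8) = - (2 + gauss_period)"
    using gauss_period_sum unfolding gauss_period_def gauss_period'_def distrib_left distrib_right c17_products_sym by linarith
  moreover have "(c17 1 + c17 2) * (c17 4 * c17 8) + (c17 4 + c17 8) * (c17 1 * c17 2) = - (3 + 2 * gauss_period)"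
    using gauss_period_sum unfolding gauss_period_def gauss_period'_def c17_products_sym distrib_left distrib_right by linarith
  moreover have "(c17 1 * c17 2) * (c17 4 * c17 8) = -1"
    using gauss_period_sum unfolding gauss_period_def gauss_period'_def c17_products_sym distrib_left distrib_right by linarith
  moreover have "c17 1 + c17 2 + c17 4 + c17 8 = gauss_period" by (simp only: gauss_period_def)
  ultimately show ?thesis unfolding quartic_product[of x "c17 1"] by (simp only:)
qed

lemma quartic_nonresidues:
  "(x - c17 3) * (x - c17 5) * (x - c17 6) * (x - c17 7)
    = x ^ 4 - gauss_period' * x ^ 3 - (2 + gauss_period') * x\<^sup>2 + (3 + 2 * gauss_period') * x - 1"
proof -
  have "c17 6 * c17 7 + c17 3 * c17 5 + (c17 3 + c17 5) * (c17 6 + c17 7) = - (2 + gauss_period')"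
    using gauss_period_sum unfolding gauss_period_def gauss_period'_def distrib_left distrib_right c17_products_sym by linarith
  moreover have "(c17 3 + c17 5) * (c17 6 * c17 7) + (c17 6 + c17 7) * (c17 3 * c17 5) = - (3 + 2 * gauss_period')"
    using gauss_period_sum unfolding gauss_period_def gauss_period'_def c17_products_sym distrib_left distrib_right by linarith
  moreover have "(c17 3 * c17 5) * (c17 6 * c17 7) = -1"
    using gauss_period_sum unfolding gauss_period_def gauss_period'_def c17_products_sym distrib_left distrib_right by linarith
  moreover have "c17 3 + c17 5 + c17 6 + c17 7 = gauss_period'" by (simp only: gauss_period'_def)
  ultimately show ?thesis unfolding quartic_product[of x "c17 3"] by (simp only:)
qed

text \<open>The limits s -> 1+ of the Dirichlet series and x -> 1- of the power series are both the
  conditionally convergent series L, and the latter is known in closed form through g.\<close>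

lemma dirichlet_L_tendsto:
  fixes f :: "nat \<Rightarrow> int"
  assumes per: "\<And>n. f (n + d) = f n" and zero: "(\<Sum>k<d. f (Suc k)) = 0" and le: "\<And>n. \<bar>f n\<bar> \<le> 1" and d: "d > 0"
    and g: "\<And>x. 0 \<le> x \<Longrightarrow> x < 1 \<Longrightarrow> (\<lambda>k. real_of_int (f (Suc k)) * (x ^ Suc k / real (Suc k))) sums g x"
    and V: "(g \<longlongrightarrow> V) (at_left 1)"
  shows "(dirichlet_L f \<longlongrightarrow> V) (at_right 1)"
proof -
  define u where "u k = real_of_int (f (Suc k))" for k
  define L where "L = (\<Sum>k. u k * (1 / real (Suc k)))"
  have bd: "\<bar>\<Sum>k<n. u k\<bar> \<le> real d" for n
  proof (rule periodic_sum_bounded)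
    show "u (n + d) = u n" for n using per[of "Suc n"] by (simp add: u_def)
    show "(\<Sum>k<d. u k) = 0" using zero by (simp add: u_def flip: of_int_sum)
    show "\<bar>u n\<bar> \<le> 1" for n using le[of "Suc n"] by (simp add: u_def flip: of_int_abs)
  qed (rule d)
  have "((\<lambda>s. \<Sum>k. u k * (real (Suc k) powr - s)) \<longlongrightarrow> L) (at_right 1)"
    unfolding L_def
  proof (rule abel_limit[OF bd])
    show "\<forall>\<^sub>F s in at_right 1. \<forall>k. real (Suc (Suc k)) powr - s \<le> real (Suc k) powr - s
        \<and> 0 \<le> real (Suc k) powr - s \<and> real (Suc k) powr - s \<le> 1 / real (Suc k)"
      using eventually_at_right_less[of 1]
    proof eventually_elim
      case (elim s)
      have "real (Suc (Suc k)) powr - s \<le> real (Suc k) powr - s" for k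
        using elim by (intro powr_mono2') auto
      moreover have "real (Suc k) powr - s \<le> 1 / real (Suc k)" for k
      proof -
        have "real (Suc k) powr - s \<le> real (Suc k) powr - 1" using elim by (intro powr_mono) auto
        then show ?thesis by (simp add: powr_minus_divide)
      qed
      ultimately show ?case by auto
    qed
    show "((\<lambda>s. real (Suc k) powr - s) \<longlongrightarrow> 1 / real (Suc k)) (at_right 1)" for k
    proof -
      have "((\<lambda>s. real (Suc k) powr - s) \<longlongrightarrow> real (Suc k) powr - 1) (at_right 1)"
        by (intro tendsto_intros) auto
      then show ?thesis by (simp add: powr_minus_divide)
    qed
  qed
  then have "(dirichlet_L f \<longlongrightarrow> L) (at_right 1)" by (simp add: dirichlet_L_def[abs_def] u_def)
  moreover have "L = V"
  proof (rule tendsto_unique[OF _ _ V])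
    have ev: "\<forall>\<^sub>F x in at_left (1::real). 0 < x \<and> x < 1"
      using eventually_at_left_real[of 0 "1::real"] by simp
    have "((\<lambda>x. \<Sum>k. u k * (x ^ Suc k / real (Suc k))) \<longlongrightarrow> L) (at_left 1)"
      unfolding L_def
    proof (rule abel_limit[OF bd])
      show "\<forall>\<^sub>F x in at_left 1. \<forall>k. x ^ Suc (Suc k) / real (Suc (Suc k)) \<le> x ^ Suc k / real (Suc k)
          \<and> 0 \<le> x ^ Suc k / real (Suc k) \<and> x ^ Suc k / real (Suc k) \<le> 1 / real (Suc k)"
        using ev
      proof eventually_elim
        case (elim x)
        have "x ^ Suc (Suc k) / real (Suc (Suc k)) \<le> x ^ Suc k / real (Suc k)" for k
          using elim by (intro frac_le power_decreasing) auto
        moreover have "x ^ Suc k / real (Suc k) \<le> 1 / real (Suc k)" for k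
          using elim by (intro divide_right_mono power_le_one) auto
        ultimately show ?case using elim by auto
      qed
      show "((\<lambda>x. x ^ Suc k / real (Suc k)) \<longlongrightarrow> 1 / real (Suc k)) (at_left 1)" for k
      proof -
        have "((\<lambda>x. x ^ Suc k / real (Suc k)) \<longlongrightarrow> 1 ^ Suc k / real (Suc k)) (at_left 1)"
          by (intro tendsto_intros) auto
        then show ?thesis by simp
      qed
    qed
    then show "(g \<longlongrightarrow> L) (at_left 1)"
    proof (rule Lim_transform_eventually)
      show "\<forall>\<^sub>F x in at_left 1. (\<Sum>k. u k * (x ^ Suc k / real (Suc k))) = g x"
        using ev by eventually_elim (use g in \<open>simp add: u_def sums_iff\<close>)
    qed
  qed auto
  ultimately show ?thesis by simp
qed

lemma trigd_mult_mod:
  assumes "d > 0"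
  shows "cosd d (a * n) = cosd d ((a * (n mod d)) mod d)" "sind d (a * n) = sind d ((a * (n mod d)) mod d)"
  using trigd_mod[OF assms, of "a * n"] by (simp_all add: mod_mult_right_eq)

lemma trigd_arg: "cosd d (a * n) = cos (real n * (real a * (2 * pi / real d)))"
  "sind d (a * n) = sin (real n * (real a * (2 * pi / real d)))"
  by (simp_all add: cosd_def sind_def mult_ac)

text \<open>Finite Fourier expansion of an odd character: residues k and 7 - k combine, which gives
  the factor 2 and turns the residue 4 into minus the term at 3.\<close>

lemma chi7_gauss: "real_of_int (chi7 n) = 2 / sqrt 7 * (sind 7 (1 * n) + sind 7 (2 * n) - sind 7 (3 * n))"
proof -
  define r where "r = n mod 7"
  have "r < 7" by (simp add: r_def)
  then have "r \<in> {0,1,2,3,4,5,6}" by auto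
  moreover have s3: "sind 7 3 = sind 7 1 + sind 7 2 - sqrt 7 / 2" using gauss_sum_7 by simp
  ultimately have "sqrt 7 / 2 * real_of_int (chi7 r) = sind 7 ((1 * r) mod 7) + sind 7 ((2 * r) mod 7) - sind 7 ((3 * r) mod 7)"
    by (elim insertE emptyE) (simp_all add: chi7_def cosd_sind7 trigd_0 s3)
  then have "sqrt 7 / 2 * real_of_int (chi7 n) = sind 7 (1 * n) + sind 7 (2 * n) - sind 7 (3 * n)"
    unfolding r_def chi7_mod trigd_mult_mod[of 7 _ n, simplified, symmetric] .
  then show ?thesis by (simp add: field_simps)
qed

lemma chi8_gauss: "real_of_int (chi8 n) = (cosd 8 (1 * n) - cosd 8 (3 * n)) / sqrt 2"
proof -
  define r where "r = n mod 8"
  have "r < 8" by (simp add: r_def)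
  then have "r \<in> {0,1,2,3,4,5,6,7}" by auto
  then have "sqrt 2 * real_of_int (chi8 r) = cosd 8 ((1 * r) mod 8) - cosd 8 ((3 * r) mod 8)"
    by (elim insertE emptyE) (simp_all add: chi8_def cosd8 cosd8[unfolded One_nat_def] trigd_0)
  then have "sqrt 2 * real_of_int (chi8 n) = cosd 8 (1 * n) - cosd 8 (3 * n)"
    unfolding r_def chi8_mod trigd_mult_mod[of 8 _ n, simplified, symmetric] .
  then show ?thesis by (simp add: field_simps)
qed

lemma chi17_gauss: "real_of_int (chi17 n) = 2 / sqrt 17 * (cosd 17 (1 * n) + cosd 17 (2 * n) + cosd 17 (4 * n) + cosd 17 (8 * n)
    - cosd 17 (3 * n) - cosd 17 (5 * n) - cosd 17 (6 * n) - cosd 17 (7 * n))"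
proof -
  define r where "r = n mod 17"
  have "r < 17" by (simp add: r_def)
  then have "r \<in> {0,1,2,3,4,5,6,7,8,9,10,11,12,13,14,15,16}" by simp presburger
  moreover have "c17 1 + c17 2 + c17 4 + c17 8 - c17 3 - c17 5 - c17 6 - c17 7 = sqrt 17"
    using gauss_period_eq by (simp add: gauss_period_def gauss_period'_def)
  then have s8: "c17 8 = sqrt 17 - c17 1 - c17 2 - c17 4 + c17 3 + c17 5 + c17 6 + c17 7" by linarith
  ultimately have "sqrt 17 * real_of_int (chi17 r) = c17 ((1 * r) mod 17) + c17 ((2 * r) mod 17) + c17 ((4 * r) mod 17) + c17 ((8 * r) mod 17)
     - c17 ((3 * r) mod 17) - c17 ((5 * r) mod 17) - c17 ((6 * r) mod 17) - c17 ((7 * r) mod 17)"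
    by (elim insertE emptyE) (simp_all add: chi17_def c17_reflect s8)
  then have "sqrt 17 * real_of_int (chi17 n) = c17 (1 * n) + c17 (2 * n) + c17 (4 * n) + c17 (8 * n)
     - c17 (3 * n) - c17 (5 * n) - c17 (6 * n) - c17 (7 * n)"
    unfolding r_def chi17_mod c17_def trigd_mult_mod[of 17 _ n, simplified, symmetric] .
  then show ?thesis unfolding c17_def by (simp add: field_simps)
qed

definition ang :: "nat \<Rightarrow> nat \<Rightarrow> real" where "ang d a = real a * (2 * pi / real d)"

section \<open>Limits of the four L-series at 1\<close>

lemma chi_periodic: "chi7 (n + 7) = chi7 n" "chi8 (n + 8) = chi8 n" "chi17 (n + 17) = chi17 n"
  "chi56 (n + 56) = chi56 n" "chi136 (n + 136) = chi136 n"
proof -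
  show "chi7 (n + 7) = chi7 n" "chi8 (n + 8) = chi8 n" "chi17 (n + 17) = chi17 n"
    by (simp_all add: chi7_def chi8_def chi17_def)
  have "(n + 56) mod 8 = n mod 8" "(n + 56) mod 7 = n mod 7" "(n + 136) mod 8 = n mod 8" "(n + 136) mod 17 = n mod 17"
    using mod_mult_self1[of n 7 8] mod_mult_self1[of n 8 7] mod_mult_self1[of n 17 8] mod_mult_self1[of n 8 17]
    by simp_all
  then show "chi56 (n + 56) = chi56 n" "chi136 (n + 136) = chi136 n"
    unfolding chi56_def chi136_def by (metis chi7_mod chi8_mod, metis chi8_mod chi17_mod)
qed

text \<open>Since m is odd, the progression with step m runs through all residues modulo 8.\<close>

lemma chi8_step_sum:
  assumes "m \<in> {7, 17}"
  shows "(\<Sum>i<8. chi8 (i * m + j)) = 0"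
proof -
  define r where "r = j mod 8"
  have e: "chi8 (i * m + j) = chi8 (i * m + r)" for i
    unfolding r_def by (metis chi8_mod mod_add_right_eq)
  have "r < 8" by (simp add: r_def)
  then have r: "r \<in> {0,1,2,3,4,5,6,7}" by auto
  have "{..<8::nat} = {0,1,2,3,4,5,6,7}" by auto
  then have "(\<Sum>i<8. chi8 (i * m + r)) = chi8 r + chi8 (m + r) + chi8 (2 * m + r) + chi8 (3 * m + r)
     + chi8 (4 * m + r) + chi8 (5 * m + r) + chi8 (6 * m + r) + chi8 (7 * m + r)" by simp
  also have "\<dots> = 0"
    using r assms by (elim insertE emptyE) (simp_all add: chi8_def)
  finally show ?thesis unfolding e .
qed

lemma chi_sum_zero: "(\<Sum>k<7. chi7 (Suc k)) = 0" "(\<Sum>k<17. chi17 (Suc k)) = 0"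
  "(\<Sum>k<56. chi56 (Suc k)) = 0" "(\<Sum>k<136. chi136 (Suc k)) = 0"
proof -
  have "{..<7::nat} = {0,1,2,3,4,5,6}" by auto
  then show "(\<Sum>k<7. chi7 (Suc k)) = 0" by (simp add: chi7_def)
  have "{..<17::nat} = {0,1,2,3,4,5,6,7,8,9,10,11,12,13,14,15,16}" by (auto simp: less_Suc_eq numeral_eq_Suc)
  then show "(\<Sum>k<17. chi17 (Suc k)) = 0" by (simp add: chi17_def)
  \<comment> \<open>Cut the period 8 m into eight blocks of length m: f repeats in every block, and
    for a fixed position the chi8 values cancel across the blocks.\<close>
  have split: "(\<Sum>k<8 * m. chi8 (Suc k) * f (Suc k)) = 0"
    if m: "m \<in> {7, 17}" and f: "\<And>i j. f (i * m + j) = f j" for m and f :: "nat \<Rightarrow> int"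
  proof -
    have "(\<Sum>k<8 * m. chi8 (Suc k) * f (Suc k)) = (\<Sum>i<8. \<Sum>k\<in>{i * m..<i * m + m}. chi8 (Suc k) * f (Suc k))"
      by (rule sum.nat_group[symmetric])
    also have "\<dots> = (\<Sum>i<8. \<Sum>j<m. chi8 (i * m + Suc j) * f (Suc j))"
    proof (rule sum.cong[OF refl])
      fix i
      have "(\<Sum>k\<in>{i * m..<i * m + m}. chi8 (Suc k) * f (Suc k)) = (\<Sum>j\<in>{0..<m}. chi8 (Suc (j + i * m)) * f (Suc (j + i * m)))"
        using sum.shift_bounds_nat_ivl[of "\<lambda>k. chi8 (Suc k) * f (Suc k)" 0 "i * m" m] by (simp add: add.commute)
      also have "\<dots> = (\<Sum>j<m. chi8 (i * m + Suc j) * f (Suc j))"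
      proof (rule sum.cong)
        fix j
        have "Suc (j + i * m) = i * m + Suc j" by simp
        then show "chi8 (Suc (j + i * m)) * f (Suc (j + i * m)) = chi8 (i * m + Suc j) * f (Suc j)"
          by (simp only: f)
      qed auto
      finally show "(\<Sum>k\<in>{i * m..<i * m + m}. chi8 (Suc k) * f (Suc k)) = (\<Sum>j<m. chi8 (i * m + Suc j) * f (Suc j))" .
    qed
    also have "\<dots> = (\<Sum>j<m. (\<Sum>i<8. chi8 (i * m + Suc j)) * f (Suc j))"
      by (subst sum.swap) (simp add: sum_distrib_right)
    also have "\<dots> = 0" by (simp only: chi8_step_sum[OF m] mult_zero_left sum.neutral_const)
    finally show ?thesis .
  qed
  have "chi7 (i * 7 + j) = chi7 j" "chi17 (i * 17 + j) = chi17 j" for i j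
    by (simp_all add: chi7_def chi17_def)
  then show "(\<Sum>k<56. chi56 (Suc k)) = 0" "(\<Sum>k<136. chi136 (Suc k)) = 0"
    using split[of 7 chi7] split[of 17 chi17] by (simp_all add: chi56_def chi136_def)
qed

lemma L_chi7: "(dirichlet_L chi7 \<longlongrightarrow> pi / sqrt 7) (at_right 1)"
proof (rule dirichlet_L_tendsto[where d = 7 and g = "\<lambda>x. 2 / sqrt 7 * (sin_log (ang 7 1) x + sin_log (ang 7 2) x - sin_log (ang 7 3) x)"])
  fix x :: real assume x: "0 \<le> x" "x < 1"
  have "(\<lambda>k. 2 / sqrt 7 * (sin (real (Suc k) * ang 7 1) * (x ^ Suc k / real (Suc k)) + sin (real (Suc k) * ang 7 2) * (x ^ Suc k / real (Suc k))
      - sin (real (Suc k) * ang 7 3) * (x ^ Suc k / real (Suc k)))) sums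
      (2 / sqrt 7 * (sin_log (ang 7 1) x + sin_log (ang 7 2) x - sin_log (ang 7 3) x))"
    by (intro sums_mult sums_add sums_diff trig_log_series x)
  moreover have "real_of_int (chi7 (Suc k)) * y = 2 / sqrt 7 * (sin (real (Suc k) * ang 7 1) * y + sin (real (Suc k) * ang 7 2) * y
      - sin (real (Suc k) * ang 7 3) * y)" for k y
    unfolding chi7_gauss trigd_arg ang_def by (simp only: mult.assoc left_diff_distrib distrib_right)
  ultimately show "(\<lambda>k. real_of_int (chi7 (Suc k)) * (x ^ Suc k / real (Suc k))) sums
      (2 / sqrt 7 * (sin_log (ang 7 1) x + sin_log (ang 7 2) x - sin_log (ang 7 3) x))" by (simp only:)
next
  \<comment> \<open>As 1 + 2 - 3 = 0 the angles cancel, leaving pi / 2 from the sawtooth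
    values.\<close>
  have "((\<lambda>x. 2 / sqrt 7 * (sin_log (ang 7 1) x + sin_log (ang 7 2) x - sin_log (ang 7 3) x)) \<longlongrightarrow>
      2 / sqrt 7 * ((pi - ang 7 1) / 2 + (pi - ang 7 2) / 2 - (pi - ang 7 3) / 2)) (at_left 1)"
    by (intro tendsto_intros sin_log_tendsto) (auto simp: ang_def field_simps)
  then show "((\<lambda>x. 2 / sqrt 7 * (sin_log (ang 7 1) x + sin_log (ang 7 2) x - sin_log (ang 7 3) x)) \<longlongrightarrow> pi / sqrt 7) (at_left 1)"
    by (simp add: ang_def field_simps)
qed (use chi_periodic chi_sum_zero chi_bounds in auto)

lemma sin_log_period: "sin_log (\<theta> + 2 * pi) x = sin_log \<theta> x"
proof -
  have "cis (\<theta> + 2 * pi) = cis \<theta>" by (simp add: complex_eq_iff)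
  then show ?thesis by (simp add: sin_log_def)
qed

text \<open>The sine series twisted by chi8: expanding chi8 in cosines shifts the angle by pi / 4
  and 3 pi / 4 in both directions. This replaces Gauss sums modulo 56.\<close>

definition chi8_sin :: "real \<Rightarrow> real \<Rightarrow> real" where
  "chi8_sin \<beta> x = (sin_log (\<beta> + pi / 4) x + sin_log (\<beta> - pi / 4) x - sin_log (\<beta> + 3 * pi / 4) x - sin_log (\<beta> - 3 * pi / 4) x) / (2 * sqrt 2)"

definition chi8_cos :: "real \<Rightarrow> real \<Rightarrow> real" where
  "chi8_cos \<beta> x = (cos_log (\<beta> + pi / 4) x + cos_log (\<beta> - pi / 4) x - cos_log (\<beta> + 3 * pi / 4) x - cos_log (\<beta> - 3 * pi / 4) x) / (2 * sqrt 2)"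

lemma chi8_product:
  "real_of_int (chi8 n) * sin (real n * \<beta>) =
    (sin (real n * (\<beta> + pi / 4)) + sin (real n * (\<beta> - pi / 4)) - sin (real n * (\<beta> + 3 * pi / 4)) - sin (real n * (\<beta> - 3 * pi / 4))) / (2 * sqrt 2)"
  "real_of_int (chi8 n) * cos (real n * \<beta>) =
    (cos (real n * (\<beta> + pi / 4)) + cos (real n * (\<beta> - pi / 4)) - cos (real n * (\<beta> + 3 * pi / 4)) - cos (real n * (\<beta> - 3 * pi / 4))) / (2 * sqrt 2)"
proof -
  have c: "real_of_int (chi8 n) = (cos (real n * (pi / 4)) - cos (real n * (3 * pi / 4))) / sqrt 2"
    unfolding chi8_gauss trigd_arg by simp
  have e: "real n * (\<beta> + t) = real n * \<beta> + real n * t" "real n * (\<beta> - t) = real n * \<beta> - real n * t" for t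
    by (simp_all add: algebra_simps)
  show "real_of_int (chi8 n) * sin (real n * \<beta>) =
    (sin (real n * (\<beta> + pi / 4)) + sin (real n * (\<beta> - pi / 4)) - sin (real n * (\<beta> + 3 * pi / 4)) - sin (real n * (\<beta> - 3 * pi / 4))) / (2 * sqrt 2)"
    unfolding c e sin_add sin_diff by (simp add: field_simps)
  show "real_of_int (chi8 n) * cos (real n * \<beta>) =
    (cos (real n * (\<beta> + pi / 4)) + cos (real n * (\<beta> - pi / 4)) - cos (real n * (\<beta> + 3 * pi / 4)) - cos (real n * (\<beta> - 3 * pi / 4))) / (2 * sqrt 2)"
    unfolding c e cos_add cos_diff by (simp add: field_simps)
qed

lemma chi8_series:
  assumes x: "0 \<le> x" "x < 1"
  shows "(\<lambda>k. real_of_int (chi8 (Suc k)) * sin (real (Suc k) * \<beta>) * (x ^ Suc k / real (Suc k))) sums chi8_sin \<beta> x"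
    "(\<lambda>k. real_of_int (chi8 (Suc k)) * cos (real (Suc k) * \<beta>) * (x ^ Suc k / real (Suc k))) sums chi8_cos \<beta> x"
proof -
  have e: "(p + q - r - s) / t * y = (p * y + q * y - r * y - s * y) / t" for p q r s t y :: real
    by (simp add: algebra_simps)
  show "(\<lambda>k. real_of_int (chi8 (Suc k)) * sin (real (Suc k) * \<beta>) * (x ^ Suc k / real (Suc k))) sums chi8_sin \<beta> x"
    unfolding chi8_product chi8_sin_def e by (intro sums_divide sums_add sums_diff trig_log_series x)
  show "(\<lambda>k. real_of_int (chi8 (Suc k)) * cos (real (Suc k) * \<beta>) * (x ^ Suc k / real (Suc k))) sums chi8_cos \<beta> x"
    unfolding chi8_product chi8_cos_def e by (intro sums_divide sums_add sums_diff trig_log_series x)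
qed

text \<open>The slopes of the four sawtooth functions cancel, so the limit is a step function; its
  jump at 3 pi / 4 is where the last angle changes sign.\<close>

lemma chi8_sin_tendsto:
  assumes "pi / 4 < \<beta>" "\<beta> < pi" "\<beta> \<noteq> 3 * pi / 4"
  shows "(chi8_sin \<beta> \<longlongrightarrow> (if \<beta> < 3 * pi / 4 then pi / (2 * sqrt 2) else 0)) (at_left 1)"
proof -
  have p: "pi > 0" by simp
  \<comment> \<open>Only this angle can leave the interval from 0 to 2 pi; a negative one is first
    moved by a full period.\<close>
  have "(sin_log (\<beta> - 3 * pi / 4) \<longlongrightarrow> (if \<beta> < 3 * pi / 4 then (pi - (\<beta> - 3 * pi / 4 + 2 * pi)) / 2 else (pi - (\<beta> - 3 * pi / 4)) / 2)) (at_left 1)"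
  proof (cases "\<beta> < 3 * pi / 4")
    case True
    have "(sin_log (\<beta> - 3 * pi / 4 + 2 * pi) \<longlongrightarrow> (pi - (\<beta> - 3 * pi / 4 + 2 * pi)) / 2) (at_left 1)"
      by (rule sin_log_tendsto) (use assms True p in linarith)+
    moreover have "sin_log (\<beta> - 3 * pi / 4 + 2 * pi) = sin_log (\<beta> - 3 * pi / 4)"
      by (rule ext) (rule sin_log_period)
    ultimately show ?thesis using True by (simp only: if_True)
  next
    case False
    then have "(sin_log (\<beta> - 3 * pi / 4) \<longlongrightarrow> (pi - (\<beta> - 3 * pi / 4)) / 2) (at_left 1)"
      by (intro sin_log_tendsto) (use assms p in linarith)+
    then show ?thesis using False by simp
  qed
  moreover have "(sin_log (\<beta> + pi / 4) \<longlongrightarrow> (pi - (\<beta> + pi / 4)) / 2) (at_left 1)"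
    "(sin_log (\<beta> - pi / 4) \<longlongrightarrow> (pi - (\<beta> - pi / 4)) / 2) (at_left 1)"
    "(sin_log (\<beta> + 3 * pi / 4) \<longlongrightarrow> (pi - (\<beta> + 3 * pi / 4)) / 2) (at_left 1)"
    by (rule sin_log_tendsto; use assms p in linarith)+
  ultimately have "(chi8_sin \<beta> \<longlongrightarrow> ((pi - (\<beta> + pi / 4)) / 2 + (pi - (\<beta> - pi / 4)) / 2 - (pi - (\<beta> + 3 * pi / 4)) / 2
      - (if \<beta> < 3 * pi / 4 then (pi - (\<beta> - 3 * pi / 4 + 2 * pi)) / 2 else (pi - (\<beta> - 3 * pi / 4)) / 2)) / (2 * sqrt 2)) (at_left 1)"
    unfolding chi8_sin_def[abs_def] by (intro tendsto_intros) auto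
  moreover have "((pi - (\<beta> + pi / 4)) / 2 + (pi - (\<beta> - pi / 4)) / 2 - (pi - (\<beta> + 3 * pi / 4)) / 2
      - (if \<beta> < 3 * pi / 4 then (pi - (\<beta> - 3 * pi / 4 + 2 * pi)) / 2 else (pi - (\<beta> - 3 * pi / 4)) / 2)) / (2 * sqrt 2)
    = (if \<beta> < 3 * pi / 4 then pi / (2 * sqrt 2) else 0)"
    by (auto simp: field_simps)
  ultimately show ?thesis by simp
qed

lemma L_chi56: "(dirichlet_L chi56 \<longlongrightarrow> 2 * pi / sqrt 14) (at_right 1)"
proof (rule dirichlet_L_tendsto[where d = 56 and g = "\<lambda>x. 2 / sqrt 7 * (chi8_sin (ang 7 1) x + chi8_sin (ang 7 2) x - chi8_sin (ang 7 3) x)"])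
  fix x :: real assume x: "0 \<le> x" "x < 1"
  have "(\<lambda>k. 2 / sqrt 7 * (real_of_int (chi8 (Suc k)) * sin (real (Suc k) * ang 7 1) * (x ^ Suc k / real (Suc k))
      + real_of_int (chi8 (Suc k)) * sin (real (Suc k) * ang 7 2) * (x ^ Suc k / real (Suc k))
      - real_of_int (chi8 (Suc k)) * sin (real (Suc k) * ang 7 3) * (x ^ Suc k / real (Suc k)))) sums
      (2 / sqrt 7 * (chi8_sin (ang 7 1) x + chi8_sin (ang 7 2) x - chi8_sin (ang 7 3) x))"
    by (intro sums_mult sums_add sums_diff chi8_series x)
  moreover have "real_of_int (chi56 (Suc k)) * y = 2 / sqrt 7 * (real_of_int (chi8 (Suc k)) * sin (real (Suc k) * ang 7 1) * y
      + real_of_int (chi8 (Suc k)) * sin (real (Suc k) * ang 7 2) * y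
      - real_of_int (chi8 (Suc k)) * sin (real (Suc k) * ang 7 3) * y)" for k y
    unfolding chi56_def of_int_mult chi7_gauss trigd_arg ang_def by (simp only: mult_ac right_diff_distrib distrib_left)
  ultimately show "(\<lambda>k. real_of_int (chi56 (Suc k)) * (x ^ Suc k / real (Suc k))) sums
      (2 / sqrt 7 * (chi8_sin (ang 7 1) x + chi8_sin (ang 7 2) x - chi8_sin (ang 7 3) x))" by (simp only:)
next
  \<comment> \<open>Of 2 pi / 7, 4 pi / 7 and 6 pi / 7 only the last lies beyond the jump at 3 pi /
    4.\<close>
  have "(chi8_sin (ang 7 1) \<longlongrightarrow> (if ang 7 1 < 3 * pi / 4 then pi / (2 * sqrt 2) else 0)) (at_left 1)"
    "(chi8_sin (ang 7 2) \<longlongrightarrow> (if ang 7 2 < 3 * pi / 4 then pi / (2 * sqrt 2) else 0)) (at_left 1)"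
    "(chi8_sin (ang 7 3) \<longlongrightarrow> (if ang 7 3 < 3 * pi / 4 then pi / (2 * sqrt 2) else 0)) (at_left 1)"
    by (rule chi8_sin_tendsto; simp add: ang_def field_simps)+
  then have "(chi8_sin (ang 7 1) \<longlongrightarrow> pi / (2 * sqrt 2)) (at_left 1)" "(chi8_sin (ang 7 2) \<longlongrightarrow> pi / (2 * sqrt 2)) (at_left 1)"
    "(chi8_sin (ang 7 3) \<longlongrightarrow> 0) (at_left 1)"
    by (simp_all add: ang_def field_simps)
  then have "((\<lambda>x. 2 / sqrt 7 * (chi8_sin (ang 7 1) x + chi8_sin (ang 7 2) x - chi8_sin (ang 7 3) x)) \<longlongrightarrow>
      2 / sqrt 7 * (pi / (2 * sqrt 2) + pi / (2 * sqrt 2) - 0)) (at_left 1)"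
    by (intro tendsto_intros)
  moreover have "2 / sqrt 7 * (pi / (2 * sqrt 2) + pi / (2 * sqrt 2) - 0) = 2 * pi / sqrt 14"
  proof -
    have "sqrt 14 = sqrt 7 * sqrt 2" by (simp flip: real_sqrt_mult)
    then show ?thesis by (simp add: field_simps)
  qed
  ultimately show "((\<lambda>x. 2 / sqrt 7 * (chi8_sin (ang 7 1) x + chi8_sin (ang 7 2) x - chi8_sin (ang 7 3) x)) \<longlongrightarrow> 2 * pi / sqrt 14) (at_left 1)"
    by simp
qed (use chi_periodic chi_sum_zero chi_bounds in auto)

lemma sqrt_17_gt: "4 < sqrt 17"
  by (rule real_less_rsqrt) simp

lemma sqrt_17_lt: "sqrt 17 < 3 * sqrt 2"
  by (rule real_less_lsqrt[THEN less_le_trans[OF _ eq_refl]]) (auto simp: power_mult_distrib)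

text \<open>Here 2 - c17 k is the squared modulus of 1 - zeta^k. The quotient of the two products is
  the square of the unit 4 + sqrt 17.\<close>

lemma quartics_at_2:
  "(2 - c17 1) * (2 - c17 2) * (2 - c17 4) * (2 - c17 8) = sqrt 17 * (sqrt 17 - 4)"
  "(2 - c17 3) * (2 - c17 5) * (2 - c17 6) * (2 - c17 7) = sqrt 17 * (sqrt 17 + 4)"
  unfolding quartic_residues quartic_nonresidues gauss_period_eq by (simp_all add: field_simps)

lemma sqrt_2_powers: "sqrt 2 ^ 3 = 2 * sqrt 2" "sqrt 2 ^ 4 = 4" "(- sqrt 2) ^ 3 = - (2 * sqrt 2)" "(- sqrt 2) ^ 4 = 4"
  by (simp_all add: power3_eq_cube power4_eq_xxxx)

text \<open>The points are 2 cos(pi / 4) and 2 cos(3 pi / 4), coming from the twist by chi8. Up to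
  sign all four values are 3 sqrt 2 + sqrt 17 or its inverse.\<close>

lemma quartics_at_sqrt_2:
  "(sqrt 2 - c17 1) * (sqrt 2 - c17 2) * (sqrt 2 - c17 4) * (sqrt 2 - c17 8) = 3 * sqrt 2 - sqrt 17"
  "(sqrt 2 - c17 3) * (sqrt 2 - c17 5) * (sqrt 2 - c17 6) * (sqrt 2 - c17 7) = 3 * sqrt 2 + sqrt 17"
  "(- sqrt 2 - c17 1) * (- sqrt 2 - c17 2) * (- sqrt 2 - c17 4) * (- sqrt 2 - c17 8) = - (3 * sqrt 2 + sqrt 17)"
  "(- sqrt 2 - c17 3) * (- sqrt 2 - c17 5) * (- sqrt 2 - c17 6) * (- sqrt 2 - c17 7) = - (3 * sqrt 2 - sqrt 17)"
  unfolding quartic_residues quartic_nonresidues gauss_period_eq sqrt_2_powers by (simp_all add: field_simps)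

lemma cos_ang_17: "2 * cos (ang 17 a) = c17 a"
  by (simp add: ang_def c17_def cosd_def)

lemma ln_prod4:
  fixes p q r s :: real
  assumes "p > 0" "q > 0" "r > 0" "s > 0"
  shows "ln p + ln q + ln r + ln s = ln (p * q * r * s)"
  using assms by (simp add: ln_mult)

text \<open>The Fourier expansion of chi17 applied to a family of series indexed by an angle;
  \<open>cos_log\<close> gives L(chi17), \<open>chi8_cos\<close> gives L(chi136).\<close>

definition chi17_comb :: "(real \<Rightarrow> real \<Rightarrow> real) \<Rightarrow> real \<Rightarrow> real" where
  "chi17_comb g x = 2 / sqrt 17 * (g (ang 17 1) x + g (ang 17 2) x + g (ang 17 4) x + g (ang 17 8) x
     - g (ang 17 3) x - g (ang 17 5) x - g (ang 17 6) x - g (ang 17 7) x)"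

lemma chi17_comb_sums:
  assumes "\<And>a. (\<lambda>k. w k * cos (real (Suc k) * ang 17 a) * y k) sums g (ang 17 a) x"
  shows "(\<lambda>k. w k * real_of_int (chi17 (Suc k)) * y k) sums chi17_comb g x"
proof -
  have "(\<lambda>k. 2 / sqrt 17 * (w k * cos (real (Suc k) * ang 17 1) * y k + w k * cos (real (Suc k) * ang 17 2) * y k
      + w k * cos (real (Suc k) * ang 17 4) * y k + w k * cos (real (Suc k) * ang 17 8) * y k
      - w k * cos (real (Suc k) * ang 17 3) * y k - w k * cos (real (Suc k) * ang 17 5) * y k
      - w k * cos (real (Suc k) * ang 17 6) * y k - w k * cos (real (Suc k) * ang 17 7) * y k)) sums chi17_comb g x"
    unfolding chi17_comb_def by (intro sums_mult sums_add sums_diff assms)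
  moreover have "w k * real_of_int (chi17 (Suc k)) * y k =
      2 / sqrt 17 * (w k * cos (real (Suc k) * ang 17 1) * y k + w k * cos (real (Suc k) * ang 17 2) * y k
      + w k * cos (real (Suc k) * ang 17 4) * y k + w k * cos (real (Suc k) * ang 17 8) * y k
      - w k * cos (real (Suc k) * ang 17 3) * y k - w k * cos (real (Suc k) * ang 17 5) * y k
      - w k * cos (real (Suc k) * ang 17 6) * y k - w k * cos (real (Suc k) * ang 17 7) * y k)" for k
    unfolding chi17_gauss trigd_arg ang_def by (simp only: mult_ac right_diff_distrib distrib_left)
  ultimately show ?thesis by (simp only:)
qed

lemma chi17_comb_tendsto:
  assumes "\<And>a. a \<in> {1..8} \<Longrightarrow> (g (ang 17 a) \<longlongrightarrow> v a) F"
  shows "(chi17_comb g \<longlongrightarrow> 2 / sqrt 17 * (v 1 + v 2 + v 4 + v 8 - v 3 - v 5 - v 6 - v 7)) F"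
  unfolding chi17_comb_def[abs_def] by (intro tendsto_intros assms) auto

lemma L_chi17: "(dirichlet_L chi17 \<longlongrightarrow> 2 * ln (4 + sqrt 17) / sqrt 17) (at_right 1)"
proof (rule dirichlet_L_tendsto[where d = 17 and g = "chi17_comb cos_log"])
  fix x :: real assume "0 \<le> x" "x < 1"
  then show "(\<lambda>k. real_of_int (chi17 (Suc k)) * (x ^ Suc k / real (Suc k))) sums chi17_comb cos_log x"
    using chi17_comb_sums[of "\<lambda>_. 1" "\<lambda>k. x ^ Suc k / real (Suc k)" cos_log x] trig_log_series(1)[of x]
    by (simp only: mult_1)
next
  have ge: "2 - c17 a \<ge> 0" for a
    using cos_le_one[of "ang 17 a"] cos_ang_17[of a] by linarith
  \<comment> \<open>That no single factor vanishes is read off from the products.\<close>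
  have "(2 - c17 1) * (2 - c17 2) * (2 - c17 4) * (2 - c17 8) \<noteq> 0" "(2 - c17 3) * (2 - c17 5) * (2 - c17 6) * (2 - c17 7) \<noteq> 0"
    unfolding quartics_at_2 using sqrt_17_gt by auto
  then have nz: "2 - c17 1 \<noteq> 0" "2 - c17 2 \<noteq> 0" "2 - c17 3 \<noteq> 0" "2 - c17 4 \<noteq> 0" "2 - c17 5 \<noteq> 0" "2 - c17 6 \<noteq> 0" "2 - c17 7 \<noteq> 0" "2 - c17 8 \<noteq> 0"
    by (simp_all only: mult_eq_0_iff de_Morgan_disj not_False_eq_True simp_thms)
  have pos: "2 - c17 a > 0" if "a \<in> {1..8}" for a
  proof -
    have "a \<in> {1,2,3,4,5,6,7,8}" using that by auto
    then have "2 - c17 a \<noteq> 0" using nz by (elim insertE emptyE) (simp_all only: not_False_eq_True)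
    then show ?thesis using ge[of a] by linarith
  qed
  have "(cos_log (ang 17 a) \<longlongrightarrow> - ln (2 - c17 a) / 2) (at_left 1)" if "a \<in> {1..8}" for a
    using cos_log_tendsto[of "ang 17 a"] pos[OF that] unfolding cos_ang_17 using cos_ang_17[of a] by simp
  from chi17_comb_tendsto[of cos_log, OF this]
  have "(chi17_comb cos_log \<longlongrightarrow> 2 / sqrt 17 * (- ln (2 - c17 1) / 2 + - ln (2 - c17 2) / 2 + - ln (2 - c17 4) / 2 + - ln (2 - c17 8) / 2
     - - ln (2 - c17 3) / 2 - - ln (2 - c17 5) / 2 - - ln (2 - c17 6) / 2 - - ln (2 - c17 7) / 2)) (at_left 1)" .
  also have "2 / sqrt 17 * (- ln (2 - c17 1) / 2 + - ln (2 - c17 2) / 2 + - ln (2 - c17 4) / 2 + - ln (2 - c17 8) / 2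
     - - ln (2 - c17 3) / 2 - - ln (2 - c17 5) / 2 - - ln (2 - c17 6) / 2 - - ln (2 - c17 7) / 2)
    = ((ln (2 - c17 3) + ln (2 - c17 5) + ln (2 - c17 6) + ln (2 - c17 7))
      - (ln (2 - c17 1) + ln (2 - c17 2) + ln (2 - c17 4) + ln (2 - c17 8))) / sqrt 17"
    by (simp add: field_simps)
  also have "ln (2 - c17 3) + ln (2 - c17 5) + ln (2 - c17 6) + ln (2 - c17 7) = ln (sqrt 17 * (sqrt 17 + 4))"
    unfolding quartics_at_2(2)[symmetric] by (intro ln_prod4 pos) auto
  also have "ln (2 - c17 1) + ln (2 - c17 2) + ln (2 - c17 4) + ln (2 - c17 8) = ln (sqrt 17 * (sqrt 17 - 4))"
    unfolding quartics_at_2(1)[symmetric] by (intro ln_prod4 pos) auto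
  also have "ln (sqrt 17 * (sqrt 17 + 4)) - ln (sqrt 17 * (sqrt 17 - 4)) = 2 * ln (4 + sqrt 17)"
  proof -
    have "sqrt 17 - 4 = 1 / (4 + sqrt 17)" using sqrt_17_gt by (simp add: field_simps)
    then have "ln (sqrt 17 - 4) = - ln (4 + sqrt 17)" using sqrt_17_gt by (simp add: ln_div)
    then show ?thesis using sqrt_17_gt by (simp add: ln_mult add.commute)
  qed
  finally show "(chi17_comb cos_log \<longlongrightarrow> 2 * ln (4 + sqrt 17) / sqrt 17) (at_left 1)" .
qed (use chi_periodic chi_sum_zero chi_bounds in auto)

text \<open>The angles \<beta> + t and \<beta> - t combine: the product of the distances from 1 to
  their points on the circle is |2 cos t - 2 cos \<beta>|. Absolute values are needed since cos
  \<beta> may lie on either side.\<close>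

lemma chi8_cos_tendsto:
  assumes "2 * cos \<beta> \<noteq> sqrt 2" "2 * cos \<beta> \<noteq> - sqrt 2"
  shows "(chi8_cos \<beta> \<longlongrightarrow> (ln \<bar>- sqrt 2 - 2 * cos \<beta>\<bar> - ln \<bar>sqrt 2 - 2 * cos \<beta>\<bar>) / (2 * sqrt 2)) (at_left 1)"
proof -
  have prod: "(2 - 2 * cos (\<beta> + t)) * (2 - 2 * cos (\<beta> - t)) = (2 * cos t - 2 * cos \<beta>)\<^sup>2" for t
  proof -
    have "(2 - 2 * (c * d - s * u)) * (2 - 2 * (c * d + s * u)) = (2 * d - 2 * c)\<^sup>2"
      if "s\<^sup>2 = 1 - c\<^sup>2" "u\<^sup>2 = 1 - d\<^sup>2" for c d s u :: real
    proof -
      have "(2 - 2 * (c * d - s * u)) * (2 - 2 * (c * d + s * u)) = 4 * (1 - c * d)\<^sup>2 - 4 * s\<^sup>2 * u\<^sup>2"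
        by (simp add: power2_eq_square algebra_simps)
      also have "\<dots> = (2 * d - 2 * c)\<^sup>2" unfolding that by (simp add: power2_eq_square algebra_simps)
      finally show ?thesis .
    qed
    then show ?thesis unfolding cos_add cos_diff by (simp add: sin_squared_eq)
  qed
  have lim: "((\<lambda>x. cos_log (\<beta> + t) x + cos_log (\<beta> - t) x) \<longlongrightarrow> - ln \<bar>2 * cos t - 2 * cos \<beta>\<bar>) (at_left 1)"
    if "2 * cos \<beta> \<noteq> 2 * cos t" for t
  proof -
    have "(2 - 2 * cos (\<beta> + t)) * (2 - 2 * cos (\<beta> - t)) \<noteq> 0" unfolding prod using that by simp
    then have "2 - 2 * cos (\<beta> + t) \<noteq> 0" "2 - 2 * cos (\<beta> - t) \<noteq> 0" by (simp_all only: mult_eq_0_iff de_Morgan_disj not_False_eq_True simp_thms)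
    then have p: "cos (\<beta> + t) < 1" "cos (\<beta> - t) < 1" using cos_le_one[of "\<beta> + t"] cos_le_one[of "\<beta> - t"] by linarith+
    have "((\<lambda>x. cos_log (\<beta> + t) x + cos_log (\<beta> - t) x) \<longlongrightarrow> - ln (2 - 2 * cos (\<beta> + t)) / 2 + - ln (2 - 2 * cos (\<beta> - t)) / 2) (at_left 1)"
      by (intro tendsto_add cos_log_tendsto p)
    also have "- ln (2 - 2 * cos (\<beta> + t)) / 2 + - ln (2 - 2 * cos (\<beta> - t)) / 2 = - ln ((2 - 2 * cos (\<beta> + t)) * (2 - 2 * cos (\<beta> - t))) / 2"
      using p by (subst ln_mult) (auto simp: field_simps)
    also have "\<dots> = - ln (\<bar>2 * cos t - 2 * cos \<beta>\<bar> ^ 2) / 2" unfolding prod by simp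
    also have "\<dots> = - ln \<bar>2 * cos t - 2 * cos \<beta>\<bar>" using that by (subst ln_realpow) auto
    finally show ?thesis .
  qed
  have c: "2 * cos (pi / 4) = sqrt 2" "2 * cos (3 * pi / 4) = - sqrt 2"
  proof -
    show "2 * cos (pi / 4) = sqrt 2" by (simp add: cos_45)
    have e: "3 * pi / 4 = pi - pi / 4" by simp
    show "2 * cos (3 * pi / 4) = - sqrt 2" unfolding e cos_pi_minus by (simp add: cos_45)
  qed
  have "((\<lambda>x. ((cos_log (\<beta> + pi / 4) x + cos_log (\<beta> - pi / 4) x) - (cos_log (\<beta> + 3 * pi / 4) x + cos_log (\<beta> - 3 * pi / 4) x)) / (2 * sqrt 2))
    \<longlongrightarrow> (- ln \<bar>2 * cos (pi / 4) - 2 * cos \<beta>\<bar> - - ln \<bar>2 * cos (3 * pi / 4) - 2 * cos \<beta>\<bar>) / (2 * sqrt 2)) (at_left 1)"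
    using assms unfolding c[symmetric] by (intro tendsto_divide tendsto_diff lim tendsto_const) (auto simp: c)
  moreover have "((cos_log (\<beta> + pi / 4) x + cos_log (\<beta> - pi / 4) x) - (cos_log (\<beta> + 3 * pi / 4) x + cos_log (\<beta> - 3 * pi / 4) x)) / (2 * sqrt 2)
     = chi8_cos \<beta> x" for x
    by (simp add: chi8_cos_def diff_diff_eq)
  ultimately show ?thesis unfolding c by simp
qed

lemma L_chi136: "(dirichlet_L chi136 \<longlongrightarrow> 4 * ln (3 * sqrt 2 + sqrt 17) / sqrt 34) (at_right 1)"
proof (rule dirichlet_L_tendsto[where d = 136 and g = "chi17_comb chi8_cos"])
  fix x :: real assume x: "0 \<le> x" "x < 1"
  have "real_of_int (chi136 n) = real_of_int (chi8 n) * real_of_int (chi17 n)" for n by (simp add: chi136_def)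
  then show "(\<lambda>k. real_of_int (chi136 (Suc k)) * (x ^ Suc k / real (Suc k))) sums chi17_comb chi8_cos x"
    using chi17_comb_sums[of "\<lambda>k. real_of_int (chi8 (Suc k))" "\<lambda>k. x ^ Suc k / real (Suc k)" chi8_cos x, OF chi8_series(2)[OF x]]
    by (simp only:)
next
  let ?w = "sqrt 17" and ?A = "3 * sqrt 2 + sqrt 17" and ?B = "3 * sqrt 2 - sqrt 17"
  have AB: "?A > 0" "?B > 0" using sqrt_17_gt sqrt_17_lt by auto
  define R where "R s a = \<bar>s - c17 a\<bar>" for s a
  have pr: "R s 1 * R s 2 * R s 4 * R s 8 = \<bar>(s - c17 1) * (s - c17 2) * (s - c17 4) * (s - c17 8)\<bar>"
    "R s 3 * R s 5 * R s 6 * R s 7 = \<bar>(s - c17 3) * (s - c17 5) * (s - c17 6) * (s - c17 7)\<bar>" for s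
    by (simp_all only: R_def abs_mult)
  have q: "R (sqrt 2) 1 * R (sqrt 2) 2 * R (sqrt 2) 4 * R (sqrt 2) 8 = ?B" "R (sqrt 2) 3 * R (sqrt 2) 5 * R (sqrt 2) 6 * R (sqrt 2) 7 = ?A"
    "R (- sqrt 2) 1 * R (- sqrt 2) 2 * R (- sqrt 2) 4 * R (- sqrt 2) 8 = ?A" "R (- sqrt 2) 3 * R (- sqrt 2) 5 * R (- sqrt 2) 6 * R (- sqrt 2) 7 = ?B"
    unfolding pr quartics_at_sqrt_2 using AB by simp_all
  have nz: "R s a \<noteq> 0" if "a \<in> {1..8}" "s = sqrt 2 \<or> s = - sqrt 2" for s a
  proof -
    have "R s 1 * R s 2 * R s 4 * R s 8 \<noteq> 0" "R s 3 * R s 5 * R s 6 * R s 7 \<noteq> 0"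
      using that(2) q AB by auto
    moreover have "a \<in> {1,2,3,4,5,6,7,8}" using that(1) by auto
    ultimately show ?thesis by (elim insertE emptyE) (simp_all only: mult_eq_0_iff de_Morgan_disj not_False_eq_True)
  qed
  have Rpos: "R s a > 0" if "a \<in> {1..8}" "s = sqrt 2 \<or> s = - sqrt 2" for s a
    using nz[OF that] by (simp add: R_def)
  have "(chi8_cos (ang 17 a) \<longlongrightarrow> (ln (R (- sqrt 2) a) - ln (R (sqrt 2) a)) / (2 * sqrt 2)) (at_left 1)" if "a \<in> {1..8}" for a
    using chi8_cos_tendsto[of "ang 17 a"] nz[OF that, of "sqrt 2"] nz[OF that, of "- sqrt 2"]
    unfolding cos_ang_17 R_def by simp
  from chi17_comb_tendsto[of chi8_cos, OF this]
  have "(chi17_comb chi8_cos \<longlongrightarrow> 2 / sqrt 17 * ((ln (R (- sqrt 2) 1) - ln (R (sqrt 2) 1)) / (2 * sqrt 2) + (ln (R (- sqrt 2) 2) - ln (R (sqrt 2) 2)) / (2 * sqrt 2)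
     + (ln (R (- sqrt 2) 4) - ln (R (sqrt 2) 4)) / (2 * sqrt 2) + (ln (R (- sqrt 2) 8) - ln (R (sqrt 2) 8)) / (2 * sqrt 2)
     - (ln (R (- sqrt 2) 3) - ln (R (sqrt 2) 3)) / (2 * sqrt 2) - (ln (R (- sqrt 2) 5) - ln (R (sqrt 2) 5)) / (2 * sqrt 2)
     - (ln (R (- sqrt 2) 6) - ln (R (sqrt 2) 6)) / (2 * sqrt 2) - (ln (R (- sqrt 2) 7) - ln (R (sqrt 2) 7)) / (2 * sqrt 2))) (at_left 1)"
    (is "(_ \<longlongrightarrow> ?V) _") .
  moreover have "?V = 4 * ln ?A / sqrt 34"
  proof -
    have l: "ln (R s 1) + ln (R s 2) + ln (R s 4) + ln (R s 8) = ln (R s 1 * R s 2 * R s 4 * R s 8)"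
      "ln (R s 3) + ln (R s 5) + ln (R s 6) + ln (R s 7) = ln (R s 3 * R s 5 * R s 6 * R s 7)"
      if "s = sqrt 2 \<or> s = - sqrt 2" for s
      using that by (intro ln_prod4 Rpos; simp)+
    have "?V = ((ln (R (- sqrt 2) 1) + ln (R (- sqrt 2) 2) + ln (R (- sqrt 2) 4) + ln (R (- sqrt 2) 8))
       - (ln (R (sqrt 2) 1) + ln (R (sqrt 2) 2) + ln (R (sqrt 2) 4) + ln (R (sqrt 2) 8))
       - (ln (R (- sqrt 2) 3) + ln (R (- sqrt 2) 5) + ln (R (- sqrt 2) 6) + ln (R (- sqrt 2) 7))
       + (ln (R (sqrt 2) 3) + ln (R (sqrt 2) 5) + ln (R (sqrt 2) 6) + ln (R (sqrt 2) 7))) / (sqrt 17 * sqrt 2)"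
      by (simp add: add_divide_distrib diff_divide_distrib algebra_simps)
    also have "\<dots> = (2 * ln ?A - 2 * ln ?B) / (sqrt 17 * sqrt 2)"
    proof -
      have s: "sqrt 2 = sqrt 2 \<or> sqrt 2 = - sqrt 2" "- sqrt 2 = sqrt 2 \<or> - sqrt 2 = - sqrt 2" by simp_all
      show ?thesis unfolding l[OF s(1)] l[OF s(2)] q by simp
    qed
    also have "ln ?B = - ln ?A"
    proof -
      have "?B * ?A = 1" by (simp add: algebra_simps)
      then have "?B = 1 / ?A" using AB by (simp add: field_simps)
      then show ?thesis using AB by (simp add: ln_div)
    qed
    also have "sqrt 17 * sqrt 2 = sqrt 34" by (simp flip: real_sqrt_mult)
    finally show ?thesis by simp
  qed
  ultimately show "(chi17_comb chi8_cos \<longlongrightarrow> 4 * ln ?A / sqrt 34) (at_left 1)" by (simp only:)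
qed (use chi_periodic chi_sum_zero chi_bounds in auto)

text \<open>The row expansion and the L-values compute the same limit at s = 1. Clearing the common
  factor 2 pi / sqrt 238 leaves minus the logarithm of \<open>b 34 7\<close> on the left.\<close>

lemma euler_at_log:
  "3 * pi * sqrt 238 / 14 - ln 7 - 2 * (ln (euler_at 1) + ln (euler_at 2) - ln (euler_at 7) - ln (euler_at 14))
    = 2 * (ln (4 + sqrt 17) + ln (3 * sqrt 2 + sqrt 17))"
proof -
  define M where "M = ln (4 + sqrt 17) + ln (3 * sqrt 2 + sqrt 17)"
  define N where "N = ln (euler_at 1) + ln (euler_at 2) - ln (euler_at 7) - ln (euler_at 14)"
  have "((\<lambda>s. dirichlet_L chi17 s * dirichlet_L chi56 s + dirichlet_L chi136 s * dirichlet_L chi7 s) \<longlongrightarrow>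
     2 * ln (4 + sqrt 17) / sqrt 17 * (2 * pi / sqrt 14) + 4 * ln (3 * sqrt 2 + sqrt 17) / sqrt 34 * (pi / sqrt 7)) (at_right 1)"
    by (intro tendsto_intros L_chi7 L_chi17 L_chi56 L_chi136)
  moreover have "\<forall>\<^sub>F s in at_right 1. dirichlet_L chi17 s * dirichlet_L chi56 s + dirichlet_L chi136 s * dirichlet_L chi7 s
     = epstein 1 238 s + epstein 2 119 s - epstein 7 34 s - epstein 14 17 s"
    using eventually_at_right_less[of 1] by eventually_elim (simp add: epstein_L_factorization)
  ultimately have "((\<lambda>s. epstein 1 238 s + epstein 2 119 s - epstein 7 34 s - epstein 14 17 s) \<longlongrightarrow>
     2 * ln (4 + sqrt 17) / sqrt 17 * (2 * pi / sqrt 14) + 4 * ln (3 * sqrt 2 + sqrt 17) / sqrt 34 * (pi / sqrt 7)) (at_right 1)"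
    by (rule Lim_transform_eventually)
  from tendsto_unique[OF _ this genus_epstein_tendsto]
  have e: "2 * ln (4 + sqrt 17) / sqrt 17 * (2 * pi / sqrt 14) + 4 * ln (3 * sqrt 2 + sqrt 17) / sqrt 34 * (pi / sqrt 7)
    = 3 * pi\<^sup>2 / 7 - pi * ln 49 / sqrt 238 - 4 * pi / sqrt 238 * N"
    unfolding N_def by simp
  \<comment> \<open>Both products of L-values thus acquire the denominator sqrt 238 of the analytic
    side.\<close>
  have r: "sqrt 17 * sqrt 14 = sqrt 238" "sqrt 34 * sqrt 7 = sqrt 238" by (simp_all flip: real_sqrt_mult)
  have "2 * ln (4 + sqrt 17) / sqrt 17 * (2 * pi / sqrt 14) + 4 * ln (3 * sqrt 2 + sqrt 17) / sqrt 34 * (pi / sqrt 7)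
     = 4 * pi * M / sqrt 238"
    unfolding times_divide_times_eq r M_def by (simp add: add_divide_distrib[symmetric] algebra_simps)
  moreover have "ln (49 :: real) = 2 * ln 7" using ln_realpow[of "7 :: real" 2] by simp
  ultimately have "4 * pi * M / sqrt 238 = 3 * pi\<^sup>2 / 7 - pi * (2 * ln 7) / sqrt 238 - 4 * pi / sqrt 238 * N" using e by simp
  then have "4 * pi * M = (3 * pi\<^sup>2 / 7 - pi * (2 * ln 7) / sqrt 238 - 4 * pi / sqrt 238 * N) * sqrt 238"
    by (simp add: divide_eq_eq)
  also have "\<dots> = 2 * pi * (3 * pi * sqrt 238 / 14 - ln 7 - 2 * N)"
    by (simp add: field_simps power2_eq_square)
  finally have "2 * pi * (2 * M) = 2 * pi * (3 * pi * sqrt 238 / 14 - ln 7 - 2 * N)" by simp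
  then show ?thesis unfolding M_def N_def by simp
qed

theorem corollary2p8:
  shows "b 34 7 = (3 * sqrt 2 - sqrt 17)\<^sup>2 * (sqrt 17 - 4)\<^sup>2"
proof -
  define r where "r = sqrt (238 :: real)"
  define N where "N = ln (euler_at 1) + ln (euler_at 2) - ln (euler_at 7) - ln (euler_at 14)"
  \<comment> \<open>Since 34 * 7 = 238, all four nomes in \<open>b\<close> are exponentials in sqrt
    238 and in a seventh of it, matching the forms 1, 2 and 7, 14.\<close>
  have "34 / 7 = 238 / (7 :: real)\<^sup>2" by simp
  then have s1: "sqrt (34 / 7) = r / 7" by (simp only: r_def real_sqrt_divide real_sqrt_abs abs_numeral)
  have s2: "sqrt 238 = r" by (simp add: r_def)
  have pair: "ramanujan_psi (- exp (- pi * t)) * ramanujan_phi (- exp (- 2 * pi * t)) = euler_fn (exp (- pi * t)) * euler_fn (exp (- 2 * pi * t))"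
    if "t > 0" for t :: real
  proof -
    have "exp (- 2 * pi * t) = (exp (- pi * t))\<^sup>2" by (simp add: power2_eq_square flip: exp_add)
    then show ?thesis using psi_phi_product[of "exp (- pi * t)"] that by simp
  qed
  have r0: "r > 0" by (simp add: r_def)
  have E: "euler_at 1 = euler_fn (exp (- 2 * pi * r))" "euler_at 2 = euler_fn (exp (- pi * r))"
    "euler_at 7 = euler_fn (exp (- 2 * pi * (r / 7)))" "euler_at 14 = euler_fn (exp (- pi * (r / 7)))"
    by (simp_all add: euler_at_def r_def)
  have pos: "euler_at a > 0" for a by (simp add: euler_at_def euler_fn_pos)
  have "b 34 7 = 7 * exp (- (pi / 4) * 6 * (r / 7)) * (ramanujan_psi (- exp (- pi * r)) * ramanujan_phi (- exp (- 2 * pi * r)))\<^sup>2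
     / (ramanujan_psi (- exp (- pi * (r / 7))) * ramanujan_phi (- exp (- 2 * pi * (r / 7))))\<^sup>2"
    by (simp add: b_def Let_def s1 s2 power_mult_distrib mult.assoc)
  also have "\<dots> = 7 * exp (- (pi / 4) * 6 * (r / 7)) * (euler_at 2 * euler_at 1)\<^sup>2 / (euler_at 14 * euler_at 7)\<^sup>2"
    using pair[of r] pair[of "r / 7"] r0 by (simp add: E)
  also have "\<dots> = exp (- (3 * pi * r / 14 - ln 7 - 2 * N))"
  proof -
    have "(euler_at 2 * euler_at 1)\<^sup>2 / (euler_at 14 * euler_at 7)\<^sup>2 = exp (2 * N)"
    proof -
      have "exp N = euler_at 2 * euler_at 1 / (euler_at 14 * euler_at 7)"
        unfolding N_def exp_diff exp_add using pos by (simp add: field_simps)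
      then show ?thesis by (simp add: exp_double power_divide)
    qed
    from this[symmetric] have "7 * exp (- (pi / 4) * 6 * (r / 7)) * (euler_at 2 * euler_at 1)\<^sup>2 / (euler_at 14 * euler_at 7)\<^sup>2
       = exp (ln 7) * exp (- (pi / 4) * 6 * (r / 7)) * exp (2 * N)" by simp
    also have "\<dots> = exp (- (3 * pi * r / 14 - ln 7 - 2 * N))"
      unfolding exp_add[symmetric] by (rule arg_cong[of _ _ exp]) (simp add: field_simps)
    finally show ?thesis .
  qed
  also have "\<dots> = (exp (- (ln (3 * sqrt 2 + sqrt 17) + ln (4 + sqrt 17))))\<^sup>2"
    unfolding N_def r_def euler_at_log exp_double[symmetric] by (simp add: algebra_simps)
  also have "exp (- (ln (3 * sqrt 2 + sqrt 17) + ln (4 + sqrt 17))) = (3 * sqrt 2 - sqrt 17) * (sqrt 17 - 4)"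
  proof -
    have "(3 * sqrt 2 - sqrt 17) * (3 * sqrt 2 + sqrt 17) = 1" "(sqrt 17 - 4) * (4 + sqrt 17) = 1"
      by (simp_all add: algebra_simps)
    moreover have "3 * sqrt 2 + sqrt 17 > 0" "4 + sqrt 17 > 0" using sqrt_17_gt by (simp_all add: add_pos_pos)
    ultimately have "inverse (3 * sqrt 2 + sqrt 17) = 3 * sqrt 2 - sqrt 17" "inverse (4 + sqrt 17) = sqrt 17 - 4"
      by (simp_all add: inverse_unique mult.commute)
    then show ?thesis
      using \<open>3 * sqrt 2 + sqrt 17 > 0\<close> \<open>4 + sqrt 17 > 0\<close>
      unfolding exp_minus exp_add by simp
  qed
  finally show ?thesis by (simp add: power_mult_distrib)
qed

end
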